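(* Let $k\ge1$, let $K$ be a field of characteristic $\mathrm{char}(K)=0$ or $\mathrm{char}(K)>k$, let $n\ge 1$, let $\mathfrak{q}=\langle X_1,\dots,X_n\rangle$ be the homogeneous maximal ideal of $A=K[X_1,\dots,X_n]$, and let $S=A/\mathfrak{q}^k$. Then: (a) For every $m\ge1$, we have $$\dim_K\big(d\mathfrak{q}^k\wedge\Omega^{m-1}_{A/K}\big)_{m+k-1}=\binom{n}{m}\binom{n+k-2}{n-1}-\binom{m+k-2}{m}\binom{n+k-2}{n-m-1}.$$ (b) For every $m\ge1$, we have $$\dim_K(\Omega^m_{S/K})=\binom{n}{m}\binom{n+k-2}{n}+\binom{m+k-2}{m}\binom{n+k-2}{n-m-1}.$$
   Context: For a $K$-algebra $B$, $\Omega^m_{B/K}=\Lambda^m_B\Omega^1_{B/K}$ is the module of Kähler differential $m$-forms, with $\Omega^0_{B/K}=B$. The polynomial ring $A$ has the standard grading, and $\Omega^m_{A/K}$ is the graded free $A$-module with basis $\{dX_{i_1}\wedge\cdots\wedge dX_{i_m}\mid 1\le i_1<\cdots<i_m\le n\}$, whose basis elements have degree $m$. $d\mathfrak{q}^k$ denotes the $A$-submodule of $\Omega^1_{A/K}$ generated by $\{df\mid f\in\mathfrak{q}^k\}$, and $d\mathfrak{q}^k\wedge\Omega^{m-1}_{A/K}$ is the $A$-submodule of $\Omega^m_{A/K}$ generated by the products $u\wedge w$ with $u\in d\mathfrak{q}^k$, $w\in\Omega^{m-1}_{A/K}$; the subscript $m+k-1$ denotes its homogeneous component of degree $m+k-1$.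 Binomial coefficients $\binom{a}{b}$ are $0$ if $b<0$ or $a<b$. *)

theory Defs
  imports
    "Jordan_Normal_Form.VS_Connect"
    "HOL-Algebra.QuotRing"
    "HOL-Algebra.Ideal_Product"
    "HOL-Library.Poly_Mapping"
begin

text \<open>
  The fields \<open>mult\<close> and \<open>one\<close> of a module record carry no meaning and are left undefined,
  as in \<^const>\<open>module_vec\<close>.
\<close>

definition free_module :: "('b, 'c) ring_scheme \<Rightarrow> 'i set \<Rightarrow> ('b, 'i \<Rightarrow> 'b) module" where
  "free_module B I =
    \<lparr> carrier = {f. (\<forall>i\<in>I. f i \<in> carrier B) \<and> (\<forall>i. i \<notin> I \<longrightarrow> f i = \<zero>\<^bsub>B\<^esub>) \<and> finite {i. f i \<noteq> \<zero>\<^bsub>B\<^esub>}},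
      mult = undefined, one = undefined,
      zero = (\<lambda>_. \<zero>\<^bsub>B\<^esub>),
      add = (\<lambda>f g i. f i \<oplus>\<^bsub>B\<^esub> g i),
      smult = (\<lambda>b f i. b \<otimes>\<^bsub>B\<^esub> f i) \<rparr>"

definition free_gen :: "('b, 'c) ring_scheme \<Rightarrow> 'i \<Rightarrow> 'i \<Rightarrow> 'b" where
  "free_gen B i = (\<lambda>j. if j = i then \<one>\<^bsub>B\<^esub> else \<zero>\<^bsub>B\<^esub>)"

text \<open>The quotient of \<open>M\<close> by a submodule \<open>N\<close>, formed from cosets in the same way as \<^const>\<open>FactRing\<close>.\<close>

definition quot_module :: "('b, 'x, 'e) module_scheme \<Rightarrow> 'x set \<Rightarrow> ('b, 'x set) module" where
  "quot_module M N =
    \<lparr> carrier = a_rcosets\<^bsub>M\<^esub> N,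
      mult = undefined, one = undefined,
      zero = N,
      add = set_add M,
      smult = (\<lambda>b X. \<Union>x\<in>X. N +>\<^bsub>M\<^esub> (b \<odot>\<^bsub>M\<^esub> x)) \<rparr>"

definition restrict_scalars :: "('a \<Rightarrow> 'b) \<Rightarrow> ('b, 'x, 'e) module_scheme \<Rightarrow> ('a, 'x) module" where
  "restrict_scalars \<phi> M =
    \<lparr> carrier = carrier M, mult = undefined, one = undefined,
      zero = \<zero>\<^bsub>M\<^esub>, add = add M, smult = (\<lambda>a x. \<phi> a \<odot>\<^bsub>M\<^esub> x) \<rparr>"

text \<open>
  \<^const>\<open>vectorspace.dim\<close> is a \<^const>\<open>Least\<close> over finite generating sets, so it is meaningful
  only for finite-dimensional vector spaces. The dimension \<open>d\<close> is an integer because the formulas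
  for it involve subtraction.
\<close>

definition has_dimension :: "('a, 'c) ring_scheme \<Rightarrow> ('a, 'x, 'e) module_scheme \<Rightarrow> int \<Rightarrow> bool" where
  "has_dimension K V d \<longleftrightarrow>
    vectorspace K V \<and> vectorspace.fin_dim K V \<and> int (vectorspace.dim K V) = d"

text \<open>
  A \<open>K\<close>-algebra is given by a commutative ring \<open>B\<close> and its structure homomorphism \<open>\<phi> : K \<rightarrow> B\<close>.
  \<open>\<Omega>\<^sup>1\<close> is the free \<open>B\<close>-module on the symbols \<open>db\<close> for \<open>b \<in> B\<close>, modulo additivity,
  the Leibniz rule and \<open>d (\<phi> a) = 0\<close>; \<open>K\<close>-linearity of \<open>d\<close> follows from these.
\<close>

definition kaehler_relations ::
    "('a, 'c) ring_scheme \<Rightarrow> ('b, 'e) ring_scheme \<Rightarrow> ('a \<Rightarrow> 'b) \<Rightarrow> ('b \<Rightarrow> 'b) set" where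
  "kaehler_relations K B \<phi> =
    (let F = free_module B (carrier B); e = free_gen B in
      {e (b \<oplus>\<^bsub>B\<^esub> c) \<ominus>\<^bsub>F\<^esub> (e b \<oplus>\<^bsub>F\<^esub> e c) | b c. b \<in> carrier B \<and> c \<in> carrier B}
    \<union> {e (b \<otimes>\<^bsub>B\<^esub> c) \<ominus>\<^bsub>F\<^esub> (b \<odot>\<^bsub>F\<^esub> e c \<oplus>\<^bsub>F\<^esub> c \<odot>\<^bsub>F\<^esub> e b) | b c. b \<in> carrier B \<and> c \<in> carrier B}
    \<union> {e (\<phi> a) | a. a \<in> carrier K})"

definition kaehler_submodule ::
    "('a, 'c) ring_scheme \<Rightarrow> ('b, 'e) ring_scheme \<Rightarrow> ('a \<Rightarrow> 'b) \<Rightarrow> ('b \<Rightarrow> 'b) set" where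
  "kaehler_submodule K B \<phi> = LinearCombinations.module.span B (free_module B (carrier B)) (kaehler_relations K B \<phi>)"

definition kaehler ::
    "('a, 'c) ring_scheme \<Rightarrow> ('b, 'e) ring_scheme \<Rightarrow> ('a \<Rightarrow> 'b) \<Rightarrow> ('b, ('b \<Rightarrow> 'b) set) module" where
  "kaehler K B \<phi> = quot_module (free_module B (carrier B)) (kaehler_submodule K B \<phi>)"

definition kaehler_d ::
    "('a, 'c) ring_scheme \<Rightarrow> ('b, 'e) ring_scheme \<Rightarrow> ('a \<Rightarrow> 'b) \<Rightarrow> 'b \<Rightarrow> ('b \<Rightarrow> 'b) set" where
  "kaehler_d K B \<phi> b =
    kaehler_submodule K B \<phi> +>\<^bsub>free_module B (carrier B)\<^esub> free_gen B b"

text \<open>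
  \<open>\<Lambda>\<^sup>m M\<close> is the free \<open>B\<close>-module on \<open>m\<close>-tuples of elements of \<open>M\<close> (lists of length \<open>m\<close>), modulo
  multilinearity and the vanishing of tuples with a repeated entry. For \<open>m = 0\<close> this is the free
  module on the empty tuple, i.e. \<open>B\<close>.
\<close>

definition tuples :: "('b, 'x, 'e) module_scheme \<Rightarrow> nat \<Rightarrow> 'x list set" where
  "tuples M m = {xs. length xs = m \<and> set xs \<subseteq> carrier M}"

definition ext_relations ::
    "('b, 'c) ring_scheme \<Rightarrow> ('b, 'x, 'e) module_scheme \<Rightarrow> nat \<Rightarrow> ('x list \<Rightarrow> 'b) set" where
  "ext_relations B M m =
    (let F = free_module B (tuples M m); e = free_gen B in
      {e (xs[i := x \<oplus>\<^bsub>M\<^esub> y]) \<ominus>\<^bsub>F\<^esub> (e (xs[i := x]) \<oplus>\<^bsub>F\<^esub> e (xs[i := y])) | xs i x y.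
         xs \<in> tuples M m \<and> i < m \<and> x \<in> carrier M \<and> y \<in> carrier M}
    \<union> {e (xs[i := b \<odot>\<^bsub>M\<^esub> x]) \<ominus>\<^bsub>F\<^esub> b \<odot>\<^bsub>F\<^esub> e (xs[i := x]) | xs i b x.
         xs \<in> tuples M m \<and> i < m \<and> b \<in> carrier B \<and> x \<in> carrier M}
    \<union> {e xs | xs. xs \<in> tuples M m \<and> \<not> distinct xs})"

definition ext_submodule ::
    "('b, 'c) ring_scheme \<Rightarrow> ('b, 'x, 'e) module_scheme \<Rightarrow> nat \<Rightarrow> ('x list \<Rightarrow> 'b) set" where
  "ext_submodule B M m = LinearCombinations.module.span B (free_module B (tuples M m)) (ext_relations B M m)"

definition ext_power ::
    "('b, 'c) ring_scheme \<Rightarrow> ('b, 'x, 'e) module_scheme \<Rightarrow> nat \<Rightarrow> ('b, ('x list \<Rightarrow> 'b) set) module" where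
  "ext_power B M m = quot_module (free_module B (tuples M m)) (ext_submodule B M m)"

text \<open>\<open>wedge_list B M [x\<^sub>1, \<dots>, x\<^sub>m]\<close> is \<open>x\<^sub>1 \<and> \<dots> \<and> x\<^sub>m\<close>.\<close>

definition wedge_list ::
    "('b, 'c) ring_scheme \<Rightarrow> ('b, 'x, 'e) module_scheme \<Rightarrow> 'x list \<Rightarrow> ('x list \<Rightarrow> 'b) set" where
  "wedge_list B M xs =
    ext_submodule B M (length xs) +>\<^bsub>free_module B (tuples M (length xs))\<^esub> free_gen B xs"

text \<open>
  The product \<open>M \<times> \<Lambda>\<^sup>m M \<rightarrow> \<Lambda>\<^sup>m\<^sup>+\<^sup>1 M\<close>. On the free modules, \<open>u \<and> _\<close> is the linear map
  \<open>free_cons B u\<close> sending the generator \<open>xs\<close> to the generator \<open>u # xs\<close>;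
  \<open>wedge_left\<close> is the map it induces on cosets.
\<close>

definition free_cons :: "('b, 'c) ring_scheme \<Rightarrow> 'x \<Rightarrow> ('x list \<Rightarrow> 'b) \<Rightarrow> 'x list \<Rightarrow> 'b" where
  "free_cons B u f =
    (\<lambda>ys. case ys of [] \<Rightarrow> \<zero>\<^bsub>B\<^esub> | y # xs \<Rightarrow> if y = u then f xs else \<zero>\<^bsub>B\<^esub>)"

definition wedge_left ::
    "('b, 'c) ring_scheme \<Rightarrow> ('b, 'x, 'e) module_scheme \<Rightarrow> nat \<Rightarrow> 'x \<Rightarrow> ('x list \<Rightarrow> 'b) set \<Rightarrow>
      ('x list \<Rightarrow> 'b) set" where
  "wedge_left B M m u w =
    (\<Union>f\<in>w. ext_submodule B M (Suc m) +>\<^bsub>free_module B (tuples M (Suc m))\<^esub> free_cons B u f)"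

definition kaehler_forms ::
    "('a, 'c) ring_scheme \<Rightarrow> ('b, 'e) ring_scheme \<Rightarrow> ('a \<Rightarrow> 'b) \<Rightarrow> nat \<Rightarrow>
      ('b, (('b \<Rightarrow> 'b) set list \<Rightarrow> 'b) set) module" where
  "kaehler_forms K B \<phi> m = ext_power B (kaehler K B \<phi>) m"

text \<open>
  Polynomials in the variables \<open>X\<^sub>0, X\<^sub>1, \<dots>\<close> with coefficients in \<open>'k\<close>; \<open>poly_ring n\<close> is the
  subring of those involving only \<open>X\<^sub>1, \<dots>, X\<^sub>n\<close>.
\<close>

type_synonym 'k mpol = "(nat \<Rightarrow>\<^sub>0 nat) \<Rightarrow>\<^sub>0 'k"

definition poly_ring :: "nat \<Rightarrow> 'k::field mpol ring" where
  "poly_ring n = class_ring\<lparr>carrier := {p. \<forall>t\<in>Poly_Mapping.keys p. Poly_Mapping.keys t \<subseteq> {1..n}}\<rparr>"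

definition poly_const :: "'k::field \<Rightarrow> 'k mpol" where
  "poly_const c = Poly_Mapping.single 0 c"

definition poly_var :: "nat \<Rightarrow> 'k::field mpol" where
  "poly_var i = Poly_Mapping.single (Poly_Mapping.single i 1) 1"

definition homogeneous :: "nat \<Rightarrow> 'k::field mpol \<Rightarrow> bool" where
  "homogeneous j p \<longleftrightarrow>
    (\<forall>t\<in>Poly_Mapping.keys p. (\<Sum>i\<in>Poly_Mapping.keys t. Poly_Mapping.lookup t i) = j)"

text \<open>
  \<open>irrelevant_ideal n\<close> is \<open>q\<close>, \<open>irrelevant_power n k\<close> is \<open>q\<^sup>k\<close>, and \<open>trunc_ring n k\<close> is \<open>S = A / q\<^sup>k\<close>,
  a \<open>K\<close>-algebra through \<open>trunc_const n k\<close>.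
\<close>

definition irrelevant_ideal :: "nat \<Rightarrow> 'k::field mpol set" where
  "irrelevant_ideal n = Idl\<^bsub>poly_ring n\<^esub> (poly_var ` {1..n})"

definition irrelevant_power :: "nat \<Rightarrow> nat \<Rightarrow> 'k::field mpol set" where
  "irrelevant_power n k = irrelevant_ideal n [^]\<^bsub>ideals_set (poly_ring n)\<^esub> k"

definition trunc_ring :: "nat \<Rightarrow> nat \<Rightarrow> 'k::field mpol set ring" where
  "trunc_ring n k = poly_ring n Quot irrelevant_power n k"

definition trunc_const :: "nat \<Rightarrow> nat \<Rightarrow> 'k::field \<Rightarrow> 'k mpol set" where
  "trunc_const n k c = irrelevant_power n k +>\<^bsub>poly_ring n\<^esub> poly_const c"

abbreviation poly_kaehler :: "nat \<Rightarrow> ('k::field mpol, ('k mpol \<Rightarrow> 'k mpol) set) module" where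
  "poly_kaehler n \<equiv> kaehler class_ring (poly_ring n) poly_const"

abbreviation poly_forms ::
    "nat \<Rightarrow> nat \<Rightarrow> ('k::field mpol, (('k mpol \<Rightarrow> 'k mpol) set list \<Rightarrow> 'k mpol) set) module" where
  "poly_forms n m \<equiv> kaehler_forms class_ring (poly_ring n) poly_const m"

abbreviation poly_d :: "nat \<Rightarrow> 'k::field mpol \<Rightarrow> ('k mpol \<Rightarrow> 'k mpol) set" where
  "poly_d n \<equiv> kaehler_d class_ring (poly_ring n) poly_const"

text \<open>
  The component of degree \<open>j\<close> of \<open>\<Omega>\<^sup>m\<close>, spanned over the field by the products \<open>f dX\<^sub>i\<^sub>1 \<and> \<dots> \<and> dX\<^sub>i\<^sub>m\<close>
  with \<open>i\<^sub>1 < \<dots> < i\<^sub>m\<close> and \<open>f\<close> homogeneous of degree \<open>j - m\<close>.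
\<close>

definition forms_component ::
    "nat \<Rightarrow> nat \<Rightarrow> nat \<Rightarrow> (('k::field mpol \<Rightarrow> 'k mpol) set list \<Rightarrow> 'k mpol) set set" where
  "forms_component n m j =
    LinearCombinations.module.span (class_ring :: 'k ring) (restrict_scalars poly_const (poly_forms n m))
      {f \<odot>\<^bsub>poly_forms n m\<^esub> wedge_list (poly_ring n) (poly_kaehler n) (map (poly_d n \<circ> poly_var) is)
        | f l is. f \<in> carrier (poly_ring n) \<and> homogeneous l f \<and> l + m = j \<and>
            length is = m \<and> set is \<subseteq> {1..n} \<and> sorted_wrt (<) is}"

definition d_irrelevant_power :: "nat \<Rightarrow> nat \<Rightarrow> ('k::field mpol \<Rightarrow> 'k mpol) set set" where
  "d_irrelevant_power n k =
    LinearCombinations.module.span (poly_ring n) (poly_kaehler n) (poly_d n ` irrelevant_power n k)"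

text \<open>The submodule \<open>dq\<^sup>k \<and> \<Omega>\<^sup>m\<^sup>-\<^sup>1\<close> of \<open>\<Omega>\<^sup>m\<close>, for \<open>m \<ge> 1\<close>.\<close>

definition d_irrelevant_power_wedge ::
    "nat \<Rightarrow> nat \<Rightarrow> nat \<Rightarrow> (('k::field mpol \<Rightarrow> 'k mpol) set list \<Rightarrow> 'k mpol) set set" where
  "d_irrelevant_power_wedge n k m =
    LinearCombinations.module.span (poly_ring n) (poly_forms n m)
      {wedge_left (poly_ring n) (poly_kaehler n) (m - 1) u w | u w.
        u \<in> d_irrelevant_power n k \<and> w \<in> carrier (poly_forms n (m - 1))}"

text \<open>
  The lower index is an integer because, e.g., \<open>n - m - 1\<close> may be negative, where the coefficient
  has to vanish; subtraction on \<^typ>\<open>nat\<close> would give \<open>1\<close> instead.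
\<close>

definition ibinom :: "int \<Rightarrow> int \<Rightarrow> int" where
  "ibinom a b = (if b < 0 \<or> a < b then 0 else int (nat a choose nat b))"

end

theory Submission
  imports Defs "HOL-Library.Function_Algebras"
begin

text \<open>
  If \<open>B = A / J\<close>, then \<open>\<Omega>\<^sup>m\<close> of \<open>B\<close> is the free \<open>A\<close>-module on the \<open>dX\<^sub>I\<close> with \<open>|I| = m\<close>, modulo
  \<open>J \<Omega>\<^sup>m\<close> and \<open>dJ \<and> \<Omega>\<^sup>m\<^sup>-\<^sup>1\<close>. For \<open>J = q\<^sup>k\<close> the first submodule consists of all forms with coefficients
  of degree at least \<open>k\<close>, so only the coefficients of degree \<open>k - 1\<close> of the second one matter. These
  make up exactly the closed forms: the de Rham complex is exact there, by a homotopy that divides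
  only by numbers up to \<open>k\<close>. The homotopy also shows that a closed form is determined by its
  coefficients at those monomials \<open>X\<^sup>a dX\<^sub>I\<close> whose smallest variable occurs in \<open>dX\<^sub>I\<close>, and that these
  coefficients are arbitrary. Both formulas count such monomials.
\<close>

text \<open>The classical homotopy contracts with the Euler field and divides by the weight of the
  form, here \<open>m + k - 1\<close>. Only the numbers up to \<open>k\<close> are known to be
  invertible, so for \<open>m > 1\<close> this could be a division by zero. Contracting with one
  variable only, the smallest one in the monomial form, replaces the weight by an exponent that is
  at most \<open>k\<close>. Singling out a variable in this way is what separates leading from
  non-leading monomials.

  A relation need not be closed. Only the part of its derivative in degrees below
  \<open>k - 1\<close> is known to vanish, and this much is enough for the homotopy.

  The other obstacle is that the modules of differentials are quotients of free modules on all ring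
  elements and on all tuples, so that no basis is visible. A map from them to coordinates requires a
  choice of polynomial representatives and is linear only up to relations. It is therefore kept on
  the free modules, with its defects shown to be relations; the quotient of the coordinate forms by
  the relations is never formed.\<close>

section \<open>Monomials and their degrees\<close>

definition mdeg :: "(nat \<Rightarrow>\<^sub>0 nat) \<Rightarrow> nat" where
  "mdeg t = (\<Sum>i\<in>Poly_Mapping.keys t. Poly_Mapping.lookup t i)"

abbreviation unit_exp :: "nat \<Rightarrow> nat \<Rightarrow>\<^sub>0 nat" where
  "unit_exp i \<equiv> Poly_Mapping.single i (Suc 0)"

lemma mdeg_eq_sum:
  assumes "finite S" and "Poly_Mapping.keys t \<subseteq> S"
  shows "mdeg t = (\<Sum>i\<in>S. Poly_Mapping.lookup t i)"
  unfolding mdeg_def using assms by (intro sum.mono_neutral_left) (auto simp: in_keys_iff)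

lemma mdeg_add: "mdeg (s + t) = mdeg s + mdeg t"
proof -
  let ?S = "Poly_Mapping.keys s \<union> Poly_Mapping.keys t"
  have "mdeg (s + t) = (\<Sum>i\<in>?S. Poly_Mapping.lookup (s + t) i)"
    by (rule mdeg_eq_sum) (auto simp: keys_add)
  also have "\<dots> = mdeg s + mdeg t"
    by (simp add: lookup_add sum.distrib mdeg_eq_sum[of ?S])
  finally show ?thesis .
qed

lemma mdeg_single [simp]: "mdeg (Poly_Mapping.single i c) = c"
  by (simp add: mdeg_def)

lemma mdeg_zero [simp]: "mdeg 0 = 0"
  by (simp add: mdeg_def)

lemma mdeg_eq_0_iff: "mdeg t = 0 \<longleftrightarrow> t = 0"
proof
  assume "mdeg t = 0"
  then show "t = 0"
    by (intro poly_mapping_eqI) (auto simp: mdeg_def in_keys_iff)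
qed simp

lemma keys_add_nat:
  "Poly_Mapping.keys (s + t :: 'a \<Rightarrow>\<^sub>0 nat) = Poly_Mapping.keys s \<union> Poly_Mapping.keys t"
  by (auto simp: in_keys_iff lookup_add)

lemma diff_unit_exp_add:
  assumes "i \<in> Poly_Mapping.keys t"
  shows "(t - unit_exp i) + unit_exp i = t"
  using assms
  by (intro poly_mapping_eqI) (auto simp: lookup_add lookup_minus lookup_single when_def in_keys_iff)

text \<open>The \<open>single\<close> case concerns only the terms of \<open>p\<close> itself, so
  whatever is known about the monomials of \<open>p\<close>, such as a lower bound on their degrees,
  is available there.\<close>

lemma poly_mapping_add_induct [case_names zero single add]:
  fixes p :: "'a \<Rightarrow>\<^sub>0 'b::comm_monoid_add"
  assumes "P 0"
    and "\<And>t. t \<in> Poly_Mapping.keys p \<Longrightarrow> P (Poly_Mapping.single t (Poly_Mapping.lookup p t))"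
    and "\<And>f g. P f \<Longrightarrow> P g \<Longrightarrow> P (f + g)"
  shows "P p"
proof -
  have p: "p = (\<Sum>t\<in>Poly_Mapping.keys p. Poly_Mapping.single t (Poly_Mapping.lookup p t))"
  proof (rule poly_mapping_eqI)
    fix k
    show "Poly_Mapping.lookup p k
      = Poly_Mapping.lookup (\<Sum>t\<in>Poly_Mapping.keys p. Poly_Mapping.single t (Poly_Mapping.lookup p t)) k"
      by (simp add: lookup_sum lookup_single when_def sum.delta in_keys_iff)
  qed
  have "P (\<Sum>t\<in>S. Poly_Mapping.single t (Poly_Mapping.lookup p t))"
    if "finite S" "S \<subseteq> Poly_Mapping.keys p" for S
    using that by (induction S) (auto intro: assms)
  then show ?thesis
    by (subst p) simp
qed

subsection \<open>Partial derivatives\<close>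

definition pd :: "nat \<Rightarrow> 'k::comm_semiring_1 mpol \<Rightarrow> 'k mpol" where
  "pd i p = Abs_poly_mapping
     (\<lambda>a. of_nat (Poly_Mapping.lookup a i + 1) * Poly_Mapping.lookup p (a + unit_exp i))"

text \<open>The function passed to \<open>Abs_poly_mapping\<close> has finite support, since this
  support lies in the preimage of the keys of \<open>p\<close> under an injective shift.\<close>

lemma lookup_pd:
  "Poly_Mapping.lookup (pd i p) a
    = of_nat (Poly_Mapping.lookup a i + 1) * Poly_Mapping.lookup p (a + unit_exp i)"
proof -
  have "finite ((\<lambda>a. a + unit_exp i) -` Poly_Mapping.keys p)"
    by (intro finite_vimageI) (auto simp: inj_def)
  then have "finite {a. of_nat (Poly_Mapping.lookup a i + 1) * Poly_Mapping.lookup p (a + unit_exp i) \<noteq> 0}"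
    by (rule rev_finite_subset) (auto simp: in_keys_iff)
  then show ?thesis
    by (simp add: pd_def)
qed

lemma pd_zero [simp]: "pd i 0 = 0"
  by (intro poly_mapping_eqI) (simp add: lookup_pd)

lemma pd_add: "pd i (p + q) = pd i p + pd i q"
  by (intro poly_mapping_eqI) (simp add: lookup_pd lookup_add algebra_simps)

lemma pd_sum: "pd i (sum f S) = (\<Sum>x\<in>S. pd i (f x))"
  by (induction S rule: infinite_finite_induct) (simp_all add: pd_add)

lemma pd_uminus: "pd i (- p :: 'k::comm_ring_1 mpol) = - pd i p"
  by (intro poly_mapping_eqI) (simp add: lookup_pd)

lemma pd_commute: "pd i (pd j p) = pd j (pd i p)"
proof (cases "i = j")
  case False
  then show ?thesis
    by (intro poly_mapping_eqI)
      (simp add: lookup_pd lookup_add lookup_single add.assoc add.commute[of "unit_exp i"] mult.left_commute)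
qed simp

text \<open>The truncated subtraction \<open>s - unit_exp i\<close> leaves \<open>s\<close>
  unchanged if X_i does not occur, but then the coefficient carries the factor
  \<open>of_nat 0\<close>.\<close>

lemma pd_single:
  "pd i (Poly_Mapping.single s x)
    = Poly_Mapping.single (s - unit_exp i) (of_nat (Poly_Mapping.lookup s i) * x)"
proof (cases "i \<in> Poly_Mapping.keys s")
  case True
  then have "s - unit_exp i = a \<longleftrightarrow> s = a + unit_exp i" for a
    by (metis diff_unit_exp_add add_diff_cancel_right')
  moreover have "Poly_Mapping.lookup (s - unit_exp i) i + 1 = Poly_Mapping.lookup s i"
    using True by (simp add: lookup_minus in_keys_iff)
  ultimately show ?thesis
    by (intro poly_mapping_eqI) (auto simp: lookup_pd lookup_add lookup_single when_def)
next
  case False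
  then have "s \<noteq> a + unit_exp i" for a
    by (auto simp: keys_add_nat)
  with False show ?thesis
    by (intro poly_mapping_eqI) (auto simp: lookup_pd lookup_single in_keys_iff)
qed

lemma pd_mult_single:
  "pd i (Poly_Mapping.single s x * Poly_Mapping.single t y)
    = pd i (Poly_Mapping.single s x) * Poly_Mapping.single t y
      + Poly_Mapping.single s x * pd i (Poly_Mapping.single t y)"
proof -
  \<comment> \<open>Truncated subtraction can be moved across the sum only if X_i occurs in
    \<open>u\<close>. In the other case the derivative of that factor has coefficient zero.\<close>
  have shift: "u - unit_exp i + v = u + v - unit_exp i"
    if "Poly_Mapping.lookup u i \<noteq> 0" for u v
    using that
    by (intro poly_mapping_eqI) (auto simp: lookup_add lookup_minus lookup_single when_def)
  have 1: "pd i (Poly_Mapping.single s x) * Poly_Mapping.single t y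
      = Poly_Mapping.single (s + t - unit_exp i) (of_nat (Poly_Mapping.lookup s i) * (x * y))"
    by (cases "Poly_Mapping.lookup s i = 0") (simp_all add: pd_single mult_single shift mult.assoc)
  have 2: "Poly_Mapping.single s x * pd i (Poly_Mapping.single t y)
      = Poly_Mapping.single (s + t - unit_exp i) (of_nat (Poly_Mapping.lookup t i) * (x * y))"
    using shift[of t s]
    by (cases "Poly_Mapping.lookup t i = 0") (simp_all add: pd_single mult_single add_ac mult_ac)
  show ?thesis
    unfolding 1 2
    by (simp add: mult_single pd_single single_add[symmetric] lookup_add algebra_simps)
qed

lemma pd_mult: "pd i (p * q) = pd i p * q + p * pd i q"
proof (induction p rule: poly_mapping_add_induct)
  case (single s)
  show ?case
    by (induction q rule: poly_mapping_add_induct)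
       (simp_all add: pd_mult_single pd_add algebra_simps)
qed (simp_all add: pd_add algebra_simps)

subsection \<open>The polynomial ring\<close>

lemma poly_ring_simps [simp]:
  "mult (poly_ring n) = (*)" "one (poly_ring n) = 1"
  "zero (poly_ring n) = 0" "add (poly_ring n) = (+)"
  by (simp_all add: poly_ring_def)

lemma carrier_poly_ring:
  "carrier (poly_ring n) = {p. \<forall>t\<in>Poly_Mapping.keys p. Poly_Mapping.keys t \<subseteq> {1..n}}"
  by (simp add: poly_ring_def)

lemma poly_ring_zero [simp]: "0 \<in> carrier (poly_ring n)"
  and poly_ring_one [simp]: "1 \<in> carrier (poly_ring n)"
  and poly_ring_const [simp]: "poly_const c \<in> carrier (poly_ring n)"
  and poly_ring_var: "i \<in> {1..n} \<Longrightarrow> poly_var i \<in> carrier (poly_ring n)"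
  by (auto simp: carrier_poly_ring poly_const_def poly_var_def)

lemma poly_ring_single:
  "Poly_Mapping.keys t \<subseteq> {1..n} \<Longrightarrow> Poly_Mapping.single t c \<in> carrier (poly_ring n)"
  by (auto simp: carrier_poly_ring)

lemma poly_ring_add: "f \<in> carrier (poly_ring n) \<Longrightarrow> g \<in> carrier (poly_ring n)
    \<Longrightarrow> f + g \<in> carrier (poly_ring n)"
  using keys_add[of f g] by (fastforce simp: carrier_poly_ring)

lemma poly_ring_uminus: "f \<in> carrier (poly_ring n) \<Longrightarrow> - f \<in> carrier (poly_ring n)"
  by (auto simp: carrier_poly_ring in_keys_iff)

lemma poly_ring_diff: "f \<in> carrier (poly_ring n) \<Longrightarrow> g \<in> carrier (poly_ring n)
    \<Longrightarrow> f - g \<in> carrier (poly_ring n)"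
  using poly_ring_add[of f n "- g"] poly_ring_uminus[of g n] by simp

lemma poly_ring_mult: "f \<in> carrier (poly_ring n) \<Longrightarrow> g \<in> carrier (poly_ring n)
    \<Longrightarrow> f * g \<in> carrier (poly_ring n)"
  using keys_mult[of f g] by (fastforce simp: carrier_poly_ring keys_add_nat)

lemma poly_ring_sum: "(\<And>x. x \<in> S \<Longrightarrow> f x \<in> carrier (poly_ring n))
    \<Longrightarrow> sum f S \<in> carrier (poly_ring n)"
  by (induction S rule: infinite_finite_induct) (auto intro: poly_ring_add)

lemma poly_ring_pd: "f \<in> carrier (poly_ring n) \<Longrightarrow> pd i f \<in> carrier (poly_ring n)"
proof -
  assume f: "f \<in> carrier (poly_ring n)"
  have "Poly_Mapping.keys t \<subseteq> {1..n}" if "t \<in> Poly_Mapping.keys (pd i f)" for t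
  proof -
    have "t + unit_exp i \<in> Poly_Mapping.keys f"
      using that by (auto simp: in_keys_iff lookup_pd)
    with f have "Poly_Mapping.keys (t + unit_exp i) \<subseteq> {1..n}"
      unfolding carrier_poly_ring by blast
    then show ?thesis
      unfolding keys_add_nat by blast
  qed
  then show ?thesis
    unfolding carrier_poly_ring by blast
qed

lemmas poly_ring_closed = poly_ring_add poly_ring_uminus poly_ring_diff poly_ring_mult
  poly_ring_sum poly_ring_pd

lemma cring_poly_ring: "cring (poly_ring n :: 'k::field mpol ring)"
proof -
  have "\<exists>y\<in>carrier (poly_ring n). y + x = 0" if "x \<in> carrier (poly_ring n)" for x :: "'k mpol"
    using that poly_ring_uminus[of x n] by (intro bexI[of _ "- x"]) auto
  then show ?thesis
    by (intro cringI abelian_groupI comm_monoidI)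
       (auto simp: poly_ring_closed algebra_simps)
qed

lemma a_inv_poly_ring:
  assumes "f \<in> carrier (poly_ring n)"
  shows "\<ominus>\<^bsub>poly_ring n\<^esub> f = - f"
proof -
  interpret cring "poly_ring n :: 'a mpol ring" by (rule cring_poly_ring)
  show ?thesis
    using assms poly_ring_uminus[OF assms] by (intro minus_equality) auto
qed

lemma single_eq_var_mult:
  "i \<in> Poly_Mapping.keys t \<Longrightarrow>
    Poly_Mapping.single t c = poly_var i * Poly_Mapping.single (t - unit_exp i) (c::'k::field)"
  by (simp add: poly_var_def mult_single add.commute[of "unit_exp i" "t - unit_exp i"] diff_unit_exp_add)

lemma mdeg_diff_unit_exp:
  "i \<in> Poly_Mapping.keys t \<Longrightarrow> mdeg (t - unit_exp i) + 1 = mdeg t"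
  using mdeg_add[of "t - unit_exp i" "unit_exp i"] by (simp add: diff_unit_exp_add)

lemma keys_diff_unit_exp: "Poly_Mapping.keys (t - unit_exp i) \<subseteq> Poly_Mapping.keys t"
  by (auto simp: in_keys_iff lookup_minus)

text \<open>The ring is generated as an algebra by constants and variables. The rule serves to
  recognise a derivation by its values on the variables; the cases \<open>add\<close> and
  \<open>mult\<close> keep the membership of the operands because the rules for \<open>\<pi>\<close>
  and \<open>d\<close> ask for it.\<close>

lemma poly_ring_induct [consumes 1, case_names const var add mult]:
  fixes p :: "'k::field mpol"
  assumes "p \<in> carrier (poly_ring n)"
    and const: "\<And>c. P (poly_const c)"
    and var: "\<And>i. i \<in> {1..n} \<Longrightarrow> P (poly_var i)"
    and add: "\<And>f g. f \<in> carrier (poly_ring n) \<Longrightarrow> g \<in> carrier (poly_ring n) \<Longrightarrow> P f \<Longrightarrow> P g \<Longrightarrow> P (f + g)"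
    and mult: "\<And>f g. f \<in> carrier (poly_ring n) \<Longrightarrow> g \<in> carrier (poly_ring n) \<Longrightarrow> P f \<Longrightarrow> P g \<Longrightarrow> P (f * g)"
  shows "P p"
proof -
  have monom: "P (Poly_Mapping.single t c)" if "Poly_Mapping.keys t \<subseteq> {1..n}" for t c
    using that
  proof (induction "mdeg t" arbitrary: t)
    case 0
    then show ?case
      using const[of c] by (simp add: mdeg_eq_0_iff poly_const_def)
  next
    case (Suc d)
    then obtain i where i: "i \<in> Poly_Mapping.keys t"
      by (fastforce simp: mdeg_def)
    have keys: "Poly_Mapping.keys (t - unit_exp i) \<subseteq> {1..n}"
      using Suc.prems keys_diff_unit_exp by blast
    have "P (Poly_Mapping.single (t - unit_exp i) c)"
      using Suc.hyps mdeg_diff_unit_exp[OF i] keys by simp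
    then show ?case
      unfolding single_eq_var_mult[OF i]
      using i Suc.prems keys by (intro mult var poly_ring_var poly_ring_single) auto
  qed
  have "p \<in> carrier (poly_ring n) \<and> P p"
  proof (induction p rule: poly_mapping_add_induct)
    case zero
    show ?case using const[of 0] by (simp add: poly_const_def)
  next
    case (single t)
    then have "Poly_Mapping.keys t \<subseteq> {1..n}"
      using assms(1) by (auto simp: carrier_poly_ring)
    then show ?case
      by (simp add: monom poly_ring_single)
  qed (auto intro: add poly_ring_add)
  then show ?thesis ..
qed

subsection \<open>Concrete differential forms\<close>

text \<open>
  Induction methods eta-expand goals, upon which the simplifier would apply these rules under the
  abstraction and leave the algebraic language.
\<close>

lemmas fun_ops = plus_fun_apply zero_fun_apply minus_apply uminus_apply
declare fun_ops [simp del]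
declare One_nat_def [simp del]

text \<open>The free module on \<open>S\<close> in coordinates, used with \<open>{1..n}\<close> for
  one-forms and \<open>ksubsets n m\<close> for m-forms. Values outside \<open>S\<close> are fixed
  to zero, so that equal forms are equal functions.\<close>

definition fns :: "nat \<Rightarrow> 'i set \<Rightarrow> ('i \<Rightarrow> 'k::field mpol) set" where
  "fns n S = {w. (\<forall>i. w i \<in> carrier (poly_ring n)) \<and> (\<forall>i. i \<notin> S \<longrightarrow> w i = 0)}"

definition ksubsets :: "nat \<Rightarrow> nat \<Rightarrow> nat set set" where
  "ksubsets n m = {I. I \<subseteq> {1..n} \<and> card I = m}"

abbreviation covecs :: "nat \<Rightarrow> (nat \<Rightarrow> 'k::field mpol) set" where
  "covecs n \<equiv> fns n {1..n}"

abbreviation forms :: "nat \<Rightarrow> nat \<Rightarrow> (nat set \<Rightarrow> 'k::field mpol) set" where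
  "forms n m \<equiv> fns n (ksubsets n m)"

definition smul :: "'a::times \<Rightarrow> ('i \<Rightarrow> 'a) \<Rightarrow> 'i \<Rightarrow> 'a" where
  "smul f w = (\<lambda>i. f * w i)"

definition bump :: "'i \<Rightarrow> 'a::zero \<Rightarrow> 'i \<Rightarrow> 'a" where
  "bump i f = (\<lambda>j. if j = i then f else 0)"

lemma finite_ksubsets [simp]: "finite (ksubsets n m)"
  by (rule finite_subset[of _ "Pow {1..n}"]) (auto simp: ksubsets_def)

lemma ksubsets_finite: "I \<in> ksubsets n m \<Longrightarrow> finite I"
  by (auto simp: ksubsets_def intro: finite_subset)

lemma sum_fun_apply: "(\<Sum>x\<in>S. f x) i = (\<Sum>x\<in>S. f x i)"
  by (induction S rule: infinite_finite_induct) (simp_all add: fun_ops)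

lemma fns_apply: "w \<in> fns n S \<Longrightarrow> w i \<in> carrier (poly_ring n)"
  by (simp add: fns_def)

lemma fns_zero [simp]: "0 \<in> fns n S"
  and fns_add: "v \<in> fns n S \<Longrightarrow> w \<in> fns n S \<Longrightarrow> v + w \<in> fns n S"
  and fns_uminus: "w \<in> fns n S \<Longrightarrow> - w \<in> fns n S"
  and fns_diff: "v \<in> fns n S \<Longrightarrow> w \<in> fns n S \<Longrightarrow> v - w \<in> fns n S"
  and fns_smul: "f \<in> carrier (poly_ring n) \<Longrightarrow> w \<in> fns n S \<Longrightarrow> smul f w \<in> fns n S"
  and fns_bump: "f \<in> carrier (poly_ring n) \<Longrightarrow> i \<in> S \<Longrightarrow> bump i f \<in> fns n S"
  by (auto simp: fns_def smul_def bump_def poly_ring_closed fun_ops)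

lemma fns_sum: "(\<And>x. x \<in> X \<Longrightarrow> w x \<in> fns n S) \<Longrightarrow> sum w X \<in> fns n S"
  by (induction X rule: infinite_finite_induct) (auto intro: fns_add)

lemma smul_simps [simp]:
  fixes w :: "'i \<Rightarrow> 'a::comm_ring_1"
  shows "smul 0 w = 0" "smul f 0 = 0" "smul 1 w = w" "smul f (smul g w) = smul (f * g) w"
    "smul f (- w) = - smul f w" "smul (- f) w = - smul f w" "smul f (bump i g) = bump i (f * g)"
  by (auto simp: smul_def bump_def fun_eq_iff mult.assoc fun_ops)

lemma smul_add: "smul f (v + w) = smul f v + smul f w"
  and smul_add_left: "smul (f + g) w = smul f w + smul g w"
  and smul_diff: "smul f (v - w) = smul f v - smul f w"
  and smul_diff_left: "smul (f - g) w = smul f w - smul g w"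
  for w :: "'i \<Rightarrow> 'a::comm_ring_1"
  by (auto simp: smul_def fun_eq_iff algebra_simps fun_ops)

lemma smul_sum: "smul f (\<Sum>x\<in>X. w x) = (\<Sum>x\<in>X. smul f (w x))"
  for w :: "'x \<Rightarrow> 'i \<Rightarrow> 'a::comm_ring_1"
  by (induction X rule: infinite_finite_induct) (simp_all add: smul_add)

lemma bump_simps [simp]: "bump i 0 = 0" "bump i f i = f"
  and bump_diff: "bump i (f - g) = bump i f - bump i g"
  for f :: "'a::ab_group_add"
  by (auto simp: bump_def fun_eq_iff fun_ops)

lemma fns_eq_sum:
  assumes "w \<in> fns n S" and "finite S"
  shows "w = (\<Sum>i\<in>S. bump i (w i))"
  using assms by (auto simp: fns_def bump_def fun_eq_iff sum_fun_apply)

lemma fns_induct [consumes 2, case_names zero bump add]: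
  assumes "w \<in> fns n S" and "finite S"
    and zero: "P 0"
    and bump: "\<And>i f. i \<in> S \<Longrightarrow> f \<in> carrier (poly_ring n) \<Longrightarrow> P (bump i f)"
    and add: "\<And>v w. v \<in> fns n S \<Longrightarrow> w \<in> fns n S \<Longrightarrow> P v \<Longrightarrow> P w \<Longrightarrow> P (v + w)"
  shows "P w"
proof -
  have "P (\<Sum>i\<in>X. bump i (w i)) \<and> (\<Sum>i\<in>X. bump i (w i)) \<in> fns n S" if "X \<subseteq> S" for X
    using finite_subset[OF that \<open>finite S\<close>] that
    by (induction X) (auto simp: zero intro!: add bump fns_add fns_bump fns_apply[OF assms(1)])
  then have "P (\<Sum>i\<in>S. bump i (w i))" by blast
  then show ?thesis
    using fns_eq_sum[OF assms(1,2)] by simp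
qed

section \<open>Exterior product, gradient and exterior derivative in coordinates\<close>

definition sg :: "nat \<Rightarrow> nat set \<Rightarrow> 'a::comm_ring_1" where
  "sg i I = (- 1) ^ card {j\<in>I. j < i}"

text \<open>The coefficient of dX_I in the product: any i in I may come from \<open>u\<close>, and
  \<open>sg i I\<close> is the sign of moving dX_i from the front to its place in dX_I. For infinite
  I the sum is 0 by convention.\<close>

definition wedge :: "(nat \<Rightarrow> 'a::comm_ring_1) \<Rightarrow> (nat set \<Rightarrow> 'a) \<Rightarrow> nat set \<Rightarrow> 'a" where
  "wedge u w = (\<lambda>I. \<Sum>i\<in>I. sg i I * u i * w (I - {i}))"

definition grad :: "nat \<Rightarrow> 'k::comm_ring_1 mpol \<Rightarrow> nat \<Rightarrow> 'k mpol" where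
  "grad n f = (\<lambda>i. if i \<in> {1..n} then pd i f else 0)"

definition ext_deriv :: "(nat set \<Rightarrow> 'k::comm_ring_1 mpol) \<Rightarrow> nat set \<Rightarrow> 'k mpol" where
  "ext_deriv w = (\<lambda>I. \<Sum>i\<in>I. sg i I * pd i (w (I - {i})))"

text \<open>Taking out the smaller of two elements first lowers by one the number of elements below
  the larger, whereas taking out the larger first changes nothing for the smaller.\<close>

lemma sg_swap:
  assumes "finite I" "i \<in> I" "j \<in> I" "i \<noteq> j"
  shows "sg i I * sg j (I - {i}) = - (sg j I * sg i (I - {j}) :: 'a::comm_ring_1)"
proof -
  have less: "sg i I * sg j (I - {i}) = - (sg j I * sg i (I - {j}) :: 'a)"
    if "finite I" "i \<in> I" "j \<in> I" "i < j" for i j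
  proof -
    have "{l \<in> I. l < j} = insert i {l \<in> I - {i}. l < j}"
      using that by auto
    then have "card {l \<in> I. l < j} = Suc (card {l \<in> I - {i}. l < j})"
      using that by simp
    moreover have "{l \<in> I - {j}. l < i} = {l \<in> I. l < i}"
      using that by auto
    ultimately show ?thesis
      by (simp add: sg_def)
  qed
  show ?thesis
    using less[of i j] less[of j i] assms by (cases "i < j") auto
qed

text \<open>The terms of (i, j) and (j, i) cancel. Cancelling them in pairs, instead of showing that
  the sum equals its own negative, covers characteristic 2. It is applied to the square of a
  one-form and to the second derivatives of a polynomial.\<close>

lemma alternating_sum_eq_0:
  fixes T :: "nat \<Rightarrow> nat \<Rightarrow> 'a::comm_ring_1"
  assumes sym: "\<And>i j. i \<in> I \<Longrightarrow> j \<in> I \<Longrightarrow> T i j = T j i"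
  shows "(\<Sum>i\<in>I. \<Sum>j\<in>I - {i}. sg i I * sg j (I - {i}) * T i j) = 0"
proof (cases "finite I")
  case True
  define F where "F = (\<lambda>(i, j). sg i I * sg j (I - {i}) * T i j)"
  let ?P = "{(i, j). i \<in> I \<and> j \<in> I \<and> i < j}" and ?Q = "{(i, j). i \<in> I \<and> j \<in> I \<and> j < i}"
  have fin: "finite ?P" "finite ?Q"
    by (rule finite_subset[of _ "I \<times> I"]; use True in auto)+
  have "(\<Sum>i\<in>I. \<Sum>j\<in>I - {i}. sg i I * sg j (I - {i}) * T i j) = sum F (Sigma I (\<lambda>i. I - {i}))"
    using True by (simp add: sum.Sigma F_def)
  also have "Sigma I (\<lambda>i. I - {i}) = ?P \<union> ?Q"
    by auto
  also have "sum F (?P \<union> ?Q) = sum F ?P + sum F ?Q"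
    by (rule sum.union_disjoint) (use fin in auto)
  also have "sum F ?Q = sum (F \<circ> prod.swap) ?P"
    by (rule sum.reindex_bij_betw[symmetric, of prod.swap, unfolded o_def[symmetric]])
       (auto simp: bij_betw_def image_iff)
  also have "\<dots> = sum (\<lambda>p. - F p) ?P"
  proof (rule sum.cong)
    fix p assume "p \<in> ?P"
    then show "(F \<circ> prod.swap) p = - F p"
      using True sg_swap[of I "fst p" "snd p", where 'a='a] sym[of "fst p" "snd p"]
      by (auto simp: F_def)
  qed simp
  finally show ?thesis
    by (simp add: sum_negf)
qed simp

lemma wedge_add: "wedge u (v + w) = wedge u v + wedge u w"
  and wedge_add_left: "wedge (u + u') w = wedge u w + wedge u' w"
  and wedge_smul: "wedge u (smul f w) = smul f (wedge u w)"
  and wedge_smul_left: "wedge (smul f u) w = smul f (wedge u w)"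
  by (auto simp: wedge_def smul_def fun_eq_iff algebra_simps sum.distrib sum_distrib_left fun_ops)

lemma wedge_zero [simp]: "wedge u 0 = 0" "wedge 0 w = 0"
  and wedge_uminus: "wedge u (- w) = - wedge u w"
  and wedge_uminus_left: "wedge (- u) w = - wedge u w"
  by (auto simp: wedge_def fun_eq_iff sum_negf fun_ops)

lemma wedge_diff: "wedge u (v - w) = wedge u v - wedge u w"
  and wedge_diff_left: "wedge (u - u') w = wedge u w - wedge u' w"
  using wedge_add[of u v "- w"] wedge_add_left[of u "- u'" w]
  by (simp_all add: wedge_uminus wedge_uminus_left)

lemma wedge_self: "wedge u (wedge u w) = 0"
proof (rule ext)
  fix I
  have "wedge u (wedge u w) I
      = (\<Sum>i\<in>I. \<Sum>j\<in>I - {i}. sg i I * sg j (I - {i}) * (u i * u j * w (I - {i} - {j})))"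
    by (simp add: wedge_def sum_distrib_left mult_ac)
  also have "\<dots> = 0"
  proof (rule alternating_sum_eq_0)
    fix i j
    have "I - {i} - {j} = I - {j} - {i}" by auto
    then show "u i * u j * w (I - {i} - {j}) = u j * u i * w (I - {j} - {i})"
      by (simp add: mult.commute)
  qed
  finally show "wedge u (wedge u w) I = 0 I" by (simp add: fun_ops)
qed

lemma wedge_anticomm: "wedge u (wedge v w) = - wedge v (wedge u w)"
proof -
  have "wedge (u + v) (wedge (u + v) w) = 0"
    by (rule wedge_self)
  then show ?thesis
    by (simp add: wedge_add wedge_add_left wedge_self eq_neg_iff_add_eq_0 add.commute)
qed

lemma wedge_forms:
  assumes "u \<in> covecs n" and "w \<in> forms n m"
  shows "wedge u w \<in> forms n (Suc m)"
proof -
  have "wedge u w I = 0" if "I \<notin> ksubsets n (Suc m)" for I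
  proof (cases "finite I")
    case True
    have "sg i I * u i * w (I - {i}) = 0" if i: "i \<in> I" for i
    proof (rule ccontr)
      assume "sg i I * u i * w (I - {i}) \<noteq> 0"
      then have "u i \<noteq> 0" "w (I - {i}) \<noteq> 0" by auto
      then have "i \<in> {1..n}" "I - {i} \<in> ksubsets n m"
        using assms by (auto simp: fns_def)
      then have "I \<in> ksubsets n (Suc m)"
        using i True card_Suc_Diff1[OF True i] by (auto simp: ksubsets_def)
      with \<open>I \<notin> _\<close> show False ..
    qed
    then show ?thesis
      by (simp add: wedge_def)
  qed (simp add: wedge_def)
  moreover have "sg i I \<in> carrier (poly_ring n)" for i I
    by (cases "even (card {j\<in>I. j < i})") (auto simp: sg_def poly_ring_uminus)
  ultimately show ?thesis
    using assms by (auto simp: fns_def wedge_def intro!: poly_ring_closed)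
qed

lemma wedge_bump:
  assumes "finite J"
  shows "wedge (bump i g) (bump J f)
    = (if i \<in> J then 0 else bump (insert i J) (sg i (insert i J) * g * f))"
proof (rule ext)
  fix I
  have *: "wedge (bump i g) (bump J f) I = (\<Sum>l\<in>I. if l = i \<and> I - {i} = J then sg i I * g * f else 0)"
    by (auto simp: wedge_def bump_def intro!: sum.cong)
  show "wedge (bump i g) (bump J f) I
    = (if i \<in> J then 0 else bump (insert i J) (sg i (insert i J) * g * f)) I"
  proof (cases "i \<in> I \<and> I - {i} = J")
    case True
    then have "finite I" "i \<notin> J" "I = insert i J"
      using assms by auto
    then show ?thesis
      unfolding * using True by (simp add: bump_def fun_ops)
  next
    case False
    then have "i \<notin> J \<Longrightarrow> I \<noteq> insert i J" by auto
    moreover have "(\<Sum>l\<in>I. if l = i \<and> I - {i} = J then sg i I * g * f else 0) = 0"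
      using False by (intro sum.neutral) auto
    ultimately show ?thesis
      unfolding * by (simp add: bump_def fun_ops)
  qed
qed

lemma grad_covecs: "f \<in> carrier (poly_ring n) \<Longrightarrow> grad n f \<in> covecs n"
  by (auto simp: grad_def fns_def poly_ring_closed)

lemma grad_add: "grad n (f + g) = grad n f + grad n g"
  and grad_mult: "grad n (f * g) = smul f (grad n g) + smul g (grad n f)"
  by (auto simp: grad_def fun_eq_iff pd_add pd_mult smul_def mult.commute fun_ops)

lemma grad_zero [simp]: "grad n 0 = 0"
  by (auto simp: grad_def fun_eq_iff fun_ops)

lemma grad_uminus: "grad n (- f) = - grad n f"
  by (auto simp: grad_def fun_eq_iff pd_uminus fun_ops)

lemma grad_diff: "grad n (f - g) = grad n f - grad n g"
  using grad_add[of n f "- g"] by (simp add: grad_uminus)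

lemma grad_const [simp]: "grad n (poly_const c) = 0"
  by (auto simp: grad_def poly_const_def pd_single fun_eq_iff fun_ops)

lemma grad_var: "i \<in> {1..n} \<Longrightarrow> grad n (poly_var i) = bump i 1"
  by (auto simp: grad_def poly_var_def pd_single fun_eq_iff bump_def lookup_single One_nat_def)

text \<open>The factor \<open>bump {} 1\<close> is the constant 1 as a form of degree 0.\<close>

definition wedges :: "(nat \<Rightarrow> 'a::comm_ring_1) list \<Rightarrow> nat set \<Rightarrow> 'a" where
  "wedges us = foldr wedge us (bump {} 1)"

lemma wedges_simps [simp]: "wedges [] = bump {} 1" "wedges (u # us) = wedge u (wedges us)"
  by (simp_all add: wedges_def)

lemma wedges_forms: "set us \<subseteq> covecs n \<Longrightarrow> wedges us \<in> forms n (length us)"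
proof (induction us)
  case Nil
  then show ?case by (auto intro: fns_bump simp: ksubsets_def)
qed (auto intro: wedge_forms)

text \<open>Anticommutativity carries \<open>u\<close> past the factors in front of its own
  occurrence, where its square vanishes.\<close>

lemma wedge_wedges_mem: "u \<in> set us \<Longrightarrow> wedge u (wedges us) = 0"
proof (induction us)
  case (Cons v us)
  then show ?case
    using wedge_anticomm[of u v "wedges us"] by (auto simp: wedge_self)
qed simp

lemma wedges_not_distinct: "\<not> distinct us \<Longrightarrow> wedges us = 0"
  by (induction us) (auto simp: wedge_wedges_mem)

lemma wedges_update_add:
  "i < length us \<Longrightarrow> wedges (us[i := x + y]) = wedges (us[i := x]) + wedges (us[i := y])"
  by (induction us arbitrary: i) (auto split: nat.splits simp: wedge_add wedge_add_left)

lemma wedges_update_smul: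
  "i < length us \<Longrightarrow> wedges (us[i := smul f x]) = smul f (wedges (us[i := x]))"
  by (induction us arbitrary: i) (auto split: nat.splits simp: wedge_smul wedge_smul_left)

text \<open>An increasing list is multiplied up from its end, so that each new index lies below all
  earlier ones and no sign arises.\<close>

lemma wedges_bump:
  assumes "sorted_wrt (<) js"
  shows "wedges (map (\<lambda>i. bump i 1) js) = bump (set js) (1::'a::comm_ring_1)"
  using assms
proof (induction js)
  case (Cons i js)
  then have "{j \<in> insert i (set js). j < i} = {}" and "i \<notin> set js"
    by auto
  then have "sg i (insert i (set js)) = (1::'a)"
    unfolding sg_def by (simp only: card.empty power_0)
  then show ?case
    using Cons \<open>i \<notin> set js\<close> by (simp add: wedge_bump)
qed simp

subsection \<open>The relations imposed by an ideal\<close>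

text \<open>The submodule J \<Omega>^1 + A dJ of the one-forms of A. Negatives come from scaling by
  -1.\<close>

inductive_set rel_covecs :: "nat \<Rightarrow> 'k::field mpol set \<Rightarrow> (nat \<Rightarrow> 'k mpol) set" for n J where
  zero: "0 \<in> rel_covecs n J"
| smul: "f \<in> J \<Longrightarrow> u \<in> covecs n \<Longrightarrow> smul f u \<in> rel_covecs n J"
| grad: "f \<in> J \<Longrightarrow> g \<in> carrier (poly_ring n) \<Longrightarrow> smul g (grad n f) \<in> rel_covecs n J"
| add: "u \<in> rel_covecs n J \<Longrightarrow> v \<in> rel_covecs n J \<Longrightarrow> u + v \<in> rel_covecs n J"

text \<open>The degree m part of the ideal that J and dJ generate in the exterior algebra, namely J
  \<Omega>^m + dJ \<and> \<Omega>^(m-1). In degree 0 the condition \<open>m = Suc l\<close> leaves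
  only J itself. A scalar in front of \<open>grad n f\<close> can be absorbed into
  \<open>w\<close>.\<close>

inductive_set rel_forms :: "nat \<Rightarrow> 'k::field mpol set \<Rightarrow> nat \<Rightarrow> (nat set \<Rightarrow> 'k mpol) set" for n J m where
  zero: "0 \<in> rel_forms n J m"
| smul: "f \<in> J \<Longrightarrow> w \<in> forms n m \<Longrightarrow> smul f w \<in> rel_forms n J m"
| grad: "f \<in> J \<Longrightarrow> w \<in> forms n l \<Longrightarrow> m = Suc l \<Longrightarrow> wedge (grad n f) w \<in> rel_forms n J m"
| add: "v \<in> rel_forms n J m \<Longrightarrow> w \<in> rel_forms n J m \<Longrightarrow> v + w \<in> rel_forms n J m"

context
  fixes n :: nat and J :: "'k::field mpol set"
  assumes J: "J \<subseteq> carrier (poly_ring n)"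
begin

lemma rel_covecs_subset: "u \<in> rel_covecs n J \<Longrightarrow> u \<in> covecs n"
  by (induction rule: rel_covecs.induct) (use J in \<open>auto intro!: fns_add fns_smul grad_covecs\<close>)

lemma rel_forms_subset: "w \<in> rel_forms n J m \<Longrightarrow> w \<in> forms n m"
  by (induction rule: rel_forms.induct)
     (use J in \<open>auto intro: fns_add fns_smul grad_covecs wedge_forms\<close>)

lemma rel_covecs_smul:
  assumes "u \<in> rel_covecs n J" "g \<in> carrier (poly_ring n)"
  shows "smul g u \<in> rel_covecs n J"
  using assms(1)
proof induction
  case (smul f u)
  then have "smul f (smul g u) \<in> rel_covecs n J"
    using assms(2) by (intro rel_covecs.smul fns_smul)
  then show ?case by (simp add: mult.commute)
next
  case (grad f h)
  then show ?case
    using assms(2) by (simp add: rel_covecs.grad poly_ring_mult)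
qed (auto simp: smul_add intro: rel_covecs.intros)

lemma rel_forms_smul:
  assumes "w \<in> rel_forms n J m" "g \<in> carrier (poly_ring n)"
  shows "smul g w \<in> rel_forms n J m"
  using assms(1)
proof induction
  case (smul f w)
  then have "smul f (smul g w) \<in> rel_forms n J m"
    using assms(2) by (intro rel_forms.smul fns_smul)
  then show ?case by (simp add: mult.commute)
next
  case (grad f w l)
  then show ?case
    using assms(2) by (auto simp flip: wedge_smul intro!: rel_forms.grad fns_smul)
qed (auto simp: smul_add intro: rel_forms.intros)

lemma rel_forms_uminus: "w \<in> rel_forms n J m \<Longrightarrow> - w \<in> rel_forms n J m"
  using rel_forms_smul[of w m "- 1"] by (simp add: poly_ring_uminus)

lemma rel_forms_diff: "v \<in> rel_forms n J m \<Longrightarrow> w \<in> rel_forms n J m \<Longrightarrow> v - w \<in> rel_forms n J m"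
  using rel_forms.add[of v n J m "- w"] rel_forms_uminus by simp

text \<open>A factor \<open>u\<close> passes the differential of \<open>f\<close> at the cost of a
  sign and joins \<open>w\<close>. Together with \<open>wedge_rel_left\<close> this is the ideal
  property of the relations.\<close>

lemma wedge_rel_right:
  assumes "u \<in> covecs n" and "w \<in> rel_forms n J m"
  shows "wedge u w \<in> rel_forms n J (Suc m)"
  using assms(2)
proof induction
  case (smul f w)
  then show ?case
    using assms(1) by (auto simp: wedge_smul intro!: rel_forms.smul wedge_forms)
next
  case (grad f w l)
  have "wedge u (wedge (grad n f) w) = wedge (grad n f) (- wedge u w)"
    by (subst wedge_anticomm) (simp add: wedge_uminus)
  also have "\<dots> \<in> rel_forms n J (Suc m)"
    using grad assms(1) by (intro rel_forms.grad[where l = m]) (auto intro!: fns_uminus wedge_forms)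
  finally show ?case .
qed (auto simp: wedge_add intro: rel_forms.intros)

lemma wedge_rel_left:
  assumes "u \<in> rel_covecs n J" and "w \<in> forms n m"
  shows "wedge u w \<in> rel_forms n J (Suc m)"
  using assms(1)
proof induction
  case (smul f u)
  then show ?case
    using assms(2) by (auto simp: wedge_smul_left intro!: rel_forms.smul wedge_forms)
next
  case (grad f g)
  then have "wedge (grad n f) (smul g w) \<in> rel_forms n J (Suc m)"
    using assms(2) by (intro rel_forms.grad) (auto intro: fns_smul)
  then show ?case by (simp add: wedge_smul wedge_smul_left)
qed (auto simp: wedge_add_left intro: rel_forms.intros)

text \<open>Factors are exchanged one at a time, through u w - v w' = u (w - w') + (u - v) w'. This
  allows products of one-forms that are known only up to relations, as the values of
  \<open>\<tau>\<close> are.\<close>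

lemma wedges_cong_rel:
  assumes "list_all2 (\<lambda>u v. u \<in> covecs n \<and> v \<in> covecs n \<and> u - v \<in> rel_covecs n J) us vs"
  shows "wedges us - wedges vs \<in> rel_forms n J (length us)"
  using assms
proof (induction us vs rule: list_all2_induct)
  case (Cons u us v vs)
  have vs: "wedges vs \<in> forms n (length us)"
    using Cons(2) wedges_forms[of vs n]
    by (auto simp: list_all2_conv_all_nth in_set_conv_nth subset_iff) (metis in_set_conv_nth)
  have "wedges (u # us) - wedges (v # vs)
      = wedge u (wedges us - wedges vs) + wedge (u - v) (wedges vs)"
    by (simp add: wedge_diff wedge_diff_left)
  also have "\<dots> \<in> rel_forms n J (length (u # us))"
    using Cons vs by (simp add: rel_forms.add wedge_rel_right wedge_rel_left)
  finally show ?case .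
qed (auto intro: rel_forms.zero)

end

subsection \<open>Free modules and quotient modules\<close>

lemma free_module_simps:
  "carrier (free_module B I)
    = {f. (\<forall>i\<in>I. f i \<in> carrier B) \<and> (\<forall>i. i \<notin> I \<longrightarrow> f i = \<zero>\<^bsub>B\<^esub>) \<and> finite {i. f i \<noteq> \<zero>\<^bsub>B\<^esub>}}"
  "\<zero>\<^bsub>free_module B I\<^esub> = (\<lambda>_. \<zero>\<^bsub>B\<^esub>)"
  "f \<oplus>\<^bsub>free_module B I\<^esub> g = (\<lambda>i. f i \<oplus>\<^bsub>B\<^esub> g i)"
  "b \<odot>\<^bsub>free_module B I\<^esub> f = (\<lambda>i. b \<otimes>\<^bsub>B\<^esub> f i)"
  by (simp_all add: free_module_def)

context cring
begin

lemma free_module_apply: "f \<in> carrier (free_module R I) \<Longrightarrow> f i \<in> carrier R"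
  by (cases "i \<in> I") (auto simp: free_module_simps)

lemma free_module_finite: "f \<in> carrier (free_module R I) \<Longrightarrow> finite {i. f i \<noteq> \<zero>}"
  by (simp add: free_module_simps)

lemma free_module_outside: "f \<in> carrier (free_module R I) \<Longrightarrow> i \<notin> I \<Longrightarrow> f i = \<zero>"
  by (simp add: free_module_simps)

lemma free_moduleI:
  assumes "\<And>i. f i \<in> carrier R" "\<And>i. i \<notin> I \<Longrightarrow> f i = \<zero>" "finite T" "\<And>i. i \<notin> T \<Longrightarrow> f i = \<zero>"
  shows "f \<in> carrier (free_module R I)"
proof -
  have "finite {i. f i \<noteq> \<zero>}"
    using assms(4) by (intro finite_subset[OF _ assms(3)]) blast
  then show ?thesis
    using assms(1,2) by (simp add: free_module_simps)
qed

lemma free_module_add_closed: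
  assumes "f \<in> carrier (free_module R I)" "g \<in> carrier (free_module R I)"
  shows "(\<lambda>i. f i \<oplus> g i) \<in> carrier (free_module R I)"
  by (rule free_moduleI[where T = "{i. f i \<noteq> \<zero>} \<union> {i. g i \<noteq> \<zero>}"])
     (use assms in \<open>auto simp: free_module_apply free_module_finite free_module_outside\<close>)

lemma free_module_smult_closed:
  assumes "f \<in> carrier (free_module R I)" "b \<in> carrier R"
  shows "(\<lambda>i. b \<otimes> f i) \<in> carrier (free_module R I)"
  by (rule free_moduleI[where T = "{i. f i \<noteq> \<zero>}"])
     (use assms in \<open>auto simp: free_module_apply free_module_finite free_module_outside\<close>)

lemma free_module_zero_closed: "(\<lambda>_. \<zero>) \<in> carrier (free_module R I)"
  by (simp add: free_module_simps)

lemma free_module_a_inv_closed: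
  assumes "f \<in> carrier (free_module R I)"
  shows "(\<lambda>i. \<ominus> f i) \<in> carrier (free_module R I)"
  by (rule free_moduleI[where T = "{i. f i \<noteq> \<zero>}"])
     (use assms in \<open>auto simp: free_module_apply free_module_finite free_module_outside\<close>)

lemma module_free_module: "Module.module R (free_module R I)"
proof -
  let ?F = "free_module R I"
  note ap = free_module_apply[where I = I]
  show ?thesis
  proof (rule moduleI)
    show "abelian_group ?F"
    proof (rule abelian_groupI)
      fix f g h assume f: "f \<in> carrier ?F" and g: "g \<in> carrier ?F" and h: "h \<in> carrier ?F"
      show "f \<oplus>\<^bsub>?F\<^esub> g \<in> carrier ?F"
        unfolding free_module_simps(3) by (rule free_module_add_closed[OF f g])
      show "f \<oplus>\<^bsub>?F\<^esub> g \<oplus>\<^bsub>?F\<^esub> h = f \<oplus>\<^bsub>?F\<^esub> (g \<oplus>\<^bsub>?F\<^esub> h)"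
        unfolding free_module_simps(3) using ap[OF f] ap[OF g] ap[OF h]
        by (simp add: a_assoc)
      show "f \<oplus>\<^bsub>?F\<^esub> g = g \<oplus>\<^bsub>?F\<^esub> f"
        unfolding free_module_simps(3) using ap[OF f] ap[OF g] by (simp add: a_comm)
      show "\<zero>\<^bsub>?F\<^esub> \<oplus>\<^bsub>?F\<^esub> f = f"
        unfolding free_module_simps(2,3) using ap[OF f] by simp
      show "\<exists>g\<in>carrier ?F. g \<oplus>\<^bsub>?F\<^esub> f = \<zero>\<^bsub>?F\<^esub>"
        using ap[OF f]
        by (intro bexI[of _ "\<lambda>i. \<ominus> f i"] free_module_a_inv_closed[OF f])
           (simp add: free_module_simps(2-) l_neg)
    next
      show "\<zero>\<^bsub>?F\<^esub> \<in> carrier ?F"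
        unfolding free_module_simps(2) by (rule free_module_zero_closed)
    qed
  next
    fix a b f g
    assume a: "a \<in> carrier R" and b: "b \<in> carrier R" and f: "f \<in> carrier ?F" and g: "g \<in> carrier ?F"
    show "a \<odot>\<^bsub>?F\<^esub> f \<in> carrier ?F"
      unfolding free_module_simps(4) by (rule free_module_smult_closed[OF f a])
    show "(a \<oplus> b) \<odot>\<^bsub>?F\<^esub> f = a \<odot>\<^bsub>?F\<^esub> f \<oplus>\<^bsub>?F\<^esub> b \<odot>\<^bsub>?F\<^esub> f"
      unfolding free_module_simps(3,4) using a b ap[OF f] by (simp add: l_distr)
    show "a \<odot>\<^bsub>?F\<^esub> (f \<oplus>\<^bsub>?F\<^esub> g) = a \<odot>\<^bsub>?F\<^esub> f \<oplus>\<^bsub>?F\<^esub> a \<odot>\<^bsub>?F\<^esub> g"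
      unfolding free_module_simps(3,4) using a ap[OF f] ap[OF g] by (simp add: r_distr)
    show "(a \<otimes> b) \<odot>\<^bsub>?F\<^esub> f = a \<odot>\<^bsub>?F\<^esub> (b \<odot>\<^bsub>?F\<^esub> f)"
      unfolding free_module_simps(4) using a b ap[OF f] by (simp add: m_assoc)
  next
    fix f assume f: "f \<in> carrier ?F"
    show "\<one> \<odot>\<^bsub>?F\<^esub> f = f"
      unfolding free_module_simps(4) using ap[OF f] by simp
  qed (rule is_cring)
qed

lemma free_module_minus:
  assumes f: "f \<in> carrier (free_module R I)" and g: "g \<in> carrier (free_module R I)"
  shows "f \<ominus>\<^bsub>free_module R I\<^esub> g = (\<lambda>i. f i \<ominus> g i)"
proof -
  interpret F: Module.module R "free_module R I" by (rule module_free_module)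
  have "\<ominus>\<^bsub>free_module R I\<^esub> g = (\<lambda>i. \<ominus> g i)"
    using free_module_a_inv_closed[OF g] g free_module_apply[OF g]
    by (intro F.minus_equality) (auto simp: free_module_simps(2,3) l_neg)
  then show ?thesis
    by (simp add: F.minus_eq minus_eq free_module_simps(3))
qed

lemma free_gen_closed: "i \<in> I \<Longrightarrow> free_gen R i \<in> carrier (free_module R I)"
  by (rule free_moduleI[where T = "{i}"]) (auto simp: free_gen_def)

lemma free_module_induct:
  assumes f: "f \<in> carrier (free_module R I)"
    and zero: "P \<zero>\<^bsub>free_module R I\<^esub>"
    and gen: "\<And>b i. b \<in> carrier R \<Longrightarrow> i \<in> I \<Longrightarrow> P (b \<odot>\<^bsub>free_module R I\<^esub> free_gen R i)"
    and add: "\<And>f g. f \<in> carrier (free_module R I) \<Longrightarrow> g \<in> carrier (free_module R I) \<Longrightarrow>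
      P f \<Longrightarrow> P g \<Longrightarrow> P (f \<oplus>\<^bsub>free_module R I\<^esub> g)"
  shows "P f"
proof -
  interpret F: Module.module R "free_module R I" by (rule module_free_module)
  \<comment> \<open>The set \<open>T\<close> only bounds the support. It may contain indices outside
    \<open>I\<close>, where \<open>f\<close> vanishes anyway.\<close>
  have "P f" if "finite T" "f \<in> carrier (free_module R I)" "{i. f i \<noteq> \<zero>} \<subseteq> T" for T f
    using that
  proof (induction T arbitrary: f)
    case empty
    then have "f = \<zero>\<^bsub>free_module R I\<^esub>" by (auto simp: free_module_simps)
    then show ?case using zero by simp
  next
    case (insert j T)
    show ?case
    proof (cases "j \<in> I")
      case True
      let ?g = "\<lambda>i. if i = j then \<zero> else f i"
      have g: "?g \<in> carrier (free_module R I)"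
        by (rule free_moduleI[where T = "{i. f i \<noteq> \<zero>}"])
           (use insert.prems in \<open>auto simp: free_module_apply free_module_finite free_module_outside\<close>)
      have "P ?g"
        by (rule insert.IH[OF g]) (use insert.prems in auto)
      moreover have "P (f j \<odot>\<^bsub>free_module R I\<^esub> free_gen R j)"
        using True insert.prems free_module_apply by (intro gen) auto
      moreover have "f = ?g \<oplus>\<^bsub>free_module R I\<^esub> (f j \<odot>\<^bsub>free_module R I\<^esub> free_gen R j)"
        using free_module_apply[OF insert.prems(1)]
        by (auto simp: free_module_simps(3,4) free_gen_def fun_eq_iff)
      ultimately show ?thesis
        using add[OF g F.smult_closed[OF free_module_apply[OF insert.prems(1), of j] free_gen_closed[OF True]]]
        by simp
    next
      case False
      then have "f j = \<zero>" using insert.prems by (simp add: free_module_outside)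
      then have "{i. f i \<noteq> \<zero>} \<subseteq> T" using insert.prems by auto
      then show ?thesis using insert.IH[OF insert.prems(1)] by blast
    qed
  qed
  then show ?thesis
    using f free_module_finite by blast
qed

end

locale quotient_module = M: Module.module R M for R (structure) and M (structure) and N +
  assumes submodule: "submodule R N M"
begin

abbreviation "Q \<equiv> quot_module M N"

lemma sub_subset: "N \<subseteq> carrier M"
  using submodule by (simp add: submodule_def)

lemma sub_carrier: "x \<in> N \<Longrightarrow> x \<in> carrier M"
  using sub_subset by blast

lemma sub_zero: "\<zero>\<^bsub>M\<^esub> \<in> N"
  and sub_add: "x \<in> N \<Longrightarrow> y \<in> N \<Longrightarrow> x \<oplus>\<^bsub>M\<^esub> y \<in> N"
  and sub_smult: "b \<in> carrier R \<Longrightarrow> x \<in> N \<Longrightarrow> b \<odot>\<^bsub>M\<^esub> x \<in> N"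
  using submodule by (auto simp: submodule_def)

lemma sub_a_inv: "x \<in> N \<Longrightarrow> \<ominus>\<^bsub>M\<^esub> x \<in> N"
  using sub_smult[of "\<ominus>\<^bsub>R\<^esub> \<one>\<^bsub>R\<^esub>" x] sub_carrier[of x] by (simp add: M.smult_l_minus)

sublocale sub: abelian_subgroup N M
proof (rule abelian_subgroupI3)
  show "additive_subgroup N M"
  proof (rule additive_subgroup.intro, rule M.add.subgroupI)
    show "N \<noteq> {}" using sub_zero by blast
  qed (auto intro: sub_subset[THEN subsetD] sub_a_inv sub_add)
qed (rule M.abelian_group_axioms)

lemma quot_carrier: "carrier Q = {N +>\<^bsub>M\<^esub> x | x. x \<in> carrier M}"
  by (auto simp: quot_module_def A_RCOSETS_def')

lemma coset_closed [simp, intro]: "x \<in> carrier M \<Longrightarrow> N +>\<^bsub>M\<^esub> x \<in> carrier Q"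
  by (auto simp: quot_carrier)

lemma coset_add: "x \<in> carrier M \<Longrightarrow> y \<in> carrier M \<Longrightarrow>
    (N +>\<^bsub>M\<^esub> x) \<oplus>\<^bsub>Q\<^esub> (N +>\<^bsub>M\<^esub> y) = N +>\<^bsub>M\<^esub> (x \<oplus>\<^bsub>M\<^esub> y)"
  by (simp add: quot_module_def sub.a_rcos_sum)

lemma coset_eq_iff:
  assumes "x \<in> carrier M" "y \<in> carrier M"
  shows "N +>\<^bsub>M\<^esub> x = N +>\<^bsub>M\<^esub> y \<longleftrightarrow> x \<ominus>\<^bsub>M\<^esub> y \<in> N"
proof
  assume "N +>\<^bsub>M\<^esub> x = N +>\<^bsub>M\<^esub> y"
  then have "x \<in> N +>\<^bsub>M\<^esub> y" using sub.a_rcos_self[OF assms(1)] by simp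
  then obtain h where "h \<in> N" "x = h \<oplus>\<^bsub>M\<^esub> y" by (auto simp: a_r_coset_def')
  then show "x \<ominus>\<^bsub>M\<^esub> y \<in> N"
    using assms sub_carrier[of h] by (simp add: M.M.minus_eq M.M.a_assoc M.M.r_neg)
next
  assume "x \<ominus>\<^bsub>M\<^esub> y \<in> N"
  moreover have "x = (x \<ominus>\<^bsub>M\<^esub> y) \<oplus>\<^bsub>M\<^esub> y"
    using assms by (simp add: M.M.minus_eq M.M.a_assoc M.M.l_neg)
  ultimately have "x \<in> N +>\<^bsub>M\<^esub> y" by (auto simp: a_r_coset_def')
  then show "N +>\<^bsub>M\<^esub> x = N +>\<^bsub>M\<^esub> y"
    using M.M.a_repr_independence[OF _ assms(2) sub.a_subgroup] by simp
qed

lemma coset_zero: "N +>\<^bsub>M\<^esub> \<zero>\<^bsub>M\<^esub> = \<zero>\<^bsub>Q\<^esub>"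
  by (simp add: quot_module_def M.a_coset_add_zero[OF sub_subset])

lemma coset_eq_zero_iff: "x \<in> carrier M \<Longrightarrow> N +>\<^bsub>M\<^esub> x = \<zero>\<^bsub>Q\<^esub> \<longleftrightarrow> x \<in> N"
  using coset_eq_iff[of x "\<zero>\<^bsub>M\<^esub>"] M.M.minus_equality[of "\<zero>\<^bsub>M\<^esub>" "\<zero>\<^bsub>M\<^esub>"]
  by (simp add: coset_zero M.M.minus_eq)

lemma mem_coset_iff:
  assumes "x \<in> carrier M"
  shows "y \<in> N +>\<^bsub>M\<^esub> x \<longleftrightarrow> y \<in> carrier M \<and> N +>\<^bsub>M\<^esub> y = N +>\<^bsub>M\<^esub> x"
proof
  assume y: "y \<in> N +>\<^bsub>M\<^esub> x"
  then show "y \<in> carrier M \<and> N +>\<^bsub>M\<^esub> y = N +>\<^bsub>M\<^esub> x"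
    using M.M.a_r_coset_subset_G[OF sub_subset assms] M.M.a_repr_independence[OF y assms sub.a_subgroup]
    by auto
next
  assume "y \<in> carrier M \<and> N +>\<^bsub>M\<^esub> y = N +>\<^bsub>M\<^esub> x"
  then show "y \<in> N +>\<^bsub>M\<^esub> x"
    using sub.a_rcos_self[of y] by auto
qed

text \<open>Scalar multiplication is defined as a union over the elements of the coset. All members
  of this union are one and the same coset because \<open>N\<close> is closed under scalars.\<close>

lemma coset_smult:
  assumes b: "b \<in> carrier R" and x: "x \<in> carrier M"
  shows "b \<odot>\<^bsub>Q\<^esub> (N +>\<^bsub>M\<^esub> x) = N +>\<^bsub>M\<^esub> (b \<odot>\<^bsub>M\<^esub> x)"
proof -
  have "N +>\<^bsub>M\<^esub> (b \<odot>\<^bsub>M\<^esub> y) = N +>\<^bsub>M\<^esub> (b \<odot>\<^bsub>M\<^esub> x)" if y: "y \<in> N +>\<^bsub>M\<^esub> x" for y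
  proof -
    have y': "y \<in> carrier M" "y \<ominus>\<^bsub>M\<^esub> x \<in> N"
      using y mem_coset_iff[OF x, of y] coset_eq_iff[of y x] x by blast+
    have "b \<odot>\<^bsub>M\<^esub> y \<ominus>\<^bsub>M\<^esub> b \<odot>\<^bsub>M\<^esub> x = b \<odot>\<^bsub>M\<^esub> (y \<ominus>\<^bsub>M\<^esub> x)"
      using b x y'(1) by (simp add: a_minus_def M.smult_r_distr M.smult_r_minus)
    also have "\<dots> \<in> N"
      using b y'(2) by (rule sub_smult)
    finally show ?thesis
      using coset_eq_iff[of "b \<odot>\<^bsub>M\<^esub> y" "b \<odot>\<^bsub>M\<^esub> x"] b x y'(1) by blast
  qed
  moreover have "x \<in> N +>\<^bsub>M\<^esub> x" using x by (rule sub.a_rcos_self)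
  ultimately have "(\<Union>y\<in>N +>\<^bsub>M\<^esub> x. N +>\<^bsub>M\<^esub> (b \<odot>\<^bsub>M\<^esub> y)) = N +>\<^bsub>M\<^esub> (b \<odot>\<^bsub>M\<^esub> x)"
    by blast
  then show ?thesis
    by (simp add: quot_module_def)
qed

lemma module_quot: "Module.module R Q"
proof (rule moduleI)
  show "abelian_group Q"
  proof (rule abelian_groupI)
    fix X assume "X \<in> carrier Q"
    then obtain x where x: "x \<in> carrier M" "X = N +>\<^bsub>M\<^esub> x" by (auto simp: quot_carrier)
    then show "\<exists>Y\<in>carrier Q. Y \<oplus>\<^bsub>Q\<^esub> X = \<zero>\<^bsub>Q\<^esub>"
      by (intro bexI[of _ "N +>\<^bsub>M\<^esub> (\<ominus>\<^bsub>M\<^esub> x)"]) (auto simp: coset_add M.M.l_neg coset_zero)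
  next
    show "\<zero>\<^bsub>Q\<^esub> \<in> carrier Q" by (simp flip: coset_zero)
    fix X assume "X \<in> carrier Q"
    then show "\<zero>\<^bsub>Q\<^esub> \<oplus>\<^bsub>Q\<^esub> X = X"
      by (auto simp: quot_carrier coset_add simp flip: coset_zero)
  next
    fix X Y assume "X \<in> carrier Q" "Y \<in> carrier Q"
    then show "X \<oplus>\<^bsub>Q\<^esub> Y \<in> carrier Q" "X \<oplus>\<^bsub>Q\<^esub> Y = Y \<oplus>\<^bsub>Q\<^esub> X"
      by (auto simp add: quot_carrier coset_add M.M.a_comm)
    fix Z assume "Z \<in> carrier Q"
    with \<open>X \<in> carrier Q\<close> \<open>Y \<in> carrier Q\<close>
    show "X \<oplus>\<^bsub>Q\<^esub> Y \<oplus>\<^bsub>Q\<^esub> Z = X \<oplus>\<^bsub>Q\<^esub> (Y \<oplus>\<^bsub>Q\<^esub> Z)"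
      by (auto simp add: quot_carrier coset_add M.M.a_assoc)
  qed
next
  fix a X assume "a \<in> carrier R" "X \<in> carrier Q"
  then show "a \<odot>\<^bsub>Q\<^esub> X \<in> carrier Q"
    by (force simp: quot_carrier coset_smult)
qed (auto simp: quot_carrier coset_add coset_smult M.smult_l_distr M.smult_r_distr M.smult_assoc1
    intro: M.R.is_cring)

end

text \<open>The elements with property \<open>P\<close> form a submodule that contains
  \<open>S\<close>, hence also the span.\<close>

lemma (in Module.module) span_induct:
  assumes x: "x \<in> span S" and S: "S \<subseteq> carrier M"
    and zero: "P \<zero>\<^bsub>M\<^esub>"
    and gen: "\<And>x. x \<in> S \<Longrightarrow> P x"
    and add: "\<And>x y. x \<in> carrier M \<Longrightarrow> y \<in> carrier M \<Longrightarrow> P x \<Longrightarrow> P y \<Longrightarrow> P (x \<oplus>\<^bsub>M\<^esub> y)"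
    and smult: "\<And>a x. a \<in> carrier R \<Longrightarrow> x \<in> carrier M \<Longrightarrow> P x \<Longrightarrow> P (a \<odot>\<^bsub>M\<^esub> x)"
  shows "P x"
proof -
  have "submodule R {x \<in> carrier M. P x} M"
    using zero add smult by (intro submodule.intro) (auto intro: module_axioms)
  then have "span S \<subseteq> {x \<in> carrier M. P x}"
    using S gen by (intro span_is_subset) auto
  then show ?thesis using x by blast
qed

lemma module_restrict_scalars:
  assumes M: "Module.module R M" and K: "cring K" and hom: "\<phi> \<in> Ring.ring_hom K R"
  shows "Module.module K (restrict_scalars \<phi> M)"
proof -
  interpret M: Module.module R M by (rule M)
  interpret K: cring K by (rule K)
  let ?V = "restrict_scalars \<phi> M"
  have simps: "carrier ?V = carrier M" "\<zero>\<^bsub>?V\<^esub> = \<zero>\<^bsub>M\<^esub>" "add ?V = add M"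
    "\<And>a x. a \<odot>\<^bsub>?V\<^esub> x = \<phi> a \<odot>\<^bsub>M\<^esub> x"
    by (simp_all add: restrict_scalars_def)
  show ?thesis
  proof (rule moduleI)
    show "abelian_group ?V"
    proof (rule abelian_groupI)
      fix x assume "x \<in> carrier ?V"
      then show "\<exists>y\<in>carrier ?V. y \<oplus>\<^bsub>?V\<^esub> x = \<zero>\<^bsub>?V\<^esub>"
        by (intro bexI[of _ "\<ominus>\<^bsub>M\<^esub> x"]) (auto simp: simps M.M.l_neg)
    qed (auto simp: simps M.M.a_ac)
  qed (auto simp: simps ring_hom_closed[OF hom] ring_hom_add[OF hom] ring_hom_mult[OF hom]
      ring_hom_one[OF hom] M.smult_l_distr M.smult_r_distr M.smult_assoc1 K)
qed

subsection \<open>Exterior powers\<close>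

lemma (in cring) free_cons_closed:
  assumes u: "u \<in> carrier M" and f: "f \<in> carrier (free_module R (tuples M m))"
  shows "free_cons R u f \<in> carrier (free_module R (tuples M (Suc m)))"
proof (rule free_moduleI[where T = "(\<lambda>xs. u # xs) ` {xs. f xs \<noteq> \<zero>}"])
  show "finite ((\<lambda>xs. u # xs) ` {xs. f xs \<noteq> \<zero>})"
    using free_module_finite[OF f] by simp
  show "free_cons R u f ys \<in> carrier R" for ys
    using free_module_apply[OF f] by (auto simp: free_cons_def split: list.splits)
  show "free_cons R u f ys = \<zero>" if "ys \<notin> tuples M (Suc m)" for ys
  proof (cases "\<exists>xs. ys = u # xs")
    case True
    then obtain xs where "ys = u # xs" by blast
    then show ?thesis
      using that free_module_outside[OF f, of xs] u by (auto simp: free_cons_def tuples_def)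
  qed (auto simp: free_cons_def split: list.splits)
  show "free_cons R u f ys = \<zero>" if "ys \<notin> (\<lambda>xs. u # xs) ` {xs. f xs \<noteq> \<zero>}" for ys
    using that by (auto simp: free_cons_def split: list.splits)
qed

text \<open>The index sets \<open>I\<close> and \<open>I'\<close> are unrelated, since the
  operations of a free module are pointwise and only its carrier depends on the index set. As
  \<open>I'\<close> occurs on the right-hand side only, it is instantiated by hand wherever the rule
  is used.\<close>

lemma (in cring) free_cons_add:
  "free_cons R u (f \<oplus>\<^bsub>free_module R I\<^esub> g) = free_cons R u f \<oplus>\<^bsub>free_module R I'\<^esub> free_cons R u g"
  by (auto simp: free_module_simps free_cons_def fun_eq_iff split: list.splits)

lemma (in cring) free_cons_smult:
  "b \<in> carrier R \<Longrightarrow>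
    free_cons R u (b \<odot>\<^bsub>free_module R I\<^esub> f) = b \<odot>\<^bsub>free_module R I'\<^esub> free_cons R u f"
  by (auto simp: free_module_simps free_cons_def fun_eq_iff split: list.splits)

lemma (in cring) free_cons_zero:
  "free_cons R u \<zero>\<^bsub>free_module R I\<^esub> = \<zero>\<^bsub>free_module R I'\<^esub>"
  by (auto simp: free_module_simps free_cons_def fun_eq_iff split: list.splits)

lemma free_cons_gen: "free_cons R u (free_gen R xs) = free_gen R (u # xs)"
  by (auto simp: free_gen_def free_cons_def fun_eq_iff split: list.splits)

lemma (in cring) free_cons_minus:
  assumes u: "u \<in> carrier M" and f: "f \<in> carrier (free_module R (tuples M m))"
    and g: "g \<in> carrier (free_module R (tuples M m))"
  shows "free_cons R u (f \<ominus>\<^bsub>free_module R (tuples M m)\<^esub> g)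
    = free_cons R u f \<ominus>\<^bsub>free_module R (tuples M (Suc m))\<^esub> free_cons R u g"
  unfolding free_module_minus[OF f g]
    free_module_minus[OF free_cons_closed[OF u f] free_cons_closed[OF u g]]
  by (auto simp: free_cons_def fun_eq_iff minus_eq split: list.splits)

locale exterior = Module.module R M for R (structure) and M (structure)
begin

abbreviation "tens m \<equiv> free_module R (tuples M m)"

lemma tuples_update: "xs \<in> tuples M m \<Longrightarrow> x \<in> carrier M \<Longrightarrow> xs[i := x] \<in> tuples M m"
  using set_update_subset_insert[of xs i x] by (auto simp: tuples_def)

lemma tuples_Cons [simp]: "x # xs \<in> tuples M (Suc m) \<longleftrightarrow> x \<in> carrier M \<and> xs \<in> tuples M m"
  by (auto simp: tuples_def)

lemma module_tens: "Module.module R (tens m)"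
  by (rule R.module_free_module)

lemma gen_closed: "xs \<in> tuples M m \<Longrightarrow> free_gen R xs \<in> carrier (tens m)"
  by (rule R.free_gen_closed)

lemma ext_relations_cases [consumes 1, case_names add smult alt]:
  assumes "r \<in> ext_relations R M m"
  obtains xs i x y where "xs \<in> tuples M m" "i < m" "x \<in> carrier M" "y \<in> carrier M"
      "r = free_gen R (xs[i := x \<oplus>\<^bsub>M\<^esub> y])
        \<ominus>\<^bsub>tens m\<^esub> (free_gen R (xs[i := x]) \<oplus>\<^bsub>tens m\<^esub> free_gen R (xs[i := y]))"
  | xs i b x where "xs \<in> tuples M m" "i < m" "b \<in> carrier R" "x \<in> carrier M"
      "r = free_gen R (xs[i := b \<odot>\<^bsub>M\<^esub> x]) \<ominus>\<^bsub>tens m\<^esub> b \<odot>\<^bsub>tens m\<^esub> free_gen R (xs[i := x])"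
  | xs where "xs \<in> tuples M m" "\<not> distinct xs" "r = free_gen R xs"
  using assms unfolding ext_relations_def Let_def by blast

lemma ext_relations_subset: "ext_relations R M m \<subseteq> carrier (tens m)"
proof
  interpret F: Module.module R "tens m" by (rule module_tens)
  fix r assume "r \<in> ext_relations R M m"
  then show "r \<in> carrier (tens m)"
    by (cases rule: ext_relations_cases) (auto intro!: gen_closed tuples_update)
qed

lemma quotient_ext: "quotient_module R (tens m) (ext_submodule R M m)"
proof -
  have "submodule R (ext_submodule R M m) (tens m)"
    unfolding ext_submodule_def
    by (rule LinearCombinations.module.span_is_submodule[OF module_tens ext_relations_subset])
  then show ?thesis
    by (intro quotient_module.intro quotient_module_axioms.intro module_tens)
qed

lemmas ext_sub_zero = quotient_module.sub_zero[OF quotient_ext]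
  and ext_sub_add = quotient_module.sub_add[OF quotient_ext]
  and ext_sub_smult = quotient_module.sub_smult[OF quotient_ext]
  and ext_quot_carrier = quotient_module.quot_carrier[OF quotient_ext]
  and ext_coset_closed = quotient_module.coset_closed[OF quotient_ext]
  and ext_coset_add = quotient_module.coset_add[OF quotient_ext]
  and ext_coset_smult = quotient_module.coset_smult[OF quotient_ext]
  and ext_coset_zero = quotient_module.coset_zero[OF quotient_ext]
  and ext_coset_eq_iff = quotient_module.coset_eq_iff[OF quotient_ext]
  and ext_coset_eq_zero_iff = quotient_module.coset_eq_zero_iff[OF quotient_ext]
  and ext_mem_coset_iff = quotient_module.mem_coset_iff[OF quotient_ext]

lemma ext_power_eq: "ext_power R M m = quot_module (tens m) (ext_submodule R M m)"
  by (simp add: ext_power_def)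

lemma module_ext_power: "Module.module R (ext_power R M m)"
  unfolding ext_power_eq by (rule quotient_module.module_quot[OF quotient_ext])

lemma ext_submodule_induct [consumes 1, case_names zero rel add smult]:
  assumes "f \<in> ext_submodule R M m"
    and "P \<zero>\<^bsub>tens m\<^esub>"
    and "\<And>r. r \<in> ext_relations R M m \<Longrightarrow> P r"
    and "\<And>f g. f \<in> carrier (tens m) \<Longrightarrow> g \<in> carrier (tens m) \<Longrightarrow> P f \<Longrightarrow> P g \<Longrightarrow> P (f \<oplus>\<^bsub>tens m\<^esub> g)"
    and "\<And>b f. b \<in> carrier R \<Longrightarrow> f \<in> carrier (tens m) \<Longrightarrow> P f \<Longrightarrow> P (b \<odot>\<^bsub>tens m\<^esub> f)"
  shows "P f"
  using assms
  by (rule module.span_induct[OF module_tens _ ext_relations_subset, where x = f and P = P, folded ext_submodule_def])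

lemma ext_relations_sub: "r \<in> ext_relations R M m \<Longrightarrow> r \<in> ext_submodule R M m"
  using LinearCombinations.module.in_own_span[OF module_tens ext_relations_subset] by (auto simp: ext_submodule_def)

lemma wedge_list_eq: "xs \<in> tuples M m \<Longrightarrow>
    wedge_list R M xs = ext_submodule R M m +>\<^bsub>tens m\<^esub> free_gen R xs"
  by (simp add: wedge_list_def tuples_def)

lemma wedge_list_closed: "xs \<in> tuples M m \<Longrightarrow> wedge_list R M xs \<in> carrier (ext_power R M m)"
  unfolding ext_power_eq wedge_list_eq by (intro ext_coset_closed gen_closed)

lemma wedge_list_update_add:
  assumes "xs \<in> tuples M m" "i < m" "x \<in> carrier M" "y \<in> carrier M"
  shows "wedge_list R M (xs[i := x \<oplus>\<^bsub>M\<^esub> y])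
    = wedge_list R M (xs[i := x]) \<oplus>\<^bsub>ext_power R M m\<^esub> wedge_list R M (xs[i := y])"
proof -
  interpret F: Module.module R "tens m" by (rule module_tens)
  note cl = gen_closed[OF tuples_update[OF assms(1)]]
  have "free_gen R (xs[i := x \<oplus>\<^bsub>M\<^esub> y])
      \<ominus>\<^bsub>tens m\<^esub> (free_gen R (xs[i := x]) \<oplus>\<^bsub>tens m\<^esub> free_gen R (xs[i := y])) \<in> ext_submodule R M m"
    by (rule ext_relations_sub, unfold ext_relations_def Let_def) (use assms in blast)
  then have "ext_submodule R M m +>\<^bsub>tens m\<^esub> free_gen R (xs[i := x \<oplus>\<^bsub>M\<^esub> y])
      = ext_submodule R M m +>\<^bsub>tens m\<^esub> (free_gen R (xs[i := x]) \<oplus>\<^bsub>tens m\<^esub> free_gen R (xs[i := y]))"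
    using assms cl by (subst ext_coset_eq_iff) auto
  then show ?thesis
    using assms cl tuples_update[OF assms(1)]
    by (simp add: wedge_list_eq[where m = m] ext_coset_add ext_power_eq)
qed

lemma wedge_list_update_smult:
  assumes "xs \<in> tuples M m" "i < m" "b \<in> carrier R" "x \<in> carrier M"
  shows "wedge_list R M (xs[i := b \<odot>\<^bsub>M\<^esub> x]) = b \<odot>\<^bsub>ext_power R M m\<^esub> wedge_list R M (xs[i := x])"
proof -
  interpret F: Module.module R "tens m" by (rule module_tens)
  note cl = gen_closed[OF tuples_update[OF assms(1)]]
  have "free_gen R (xs[i := b \<odot>\<^bsub>M\<^esub> x]) \<ominus>\<^bsub>tens m\<^esub> b \<odot>\<^bsub>tens m\<^esub> free_gen R (xs[i := x])
      \<in> ext_submodule R M m"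
    by (rule ext_relations_sub, unfold ext_relations_def Let_def) (use assms in blast)
  then have "ext_submodule R M m +>\<^bsub>tens m\<^esub> free_gen R (xs[i := b \<odot>\<^bsub>M\<^esub> x])
      = ext_submodule R M m +>\<^bsub>tens m\<^esub> (b \<odot>\<^bsub>tens m\<^esub> free_gen R (xs[i := x]))"
    using assms cl by (subst ext_coset_eq_iff) auto
  then show ?thesis
    using assms cl tuples_update[OF assms(1)]
    by (simp add: wedge_list_eq[where m = m] ext_coset_smult ext_power_eq)
qed

lemma wedge_list_not_distinct:
  assumes "xs \<in> tuples M m" "\<not> distinct xs"
  shows "wedge_list R M xs = \<zero>\<^bsub>ext_power R M m\<^esub>"
proof -
  have "free_gen R xs \<in> ext_submodule R M m"
    by (rule ext_relations_sub, unfold ext_relations_def Let_def) (use assms in blast)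
  then show ?thesis
    using assms gen_closed[OF assms(1)] by (simp add: wedge_list_eq[where m = m] ext_power_eq ext_coset_eq_zero_iff)
qed

lemma ext_power_induct [consumes 1, case_names zero wedge add]:
  assumes "w \<in> carrier (ext_power R M m)"
    and zero: "P \<zero>\<^bsub>ext_power R M m\<^esub>"
    and wedge: "\<And>b xs. b \<in> carrier R \<Longrightarrow> xs \<in> tuples M m \<Longrightarrow>
      P (b \<odot>\<^bsub>ext_power R M m\<^esub> wedge_list R M xs)"
    and add: "\<And>v w. v \<in> carrier (ext_power R M m) \<Longrightarrow> w \<in> carrier (ext_power R M m) \<Longrightarrow>
      P v \<Longrightarrow> P w \<Longrightarrow> P (v \<oplus>\<^bsub>ext_power R M m\<^esub> w)"
  shows "P w"
proof -
  obtain f where f: "f \<in> carrier (tens m)" and w: "w = ext_submodule R M m +>\<^bsub>tens m\<^esub> f"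
    using assms(1) by (auto simp: ext_power_eq ext_quot_carrier)
  have "P (ext_submodule R M m +>\<^bsub>tens m\<^esub> f)"
    using f
  proof (rule R.free_module_induct)
    show "P (ext_submodule R M m +>\<^bsub>tens m\<^esub> \<zero>\<^bsub>tens m\<^esub>)"
      using zero by (simp add: ext_coset_zero ext_power_eq)
  next
    fix b xs assume "b \<in> carrier R" "xs \<in> tuples M m"
    then show "P (ext_submodule R M m +>\<^bsub>tens m\<^esub> (b \<odot>\<^bsub>tens m\<^esub> free_gen R xs))"
      using wedge[of b xs] by (simp add: ext_power_eq wedge_list_eq[where m = m] ext_coset_smult gen_closed)
  next
    fix f g assume "f \<in> carrier (tens m)" "g \<in> carrier (tens m)"
      "P (ext_submodule R M m +>\<^bsub>tens m\<^esub> f)" "P (ext_submodule R M m +>\<^bsub>tens m\<^esub> g)"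
    then show "P (ext_submodule R M m +>\<^bsub>tens m\<^esub> (f \<oplus>\<^bsub>tens m\<^esub> g))"
      using add[of "ext_submodule R M m +>\<^bsub>tens m\<^esub> f" "ext_submodule R M m +>\<^bsub>tens m\<^esub> g"]
      by (simp add: ext_power_eq ext_coset_add ext_coset_closed)
  qed
  then show ?thesis by (simp add: w)
qed

text \<open>Prepending \<open>u\<close> turns a generating relation at position i into one of the
  same kind at position \<open>Suc i\<close>, and a tuple with a repeated entry into another one.
  Hence multiplication by \<open>u\<close> descends to the quotients.\<close>

lemma free_cons_ext_submodule:
  assumes u: "u \<in> carrier M" and "f \<in> ext_submodule R M m"
  shows "free_cons R u f \<in> ext_submodule R M (Suc m)"
  using assms(2)
proof (induction rule: ext_submodule_induct)
  case zero
  then show ?case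
    using ext_sub_zero[of "Suc m"] by (subst R.free_cons_zero[where I' = "tuples M (Suc m)"])
next
  case (rel r)
  interpret F: Module.module R "tens m" by (rule module_tens)
  from rel have "free_cons R u r \<in> ext_relations R M (Suc m)"
  proof (cases rule: ext_relations_cases)
    case (add xs i x y)
    have "free_cons R u r = free_gen R ((u # xs)[Suc i := x \<oplus>\<^bsub>M\<^esub> y]) \<ominus>\<^bsub>tens (Suc m)\<^esub>
      (free_gen R ((u # xs)[Suc i := x]) \<oplus>\<^bsub>tens (Suc m)\<^esub> free_gen R ((u # xs)[Suc i := y]))"
      unfolding add(5) using add u
      by (subst R.free_cons_minus)
         (auto simp: R.free_cons_add[where I' = "tuples M (Suc m)"] free_cons_gen
           intro!: gen_closed tuples_update)
    moreover have "u # xs \<in> tuples M (Suc m)" "Suc i < Suc m" using add u by auto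
    ultimately show ?thesis using add(3,4) unfolding ext_relations_def Let_def by blast
  next
    case (smult xs i b x)
    have "free_cons R u r = free_gen R ((u # xs)[Suc i := b \<odot>\<^bsub>M\<^esub> x]) \<ominus>\<^bsub>tens (Suc m)\<^esub>
      b \<odot>\<^bsub>tens (Suc m)\<^esub> free_gen R ((u # xs)[Suc i := x])"
      unfolding smult(5) using smult u
      by (subst R.free_cons_minus)
         (auto simp: R.free_cons_smult[where I' = "tuples M (Suc m)"] free_cons_gen
           intro!: gen_closed tuples_update)
    moreover have "u # xs \<in> tuples M (Suc m)" "Suc i < Suc m" using smult u by auto
    ultimately show ?thesis using smult(3,4) unfolding ext_relations_def Let_def by blast
  next
    case (alt xs)
    then have "u # xs \<in> tuples M (Suc m)" "\<not> distinct (u # xs)" "free_cons R u r = free_gen R (u # xs)"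
      using u by (auto simp: free_cons_gen)
    then show ?thesis unfolding ext_relations_def Let_def by blast
  qed
  then show ?case by (rule ext_relations_sub)
next
  case (add f g)
  then show ?case
    using ext_sub_add by (subst R.free_cons_add[where I' = "tuples M (Suc m)"])
next
  case (smult b f)
  then show ?case
    using ext_sub_smult by (subst R.free_cons_smult[where I' = "tuples M (Suc m)"])
qed

lemma wedge_left_coset:
  assumes u: "u \<in> carrier M" and f: "f \<in> carrier (tens m)"
  shows "wedge_left R M m u (ext_submodule R M m +>\<^bsub>tens m\<^esub> f)
    = ext_submodule R M (Suc m) +>\<^bsub>tens (Suc m)\<^esub> free_cons R u f"
proof -
  have "ext_submodule R M (Suc m) +>\<^bsub>tens (Suc m)\<^esub> free_cons R u g
      = ext_submodule R M (Suc m) +>\<^bsub>tens (Suc m)\<^esub> free_cons R u f"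
    if "g \<in> ext_submodule R M m +>\<^bsub>tens m\<^esub> f" for g
  proof -
    have g: "g \<in> carrier (tens m)" "g \<ominus>\<^bsub>tens m\<^esub> f \<in> ext_submodule R M m"
      using that ext_mem_coset_iff[OF f, of g] ext_coset_eq_iff[of g m f] f by blast+
    have "free_cons R u g \<ominus>\<^bsub>tens (Suc m)\<^esub> free_cons R u f \<in> ext_submodule R M (Suc m)"
      using free_cons_ext_submodule[OF u g(2)] R.free_cons_minus[OF u g(1) f] by simp
    then show ?thesis
      using ext_coset_eq_iff[OF R.free_cons_closed[OF u g(1)] R.free_cons_closed[OF u f]] by blast
  qed
  moreover have "f \<in> ext_submodule R M m +>\<^bsub>tens m\<^esub> f"
    using ext_mem_coset_iff[OF f] f by simp
  ultimately show ?thesis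
    unfolding wedge_left_def by blast
qed

lemma wedge_left_wedge_list:
  "u \<in> carrier M \<Longrightarrow> xs \<in> tuples M m \<Longrightarrow> wedge_left R M m u (wedge_list R M xs) = wedge_list R M (u # xs)"
  using wedge_list_eq[of "u # xs" "Suc m"]
  by (simp add: wedge_list_eq[where m = m] wedge_left_coset gen_closed free_cons_gen)

lemma wedge_left_closed:
  assumes "u \<in> carrier M" "w \<in> carrier (ext_power R M m)"
  shows "wedge_left R M m u w \<in> carrier (ext_power R M (Suc m))"
  using assms by (auto simp: ext_power_eq ext_quot_carrier wedge_left_coset intro!: R.free_cons_closed)

lemma wedge_left_add:
  assumes "u \<in> carrier M" "v \<in> carrier (ext_power R M m)" "w \<in> carrier (ext_power R M m)"
  shows "wedge_left R M m u (v \<oplus>\<^bsub>ext_power R M m\<^esub> w)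
    = wedge_left R M m u v \<oplus>\<^bsub>ext_power R M (Suc m)\<^esub> wedge_left R M m u w"
proof -
  interpret F: Module.module R "tens m" by (rule module_tens)
  show ?thesis
    using assms
    by (auto simp: ext_power_eq ext_quot_carrier wedge_left_coset ext_coset_add R.free_cons_closed
        R.free_cons_add[where I' = "tuples M (Suc m)"])
qed

lemma wedge_left_smult:
  assumes "u \<in> carrier M" "b \<in> carrier R" "w \<in> carrier (ext_power R M m)"
  shows "wedge_left R M m u (b \<odot>\<^bsub>ext_power R M m\<^esub> w)
    = b \<odot>\<^bsub>ext_power R M (Suc m)\<^esub> wedge_left R M m u w"
proof -
  interpret F: Module.module R "tens m" by (rule module_tens)
  show ?thesis
    using assms
    by (auto simp: ext_power_eq ext_quot_carrier wedge_left_coset ext_coset_smult R.free_cons_closed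
        R.free_cons_smult[where I' = "tuples M (Suc m)"])
qed

lemma wedge_left_zero:
  assumes u: "u \<in> carrier M"
  shows "wedge_left R M m u \<zero>\<^bsub>ext_power R M m\<^esub> = \<zero>\<^bsub>ext_power R M (Suc m)\<^esub>"
proof -
  have "\<zero>\<^bsub>tens m\<^esub> \<in> carrier (tens m)"
    unfolding free_module_simps(2) by (rule R.free_module_zero_closed)
  then have "wedge_left R M m u (ext_submodule R M m +>\<^bsub>tens m\<^esub> \<zero>\<^bsub>tens m\<^esub>)
      = ext_submodule R M (Suc m) +>\<^bsub>tens (Suc m)\<^esub> free_cons R u \<zero>\<^bsub>tens m\<^esub>"
    by (rule wedge_left_coset[OF u])
  also have "free_cons R u \<zero>\<^bsub>tens m\<^esub> = \<zero>\<^bsub>tens (Suc m)\<^esub>"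
    by (rule R.free_cons_zero)
  finally show ?thesis
    by (simp only: ext_coset_zero ext_power_eq)
qed

lemma wedge_list_Cons_add:
  assumes "x \<in> carrier M" "y \<in> carrier M" "xs \<in> tuples M m"
  shows "wedge_list R M ((x \<oplus>\<^bsub>M\<^esub> y) # xs)
    = wedge_list R M (x # xs) \<oplus>\<^bsub>ext_power R M (Suc m)\<^esub> wedge_list R M (y # xs)"
  using wedge_list_update_add[of "x # xs" "Suc m" 0 x y] assms by simp

lemma wedge_list_Cons_smult:
  assumes "b \<in> carrier R" "x \<in> carrier M" "xs \<in> tuples M m"
  shows "wedge_list R M ((b \<odot>\<^bsub>M\<^esub> x) # xs) = b \<odot>\<^bsub>ext_power R M (Suc m)\<^esub> wedge_list R M (x # xs)"
  using wedge_list_update_smult[of "x # xs" "Suc m" 0 b x] assms by simp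

text \<open>On the free modules prepending is not additive in the prepended element, because
  distinct tuples are independent generators. Additivity appears only in the quotient. It is
  obtained on products of one-forms and extended by linearity in \<open>w\<close>.\<close>

lemma wedge_left_add_left:
  assumes u: "u \<in> carrier M" and v: "v \<in> carrier M" and "w \<in> carrier (ext_power R M m)"
  shows "wedge_left R M m (u \<oplus>\<^bsub>M\<^esub> v) w
    = wedge_left R M m u w \<oplus>\<^bsub>ext_power R M (Suc m)\<^esub> wedge_left R M m v w"
proof -
  interpret E: Module.module R "ext_power R M m" by (rule module_ext_power)
  interpret E': Module.module R "ext_power R M (Suc m)" by (rule module_ext_power)
  show ?thesis
    using assms(3)
  proof (induction rule: ext_power_induct)
    case (wedge b xs)
    have "wedge_list R M (x # xs) \<in> carrier (ext_power R M (Suc m))" if "x \<in> carrier M" for x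
      using that wedge by (intro wedge_list_closed) simp
    then show ?case
      using wedge u v
      by (simp add: wedge_left_smult wedge_list_closed wedge_left_wedge_list wedge_list_Cons_add
          E'.smult_r_distr)
  next
    case (add w w')
    have cl: "wedge_left R M m x y \<in> carrier (ext_power R M (Suc m))"
      if "x \<in> {u, v}" "y \<in> {w, w'}" for x y
      using that u v add(1,2) by (auto intro: wedge_left_closed)
    show ?case
      using add u v cl by (simp add: wedge_left_add E'.M.a_ac)
  qed (use u v in \<open>simp add: wedge_left_zero\<close>)
qed

lemma wedge_left_smult_left:
  assumes b: "b \<in> carrier R" and u: "u \<in> carrier M" and "w \<in> carrier (ext_power R M m)"
  shows "wedge_left R M m (b \<odot>\<^bsub>M\<^esub> u) w = b \<odot>\<^bsub>ext_power R M (Suc m)\<^esub> wedge_left R M m u w"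
proof -
  interpret E: Module.module R "ext_power R M m" by (rule module_ext_power)
  interpret E': Module.module R "ext_power R M (Suc m)" by (rule module_ext_power)
  show ?thesis
    using assms(3)
  proof (induction rule: ext_power_induct)
    case (wedge c xs)
    have "wedge_list R M (u # xs) \<in> carrier (ext_power R M (Suc m))"
      using wedge u by (intro wedge_list_closed) simp
    then show ?case
      using wedge u b
      by (simp add: wedge_left_smult wedge_list_closed wedge_left_wedge_list wedge_list_Cons_smult
          E'.smult_assoc1[symmetric] R.m_comm)
  next
    case (add w w')
    then show ?case
      using u b by (simp add: wedge_left_add wedge_left_closed E'.smult_r_distr)
  qed (use u b in \<open>simp add: wedge_left_zero\<close>)
qed

lemma wedge_left_zero_left:
  "w \<in> carrier (ext_power R M m) \<Longrightarrow> wedge_left R M m \<zero>\<^bsub>M\<^esub> w = \<zero>\<^bsub>ext_power R M (Suc m)\<^esub>"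
proof -
  interpret E': Module.module R "ext_power R M (Suc m)" by (rule module_ext_power)
  assume "w \<in> carrier (ext_power R M m)"
  then show ?thesis
    using wedge_left_smult_left[of "\<zero>" "\<zero>\<^bsub>M\<^esub>" w m] by (simp add: wedge_left_closed)
qed

text \<open>Expand the vanishing product that has \<open>x \<oplus> y\<close> in both of the first
  two places; the two squares drop out.\<close>

lemma wedge_list_swap:
  assumes x: "x \<in> carrier M" and y: "y \<in> carrier M" and zs: "zs \<in> tuples M m"
  shows "wedge_list R M (x # y # zs)
    = \<ominus>\<^bsub>ext_power R M (Suc (Suc m))\<^esub> wedge_list R M (y # x # zs)"
proof -
  let ?E = "ext_power R M (Suc (Suc m))"
  interpret E: Module.module R ?E by (rule module_ext_power)
  have cl: "wedge_list R M (a # b # zs) \<in> carrier ?E" if "a \<in> carrier M" "b \<in> carrier M" for a b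
    using that zs by (intro wedge_list_closed) simp
  have snd: "wedge_list R M (a # (x \<oplus>\<^bsub>M\<^esub> y) # zs) = wedge_list R M (a # x # zs) \<oplus>\<^bsub>?E\<^esub> wedge_list R M (a # y # zs)"
    if "a \<in> carrier M" for a
    using wedge_list_update_add[of "a # x # zs" "Suc (Suc m)" "Suc 0" x y] that x y zs by simp
  have zero: "wedge_list R M (a # a # zs) = \<zero>\<^bsub>?E\<^esub>" if "a \<in> carrier M" for a
    using that zs by (intro wedge_list_not_distinct) auto
  have "\<zero>\<^bsub>?E\<^esub> = wedge_list R M ((x \<oplus>\<^bsub>M\<^esub> y) # (x \<oplus>\<^bsub>M\<^esub> y) # zs)"
    using x y by (simp add: zero)
  also have "\<dots> = wedge_list R M (x # y # zs) \<oplus>\<^bsub>?E\<^esub> wedge_list R M (y # x # zs)"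
    using x y zs by (subst wedge_list_Cons_add[where m = "Suc m"]) (simp_all add: snd zero cl)
  finally show ?thesis
    using cl[OF x y] cl[OF y x] E.M.minus_equality by simp
qed

end

subsection \<open>Differential forms of a quotient of the polynomial ring\<close>

text \<open>
  Both algebras of the theorem are instances, the polynomial ring itself with \<open>\<pi>\<close> the identity.
\<close>

locale presentation = B: cring B for B :: "('b, 'e) ring_scheme" (structure) +
  fixes n :: nat and \<pi> :: "'k::field mpol \<Rightarrow> 'b" and \<phi> :: "'k \<Rightarrow> 'b"
  assumes hom: "\<pi> \<in> Ring.ring_hom (poly_ring n) B"
    and surj: "\<pi> ` carrier (poly_ring n) = carrier B"
    and phi_eq: "\<phi> c = \<pi> (poly_const c)"
begin

abbreviation A :: "'k mpol set" where "A \<equiv> carrier (poly_ring n)"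

definition J :: "'k mpol set" where "J = {f \<in> A. \<pi> f = \<zero>}"

lemma pi_closed [simp]: "f \<in> A \<Longrightarrow> \<pi> f \<in> carrier B"
  and pi_add: "f \<in> A \<Longrightarrow> g \<in> A \<Longrightarrow> \<pi> (f + g) = \<pi> f \<oplus> \<pi> g"
  and pi_mult: "f \<in> A \<Longrightarrow> g \<in> A \<Longrightarrow> \<pi> (f * g) = \<pi> f \<otimes> \<pi> g"
  and pi_one [simp]: "\<pi> 1 = \<one>"
  using ring_hom_closed[OF hom] ring_hom_add[OF hom] ring_hom_mult[OF hom] ring_hom_one[OF hom]
  by simp_all

lemma pi_zero [simp]: "\<pi> 0 = \<zero>"
proof -
  have "\<pi> 0 \<oplus> \<pi> 0 = \<pi> 0" using pi_add[of 0 0] by simp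
  then show ?thesis using B.add.l_cancel_one[of "\<pi> 0" "\<pi> 0"] by simp
qed

lemma pi_diff: "f \<in> A \<Longrightarrow> g \<in> A \<Longrightarrow> \<pi> (f - g) = \<pi> f \<ominus> \<pi> g"
  using pi_add[of "f - g" g] poly_ring_diff[of f n g]
  by (simp add: B.minus_eq B.a_assoc B.r_neg)

lemma pi_uminus: "f \<in> A \<Longrightarrow> \<pi> (- f) = \<ominus> \<pi> f"
  using pi_diff[of 0 f] by (simp add: B.minus_eq)

lemma J_subset: "J \<subseteq> A"
  by (auto simp: J_def)

lemma diff_J: "f \<in> A \<Longrightarrow> g \<in> A \<Longrightarrow> \<pi> f = \<pi> g \<Longrightarrow> f - g \<in> J"
  by (simp add: J_def pi_diff poly_ring_diff B.minus_eq B.r_neg)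

text \<open>An arbitrary section of \<open>\<pi>\<close> on sets. It need not respect sums or
  products, but each failure to do so lies in the kernel \<open>J\<close>.\<close>

definition \<sigma> :: "'b \<Rightarrow> 'k mpol" where "\<sigma> b = (SOME f. f \<in> A \<and> \<pi> f = b)"

lemma \<sigma>: "b \<in> carrier B \<Longrightarrow> \<sigma> b \<in> A \<and> \<pi> (\<sigma> b) = b"
proof -
  assume "b \<in> carrier B"
  then have "b \<in> \<pi> ` A" by (simp add: surj)
  then have "\<exists>f. f \<in> A \<and> \<pi> f = b" by auto
  then show ?thesis unfolding \<sigma>_def by (rule someI_ex)
qed

lemma sigma_closed [simp]: "b \<in> carrier B \<Longrightarrow> \<sigma> b \<in> A"
  and pi_sigma [simp]: "b \<in> carrier B \<Longrightarrow> \<pi> (\<sigma> b) = b"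
  using \<sigma> by auto

section \<open>Linear maps into coordinate spaces, up to a submodule\<close>

definition lift :: "('x \<Rightarrow> 'i \<Rightarrow> 'k mpol) \<Rightarrow> ('x \<Rightarrow> 'b) \<Rightarrow> 'i \<Rightarrow> 'k mpol" where
  "lift g f = (\<Sum>x | f x \<noteq> \<zero>. smul (\<sigma> (f x)) (g x))"

text \<open>The submodules N for which \<open>fns n S\<close> modulo N is a module over B: those
  that contain all multiples by J. Modulo such an N the choices made by \<open>\<sigma>\<close> do
  not matter. The instances are the relations among one-forms and among m-forms.\<close>

definition absorbing :: "'i set \<Rightarrow> ('i \<Rightarrow> 'k mpol) set \<Rightarrow> bool" where
  "absorbing S N \<longleftrightarrow> N \<subseteq> fns n S \<and> 0 \<in> N \<and> (\<forall>v\<in>N. \<forall>w\<in>N. v + w \<in> N)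
    \<and> (\<forall>f\<in>A. \<forall>w\<in>N. smul f w \<in> N) \<and> (\<forall>f\<in>J. \<forall>w\<in>fns n S. smul f w \<in> N)"

context
  fixes S :: "'i set" and N
  assumes N: "absorbing S N"
begin

lemma absorbing_zero: "0 \<in> N"
  and absorbing_add: "v \<in> N \<Longrightarrow> w \<in> N \<Longrightarrow> v + w \<in> N"
  and absorbing_smul: "f \<in> A \<Longrightarrow> w \<in> N \<Longrightarrow> smul f w \<in> N"
  and absorbing_J: "f \<in> J \<Longrightarrow> w \<in> fns n S \<Longrightarrow> smul f w \<in> N"
  using N by (auto simp: absorbing_def)

lemma absorbing_uminus: "w \<in> N \<Longrightarrow> - w \<in> N"
  using absorbing_smul[of "- 1" w] by (simp add: poly_ring_uminus)

lemma absorbing_diff: "v \<in> N \<Longrightarrow> w \<in> N \<Longrightarrow> v - w \<in> N"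
  using absorbing_add[of v "- w"] absorbing_uminus by simp

lemma absorbing_trans: "u - v \<in> N \<Longrightarrow> v - w \<in> N \<Longrightarrow> u - w \<in> N"
  using absorbing_add[of "u - v" "v - w"] by simp

lemma absorbing_sum: "(\<And>x. x \<in> T \<Longrightarrow> w x \<in> N) \<Longrightarrow> sum w T \<in> N"
  by (induction T rule: infinite_finite_induct) (auto intro: absorbing_zero absorbing_add)

context
  fixes X and g :: "'x \<Rightarrow> 'i \<Rightarrow> 'k mpol"
  assumes g: "\<And>x. x \<in> X \<Longrightarrow> g x \<in> fns n S"
begin

lemma lift_closed:
  assumes f: "f \<in> carrier (free_module B X)"
  shows "lift g f \<in> fns n S"
  unfolding lift_def
proof (rule fns_sum)
  fix x assume "x \<in> {x. f x \<noteq> \<zero>}"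
  then show "smul (\<sigma> (f x)) (g x) \<in> fns n S"
    using B.free_module_outside[OF f] B.free_module_apply[OF f] g by (intro fns_smul) auto
qed

text \<open>Enlarging the support adds terms with coefficient \<open>\<sigma> \<zero>\<close>, which
  may differ from 0 but lies in \<open>J\<close>.\<close>

lemma lift_mod:
  assumes f: "f \<in> carrier (free_module B X)"
    and T: "finite T" "{x. f x \<noteq> \<zero>} \<subseteq> T" "T \<subseteq> X"
  shows "(\<Sum>x\<in>T. smul (\<sigma> (f x)) (g x)) - lift g f \<in> N"
proof -
  have "(\<Sum>x\<in>T. smul (\<sigma> (f x)) (g x)) - lift g f
      = (\<Sum>x\<in>T - {x. f x \<noteq> \<zero>}. smul (\<sigma> (f x)) (g x))"
    unfolding lift_def by (rule sum_diff[OF T(1,2), symmetric])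
  also have "\<dots> \<in> N"
    using T g diff_J[of "\<sigma> \<zero>" 0] by (intro absorbing_sum absorbing_J) auto
  finally show ?thesis .
qed

text \<open>The three lifts are sums over different supports and are first moved to a common one.
  There the coefficients differ by a failure of additivity of \<open>\<sigma>\<close>, which lies in
  \<open>J\<close>.\<close>

lemma lift_add:
  assumes f: "f \<in> carrier (free_module B X)" and h: "h \<in> carrier (free_module B X)"
  shows "lift g (f \<oplus>\<^bsub>free_module B X\<^esub> h) - (lift g f + lift g h) \<in> N"
proof -
  let ?T = "{x. f x \<noteq> \<zero>} \<union> {x. h x \<noteq> \<zero>}"
  have T: "finite ?T" "?T \<subseteq> X"
    using B.free_module_finite[OF f] B.free_module_finite[OF h]
      B.free_module_outside[OF f] B.free_module_outside[OF h] by auto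
  have fh: "f \<oplus>\<^bsub>free_module B X\<^esub> h \<in> carrier (free_module B X)"
    unfolding free_module_simps(3) by (rule B.free_module_add_closed[OF f h])
  have *: "(\<Sum>x\<in>?T. smul (\<sigma> (f x \<oplus> h x)) (g x)) - lift g (f \<oplus>\<^bsub>free_module B X\<^esub> h) \<in> N"
    "(\<Sum>x\<in>?T. smul (\<sigma> (f x)) (g x)) - lift g f \<in> N"
    "(\<Sum>x\<in>?T. smul (\<sigma> (h x)) (g x)) - lift g h \<in> N"
  proof -
    have "{x. (f \<oplus>\<^bsub>free_module B X\<^esub> h) x \<noteq> \<zero>} \<subseteq> ?T"
      by (auto simp: free_module_simps(3))
    from lift_mod[OF fh T(1) this T(2)]
    show "(\<Sum>x\<in>?T. smul (\<sigma> (f x \<oplus> h x)) (g x)) - lift g (f \<oplus>\<^bsub>free_module B X\<^esub> h) \<in> N"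
      by (simp only: free_module_simps(3))
  qed (rule lift_mod[OF f T(1) _ T(2)] lift_mod[OF h T(1) _ T(2)]; blast)+
  have "(\<Sum>x\<in>?T. smul (\<sigma> (f x \<oplus> h x)) (g x))
      - ((\<Sum>x\<in>?T. smul (\<sigma> (f x)) (g x)) + (\<Sum>x\<in>?T. smul (\<sigma> (h x)) (g x)))
    = (\<Sum>x\<in>?T. smul (\<sigma> (f x \<oplus> h x) - (\<sigma> (f x) + \<sigma> (h x))) (g x))"
    by (simp add: sum_subtractf sum.distrib smul_diff_left smul_add_left)
  also have "\<dots> \<in> N"
    using T g B.free_module_apply[OF f] B.free_module_apply[OF h]
    by (intro absorbing_sum absorbing_J diff_J) (auto simp: pi_add poly_ring_add)
  finally have "(\<Sum>x\<in>?T. smul (\<sigma> (f x \<oplus> h x)) (g x))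
      - ((\<Sum>x\<in>?T. smul (\<sigma> (f x)) (g x)) + (\<Sum>x\<in>?T. smul (\<sigma> (h x)) (g x))) \<in> N" .
  from absorbing_add[OF absorbing_diff[OF this *(1)] absorbing_add[OF *(2,3)]]
  show ?thesis by (simp add: algebra_simps)
qed

lemma lift_smult:
  assumes b: "b \<in> carrier B" and f: "f \<in> carrier (free_module B X)"
  shows "lift g (b \<odot>\<^bsub>free_module B X\<^esub> f) - smul (\<sigma> b) (lift g f) \<in> N"
proof -
  let ?T = "{x. f x \<noteq> \<zero>}"
  have T: "finite ?T" "?T \<subseteq> X"
    using B.free_module_finite[OF f] B.free_module_outside[OF f] by auto
  have bf: "b \<odot>\<^bsub>free_module B X\<^esub> f \<in> carrier (free_module B X)"
    unfolding free_module_simps(4) by (rule B.free_module_smult_closed[OF f b])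
  have 1: "(\<Sum>x\<in>?T. smul (\<sigma> (b \<otimes> f x)) (g x)) - lift g (b \<odot>\<^bsub>free_module B X\<^esub> f) \<in> N"
  proof -
    have "{x. (b \<odot>\<^bsub>free_module B X\<^esub> f) x \<noteq> \<zero>} \<subseteq> ?T"
      using b by (auto simp: free_module_simps(4))
    from lift_mod[OF bf T(1) this T(2)] show ?thesis
      by (simp only: free_module_simps(4))
  qed
  have "(\<Sum>x\<in>?T. smul (\<sigma> (b \<otimes> f x)) (g x)) - smul (\<sigma> b) (lift g f)
      = (\<Sum>x\<in>?T. smul (\<sigma> (b \<otimes> f x) - \<sigma> b * \<sigma> (f x)) (g x))"
    by (simp add: lift_def smul_sum sum_subtractf smul_diff_left)
  also have "\<dots> \<in> N"
  proof (rule absorbing_sum)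
    fix x assume x: "x \<in> ?T"
    have fx: "f x \<in> carrier B" by (rule B.free_module_apply[OF f])
    have "\<sigma> (b \<otimes> f x) - \<sigma> b * \<sigma> (f x) \<in> J"
      using b fx pi_mult[of "\<sigma> b" "\<sigma> (f x)"] by (intro diff_J poly_ring_mult) simp_all
    then show "smul (\<sigma> (b \<otimes> f x) - \<sigma> b * \<sigma> (f x)) (g x) \<in> N"
      using x T g by (intro absorbing_J) auto
  qed
  finally have 2: "(\<Sum>x\<in>?T. smul (\<sigma> (b \<otimes> f x)) (g x)) - smul (\<sigma> b) (lift g f) \<in> N" .
  from absorbing_diff[OF 2 1] show ?thesis by simp
qed

lemma lift_minus:
  assumes f: "f \<in> carrier (free_module B X)" and h: "h \<in> carrier (free_module B X)"
  shows "lift g (f \<ominus>\<^bsub>free_module B X\<^esub> h) - (lift g f - lift g h) \<in> N"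
proof -
  let ?d = "f \<ominus>\<^bsub>free_module B X\<^esub> h"
  have d: "?d \<in> carrier (free_module B X)"
    using B.module_free_module f h by (meson abelian_group.minus_closed Module.module.axioms(2))
  have "f i \<ominus> h i \<oplus> h i = f i" for i
    using B.free_module_apply[OF f] B.free_module_apply[OF h]
    by (simp add: B.minus_eq B.a_assoc B.l_neg)
  then have "?d \<oplus>\<^bsub>free_module B X\<^esub> h = f"
    unfolding B.free_module_minus[OF f h] free_module_simps(3) by simp
  then have "- (lift g f - (lift g ?d + lift g h)) \<in> N"
    using absorbing_uminus[OF lift_add[OF d h]] by simp
  then show ?thesis by (simp add: algebra_simps)
qed

lemma lift_gen:
  assumes x: "x \<in> X"
  shows "lift g (free_gen B x) - g x \<in> N"
proof -
  have "{y. free_gen B x y \<noteq> \<zero>} \<subseteq> {x}" "free_gen B x x = \<one>"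
    by (auto simp: free_gen_def)
  then have 1: "smul (\<sigma> \<one>) (g x) - lift g (free_gen B x) \<in> N"
    using lift_mod[OF B.free_gen_closed[OF x], of "{x}"] x by simp
  have 2: "smul (\<sigma> \<one> - 1) (g x) \<in> N"
    using x g by (intro absorbing_J diff_J) auto
  from absorbing_diff[OF 2 1] show ?thesis
    by (simp add: smul_diff_left)
qed

text \<open>This takes the place of the universal property of a quotient: since
  \<open>lift g\<close> is linear modulo N, it is enough to know its values on the generating
  relations.\<close>

lemma lift_kernel:
  assumes R: "R \<subseteq> carrier (free_module B X)" and ker: "\<And>r. r \<in> R \<Longrightarrow> lift g r \<in> N"
    and f: "f \<in> LinearCombinations.module.span B (free_module B X) R"
  shows "lift g f \<in> N"
proof -
  let ?F = "free_module B X" and ?P = "\<lambda>f. lift g f \<in> N"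
  have zero: "?P \<zero>\<^bsub>?F\<^esub>"
    by (simp add: lift_def free_module_simps(2) absorbing_zero)
  have add: "?P (f \<oplus>\<^bsub>?F\<^esub> h)"
    if fh: "f \<in> carrier ?F" "h \<in> carrier ?F" and P: "?P f" "?P h" for f h
  proof -
    have "(lift g (f \<oplus>\<^bsub>?F\<^esub> h) - (lift g f + lift g h)) + (lift g f + lift g h) \<in> N"
      by (intro absorbing_add lift_add fh P)
    then show ?thesis by simp
  qed
  have smult: "?P (b \<odot>\<^bsub>?F\<^esub> f)" if b: "b \<in> carrier B" and f: "f \<in> carrier ?F" and P: "?P f" for b f
  proof -
    have "(lift g (b \<odot>\<^bsub>?F\<^esub> f) - smul (\<sigma> b) (lift g f)) + smul (\<sigma> b) (lift g f) \<in> N"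
      by (intro absorbing_add lift_smult absorbing_smul sigma_closed b f P)
    then show ?thesis by simp
  qed
  show ?thesis
    by (rule module.span_induct[OF B.module_free_module f R, where P = ?P, OF zero ker add smult])
qed

end

end

lemma absorbing_rel_covecs: "absorbing {1..n} (rel_covecs n J)"
  unfolding absorbing_def
  by (auto intro: rel_covecs_subset[OF J_subset] rel_covecs.intros rel_covecs_smul[OF J_subset])

lemma absorbing_rel_forms: "absorbing (ksubsets n m) (rel_forms n J m)"
  unfolding absorbing_def
  by (auto intro: rel_forms_subset[OF J_subset] rel_forms.intros rel_forms_smul[OF J_subset])

end

context presentation
begin

abbreviation "FB \<equiv> free_module B (carrier B)"
abbreviation "rel1 \<equiv> kaehler_submodule (class_ring :: 'k ring) B \<phi>"
abbreviation "Om \<equiv> kaehler (class_ring :: 'k ring) B \<phi>"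
abbreviation "d \<equiv> kaehler_d (class_ring :: 'k ring) B \<phi>"
abbreviation "krel \<equiv> kaehler_relations (class_ring :: 'k ring) B \<phi>"

lemma phi_closed [simp]: "\<phi> c \<in> carrier B"
  by (simp add: phi_eq)

lemma kaehler_relations_cases [consumes 1, case_names add mult const]:
  assumes "r \<in> krel"
  obtains b c where "b \<in> carrier B" "c \<in> carrier B"
      "r = free_gen B (b \<oplus> c) \<ominus>\<^bsub>FB\<^esub> (free_gen B b \<oplus>\<^bsub>FB\<^esub> free_gen B c)"
  | b c where "b \<in> carrier B" "c \<in> carrier B"
      "r = free_gen B (b \<otimes> c) \<ominus>\<^bsub>FB\<^esub> (b \<odot>\<^bsub>FB\<^esub> free_gen B c \<oplus>\<^bsub>FB\<^esub> c \<odot>\<^bsub>FB\<^esub> free_gen B b)"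
  | a where "r = free_gen B (\<phi> a)"
  using assms unfolding kaehler_relations_def Let_def by auto

lemma module_FB: "Module.module B FB"
  by (rule B.module_free_module)

lemma gen_FB: "b \<in> carrier B \<Longrightarrow> free_gen B b \<in> carrier FB"
  by (rule B.free_gen_closed)

lemma kaehler_relations_subset: "krel \<subseteq> carrier FB"
proof
  interpret F: Module.module B FB by (rule module_FB)
  fix r assume "r \<in> krel"
  then show "r \<in> carrier FB"
    by (cases rule: kaehler_relations_cases) (auto intro!: gen_FB)
qed

lemma quotient_kaehler: "quotient_module B FB rel1"
proof -
  have "submodule B rel1 FB"
    unfolding kaehler_submodule_def
    by (rule LinearCombinations.module.span_is_submodule[OF module_FB kaehler_relations_subset])
  then show ?thesis
    by (intro quotient_module.intro quotient_module_axioms.intro module_FB)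
qed

lemmas k_quot_carrier = quotient_module.quot_carrier[OF quotient_kaehler]
  and k_coset_closed = quotient_module.coset_closed[OF quotient_kaehler]
  and k_coset_add = quotient_module.coset_add[OF quotient_kaehler]
  and k_coset_smult = quotient_module.coset_smult[OF quotient_kaehler]
  and k_coset_zero = quotient_module.coset_zero[OF quotient_kaehler]
  and k_coset_eq_iff = quotient_module.coset_eq_iff[OF quotient_kaehler]
  and k_coset_eq_zero_iff = quotient_module.coset_eq_zero_iff[OF quotient_kaehler]

lemma kaehler_eq: "Om = quot_module FB rel1"
  by (simp add: kaehler_def)

lemma module_kaehler: "Module.module B Om"
  unfolding kaehler_eq by (rule quotient_module.module_quot[OF quotient_kaehler])

lemma exterior_kaehler: "exterior B Om"
  by (intro exterior.intro module_kaehler)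

lemma d_eq: "d b = rel1 +>\<^bsub>FB\<^esub> free_gen B b"
  by (simp add: kaehler_d_def)

lemma krel_in_rel1: "r \<in> krel \<Longrightarrow> r \<in> rel1"
  using LinearCombinations.module.in_own_span[OF module_FB kaehler_relations_subset]
  unfolding kaehler_submodule_def by blast

lemma d_closed [simp]: "b \<in> carrier B \<Longrightarrow> d b \<in> carrier Om"
  unfolding d_eq kaehler_eq by (intro k_coset_closed gen_FB)

lemma d_add:
  assumes b: "b \<in> carrier B" and c: "c \<in> carrier B"
  shows "d (b \<oplus> c) = d b \<oplus>\<^bsub>Om\<^esub> d c"
proof -
  interpret F: Module.module B FB by (rule module_FB)
  have "free_gen B (b \<oplus> c) \<ominus>\<^bsub>FB\<^esub> (free_gen B b \<oplus>\<^bsub>FB\<^esub> free_gen B c) \<in> rel1"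
    by (rule krel_in_rel1, unfold kaehler_relations_def Let_def) (use b c in blast)
  then have "d (b \<oplus> c) = rel1 +>\<^bsub>FB\<^esub> (free_gen B b \<oplus>\<^bsub>FB\<^esub> free_gen B c)"
    unfolding d_eq using b c by (subst k_coset_eq_iff) (auto intro!: gen_FB)
  also have "\<dots> = d b \<oplus>\<^bsub>Om\<^esub> d c"
    unfolding d_eq kaehler_eq by (rule k_coset_add[symmetric]) (auto intro!: gen_FB b c)
  finally show ?thesis .
qed

lemma d_mult:
  assumes b: "b \<in> carrier B" and c: "c \<in> carrier B"
  shows "d (b \<otimes> c) = b \<odot>\<^bsub>Om\<^esub> d c \<oplus>\<^bsub>Om\<^esub> c \<odot>\<^bsub>Om\<^esub> d b"
proof -
  interpret F: Module.module B FB by (rule module_FB)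
  have "free_gen B (b \<otimes> c) \<ominus>\<^bsub>FB\<^esub> (b \<odot>\<^bsub>FB\<^esub> free_gen B c \<oplus>\<^bsub>FB\<^esub> c \<odot>\<^bsub>FB\<^esub> free_gen B b) \<in> rel1"
    by (rule krel_in_rel1, unfold kaehler_relations_def Let_def) (use b c in blast)
  then have "d (b \<otimes> c) = rel1 +>\<^bsub>FB\<^esub> (b \<odot>\<^bsub>FB\<^esub> free_gen B c \<oplus>\<^bsub>FB\<^esub> c \<odot>\<^bsub>FB\<^esub> free_gen B b)"
    unfolding d_eq using b c by (subst k_coset_eq_iff) (auto intro!: gen_FB)
  also have "\<dots> = b \<odot>\<^bsub>Om\<^esub> d c \<oplus>\<^bsub>Om\<^esub> c \<odot>\<^bsub>Om\<^esub> d b"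
    unfolding d_eq kaehler_eq using b c by (simp add: k_coset_add k_coset_smult gen_FB)
  finally show ?thesis .
qed

lemma d_const: "d (\<phi> a) = \<zero>\<^bsub>Om\<^esub>"
proof -
  have "free_gen B (\<phi> a) \<in> rel1"
    by (rule krel_in_rel1, unfold kaehler_relations_def Let_def) auto
  then show ?thesis
    unfolding d_eq kaehler_eq using gen_FB by (simp add: k_coset_eq_zero_iff)
qed

lemma kaehler_induct [consumes 1, case_names zero d add]:
  assumes "x \<in> carrier Om"
    and zero: "P \<zero>\<^bsub>Om\<^esub>"
    and gen: "\<And>b c. b \<in> carrier B \<Longrightarrow> c \<in> carrier B \<Longrightarrow> P (b \<odot>\<^bsub>Om\<^esub> d c)"
    and add: "\<And>x y. x \<in> carrier Om \<Longrightarrow> y \<in> carrier Om \<Longrightarrow> P x \<Longrightarrow> P y \<Longrightarrow> P (x \<oplus>\<^bsub>Om\<^esub> y)"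
  shows "P x"
proof -
  obtain f where f: "f \<in> carrier FB" and x: "x = rel1 +>\<^bsub>FB\<^esub> f"
    using assms(1) unfolding kaehler_eq k_quot_carrier by blast
  have "P (rel1 +>\<^bsub>FB\<^esub> f)"
    using f
  proof (rule B.free_module_induct)
    show "P (rel1 +>\<^bsub>FB\<^esub> \<zero>\<^bsub>FB\<^esub>)"
      using zero by (simp add: k_coset_zero kaehler_eq)
  next
    fix b c assume "b \<in> carrier B" "c \<in> carrier B"
    then show "P (rel1 +>\<^bsub>FB\<^esub> (b \<odot>\<^bsub>FB\<^esub> free_gen B c))"
      using gen[of b c] by (simp add: kaehler_eq d_eq k_coset_smult gen_FB)
  next
    fix f g assume "f \<in> carrier FB" "g \<in> carrier FB" "P (rel1 +>\<^bsub>FB\<^esub> f)" "P (rel1 +>\<^bsub>FB\<^esub> g)"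
    then show "P (rel1 +>\<^bsub>FB\<^esub> (f \<oplus>\<^bsub>FB\<^esub> g))"
      using add[of "rel1 +>\<^bsub>FB\<^esub> f" "rel1 +>\<^bsub>FB\<^esub> g"]
      by (simp add: kaehler_eq k_coset_add k_coset_closed)
  qed
  then show ?thesis by (simp add: x)
qed

subsection \<open>From Kaehler forms to concrete forms\<close>

text \<open>The inverse of \<open>eval1\<close> up to relations: the symbol db goes to the gradient
  of a polynomial that represents b.\<close>

definition lift1 :: "('b \<Rightarrow> 'b) \<Rightarrow> nat \<Rightarrow> 'k mpol" where
  "lift1 = lift (\<lambda>b. grad n (\<sigma> b))"

text \<open>The representative is arbitrary; by \<open>\<tau>_coset\<close> any other one changes
  the value by a relation only.\<close>

definition \<tau> :: "('b \<Rightarrow> 'b) set \<Rightarrow> nat \<Rightarrow> 'k mpol" where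
  "\<tau> x = lift1 (SOME f. f \<in> carrier FB \<and> rel1 +>\<^bsub>FB\<^esub> f = x)"

lemma grad_sigma: "b \<in> carrier B \<Longrightarrow> grad n (\<sigma> b) \<in> covecs n"
  by (intro grad_covecs sigma_closed)

lemmas l1 = absorbing_rel_covecs grad_sigma

lemma grad_J: "f \<in> J \<Longrightarrow> grad n f \<in> rel_covecs n J"
  using rel_covecs.grad[of f J 1 n] by simp

lemmas rc_trans = absorbing_trans[OF absorbing_rel_covecs]
  and rc_uminus = absorbing_uminus[OF absorbing_rel_covecs]
  and rc_diff = absorbing_diff[OF absorbing_rel_covecs]
  and rc_smul = absorbing_smul[OF absorbing_rel_covecs]

lemma lift1_add: "f \<in> carrier FB \<Longrightarrow> h \<in> carrier FB \<Longrightarrow>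
    lift1 (f \<oplus>\<^bsub>FB\<^esub> h) - (lift1 f + lift1 h) \<in> rel_covecs n J"
  unfolding lift1_def by (rule lift_add[OF l1])

lemma lift1_smult: "b \<in> carrier B \<Longrightarrow> f \<in> carrier FB \<Longrightarrow>
    lift1 (b \<odot>\<^bsub>FB\<^esub> f) - smul (\<sigma> b) (lift1 f) \<in> rel_covecs n J"
  unfolding lift1_def by (rule lift_smult[OF l1])

lemma lift1_minus: "f \<in> carrier FB \<Longrightarrow> h \<in> carrier FB \<Longrightarrow>
    lift1 (f \<ominus>\<^bsub>FB\<^esub> h) - (lift1 f - lift1 h) \<in> rel_covecs n J"
  unfolding lift1_def by (rule lift_minus[OF l1])

lemma lift1_gen: "b \<in> carrier B \<Longrightarrow> lift1 (free_gen B b) - grad n (\<sigma> b) \<in> rel_covecs n J"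
  unfolding lift1_def by (rule lift_gen[OF l1])

lemma lift1_closed: "f \<in> carrier FB \<Longrightarrow> lift1 f \<in> covecs n"
  unfolding lift1_def by (rule lift_closed[OF l1])

text \<open>Each relation compares \<open>\<sigma>\<close> of a sum, a product or a constant with
  the same expression formed from polynomials. These differ by an element of \<open>J\<close>, so
  their gradients differ by a relation, while \<open>grad\<close> itself obeys the sum and product
  rules exactly.\<close>

lemma lift1_krel:
  assumes "r \<in> krel"
  shows "lift1 r \<in> rel_covecs n J"
  using assms
proof (cases rule: kaehler_relations_cases)
  case (add b c)
  interpret F: Module.module B FB by (rule module_FB)
  note g = gen_FB[OF add(1)] gen_FB[OF add(2)] gen_FB[OF B.a_closed[OF add(1,2)]]
  have bc: "free_gen B b \<oplus>\<^bsub>FB\<^esub> free_gen B c \<in> carrier FB" using g by simp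
  have "grad n (\<sigma> (b \<oplus> c) - (\<sigma> b + \<sigma> c)) \<in> rel_covecs n J"
    using add by (intro grad_J diff_J) (simp_all add: pi_add poly_ring_add)
  then have "grad n (\<sigma> (b \<oplus> c)) - (grad n (\<sigma> b) + grad n (\<sigma> c)) \<in> rel_covecs n J"
    by (simp add: grad_diff grad_add)
  moreover note lift1_gen[OF add(1)] lift1_gen[OF add(2)] lift1_gen[OF B.a_closed[OF add(1,2)]]
    lift1_minus[OF g(3) bc] lift1_add[OF g(1,2)]
  \<comment> \<open>A telescoping sum: every bracket is a relation, the intermediate lifts and
    gradients cancel, and \<open>lift1 r\<close> remains.\<close>
  ultimately have "(lift1 r - (lift1 (free_gen B (b \<oplus> c)) - lift1 (free_gen B b \<oplus>\<^bsub>FB\<^esub> free_gen B c)))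
     + ((lift1 (free_gen B (b \<oplus> c)) - grad n (\<sigma> (b \<oplus> c)))
     + ((grad n (\<sigma> (b \<oplus> c)) - (grad n (\<sigma> b) + grad n (\<sigma> c)))
     + (- (lift1 (free_gen B b \<oplus>\<^bsub>FB\<^esub> free_gen B c) - (lift1 (free_gen B b) + lift1 (free_gen B c)))
     + (- (lift1 (free_gen B b) - grad n (\<sigma> b)) + - (lift1 (free_gen B c) - grad n (\<sigma> c))))))
    \<in> rel_covecs n J"
    unfolding add(3) by (intro rel_covecs.add rc_uminus)
  then show ?thesis by (simp add: algebra_simps)
next
  case (mult b c)
  interpret F: Module.module B FB by (rule module_FB)
  note g = gen_FB[OF mult(1)] gen_FB[OF mult(2)] gen_FB[OF B.m_closed[OF mult(1,2)]]
  let ?b = "free_gen B b" and ?c = "free_gen B c" and ?bc = "free_gen B (b \<otimes> c)"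
  have h: "b \<odot>\<^bsub>FB\<^esub> ?c \<in> carrier FB" "c \<odot>\<^bsub>FB\<^esub> ?b \<in> carrier FB"
    using g mult by simp_all
  then have s: "b \<odot>\<^bsub>FB\<^esub> ?c \<oplus>\<^bsub>FB\<^esub> c \<odot>\<^bsub>FB\<^esub> ?b \<in> carrier FB" by simp
  have "grad n (\<sigma> (b \<otimes> c) - \<sigma> b * \<sigma> c) \<in> rel_covecs n J"
    using mult by (intro grad_J diff_J) (simp_all add: pi_mult poly_ring_mult)
  then have 1: "grad n (\<sigma> (b \<otimes> c)) - (smul (\<sigma> b) (grad n (\<sigma> c)) + smul (\<sigma> c) (grad n (\<sigma> b)))
      \<in> rel_covecs n J"
    by (simp add: grad_diff grad_mult)
  have 2: "smul (\<sigma> b) (lift1 ?c - grad n (\<sigma> c)) \<in> rel_covecs n J"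
    "smul (\<sigma> c) (lift1 ?b - grad n (\<sigma> b)) \<in> rel_covecs n J"
    using mult lift1_gen by (auto intro!: rc_smul)
  from 1 2 lift1_gen[OF B.m_closed[OF mult(1,2)]] lift1_minus[OF g(3) s] lift1_add[OF h]
    lift1_smult[OF mult(1) g(2)] lift1_smult[OF mult(2) g(1)]
  have "(lift1 r - (lift1 ?bc - lift1 (b \<odot>\<^bsub>FB\<^esub> ?c \<oplus>\<^bsub>FB\<^esub> c \<odot>\<^bsub>FB\<^esub> ?b)))
     + ((lift1 ?bc - grad n (\<sigma> (b \<otimes> c)))
     + ((grad n (\<sigma> (b \<otimes> c)) - (smul (\<sigma> b) (grad n (\<sigma> c)) + smul (\<sigma> c) (grad n (\<sigma> b))))
     + (- (lift1 (b \<odot>\<^bsub>FB\<^esub> ?c \<oplus>\<^bsub>FB\<^esub> c \<odot>\<^bsub>FB\<^esub> ?b) - (lift1 (b \<odot>\<^bsub>FB\<^esub> ?c) + lift1 (c \<odot>\<^bsub>FB\<^esub> ?b)))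
     + (- (lift1 (b \<odot>\<^bsub>FB\<^esub> ?c) - smul (\<sigma> b) (lift1 ?c))
     + (- (lift1 (c \<odot>\<^bsub>FB\<^esub> ?b) - smul (\<sigma> c) (lift1 ?b))
     + (- smul (\<sigma> b) (lift1 ?c - grad n (\<sigma> c)) + - smul (\<sigma> c) (lift1 ?b - grad n (\<sigma> b))))))))
    \<in> rel_covecs n J"
    unfolding mult(3) by (intro rel_covecs.add rc_uminus)
  then show ?thesis by (simp add: smul_diff algebra_simps)
next
  case (const a)
  have "grad n (\<sigma> (\<phi> a) - poly_const a) \<in> rel_covecs n J"
    by (intro grad_J diff_J) (simp_all add: phi_eq)
  then have "(lift1 r - grad n (\<sigma> (\<phi> a))) + grad n (\<sigma> (\<phi> a)) \<in> rel_covecs n J"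
    unfolding const using lift1_gen[of "\<phi> a"] by (intro rel_covecs.add) (simp_all add: grad_diff)
  then show ?thesis by simp
qed

lemma lift1_rel1: "f \<in> rel1 \<Longrightarrow> lift1 f \<in> rel_covecs n J"
  unfolding kaehler_submodule_def lift1_def
  by (rule lift_kernel[OF l1 kaehler_relations_subset])
     (use lift1_krel in \<open>simp_all add: lift1_def\<close>)

lemma \<tau>_rep:
  assumes "x \<in> carrier Om"
  obtains f where "f \<in> carrier FB" "rel1 +>\<^bsub>FB\<^esub> f = x" "\<tau> x = lift1 f"
proof -
  have "\<exists>f. f \<in> carrier FB \<and> rel1 +>\<^bsub>FB\<^esub> f = x"
    using assms unfolding kaehler_eq k_quot_carrier by blast
  from someI_ex[OF this] show ?thesis
    using that unfolding \<tau>_def by blast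
qed

lemma \<tau>_closed: "x \<in> carrier Om \<Longrightarrow> \<tau> x \<in> covecs n"
  by (erule \<tau>_rep) (simp add: lift1_closed)

lemma \<tau>_coset:
  assumes f: "f \<in> carrier FB"
  shows "\<tau> (rel1 +>\<^bsub>FB\<^esub> f) - lift1 f \<in> rel_covecs n J"
proof -
  have "rel1 +>\<^bsub>FB\<^esub> f \<in> carrier Om"
    unfolding kaehler_eq by (rule k_coset_closed[OF f])
  then obtain g where g: "g \<in> carrier FB" "rel1 +>\<^bsub>FB\<^esub> g = rel1 +>\<^bsub>FB\<^esub> f" "\<tau> (rel1 +>\<^bsub>FB\<^esub> f) = lift1 g"
    by (rule \<tau>_rep)
  have "lift1 (g \<ominus>\<^bsub>FB\<^esub> f) \<in> rel_covecs n J"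
    using g k_coset_eq_iff[OF g(1) f] by (intro lift1_rel1) simp
  from rc_diff[OF this lift1_minus[OF g(1) f]] show ?thesis
    by (simp add: g(3))
qed

lemma \<tau>_add:
  assumes "x \<in> carrier Om" "y \<in> carrier Om"
  shows "\<tau> (x \<oplus>\<^bsub>Om\<^esub> y) - (\<tau> x + \<tau> y) \<in> rel_covecs n J"
proof -
  interpret F: Module.module B FB by (rule module_FB)
  obtain f where f: "f \<in> carrier FB" "rel1 +>\<^bsub>FB\<^esub> f = x" "\<tau> x = lift1 f" using assms(1) by (rule \<tau>_rep)
  obtain g where g: "g \<in> carrier FB" "rel1 +>\<^bsub>FB\<^esub> g = y" "\<tau> y = lift1 g" using assms(2) by (rule \<tau>_rep)
  have "x \<oplus>\<^bsub>Om\<^esub> y = rel1 +>\<^bsub>FB\<^esub> (f \<oplus>\<^bsub>FB\<^esub> g)"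
    unfolding kaehler_eq using k_coset_add[OF f(1) g(1)] f(2) g(2) by simp
  then show ?thesis
    using rc_trans[OF \<tau>_coset[of "f \<oplus>\<^bsub>FB\<^esub> g"] lift1_add[OF f(1) g(1)]] f g by simp
qed

lemma \<tau>_smult:
  assumes b: "b \<in> carrier B" and "x \<in> carrier Om"
  shows "\<tau> (b \<odot>\<^bsub>Om\<^esub> x) - smul (\<sigma> b) (\<tau> x) \<in> rel_covecs n J"
proof -
  interpret F: Module.module B FB by (rule module_FB)
  obtain f where f: "f \<in> carrier FB" "rel1 +>\<^bsub>FB\<^esub> f = x" "\<tau> x = lift1 f" using assms(2) by (rule \<tau>_rep)
  have "b \<odot>\<^bsub>Om\<^esub> x = rel1 +>\<^bsub>FB\<^esub> (b \<odot>\<^bsub>FB\<^esub> f)"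
    unfolding kaehler_eq using k_coset_smult[OF b f(1)] f(2) by simp
  then show ?thesis
    using rc_trans[OF \<tau>_coset[of "b \<odot>\<^bsub>FB\<^esub> f"] lift1_smult[OF b f(1)]] f b by simp
qed

lemma \<tau>_d:
  assumes f: "f \<in> A"
  shows "\<tau> (d (\<pi> f)) - grad n f \<in> rel_covecs n J"
proof -
  have "grad n (\<sigma> (\<pi> f) - f) \<in> rel_covecs n J"
    using f by (intro grad_J diff_J) simp_all
  then have "grad n (\<sigma> (\<pi> f)) - grad n f \<in> rel_covecs n J"
    by (simp add: grad_diff)
  then show ?thesis
    unfolding d_eq using f
    by (intro rc_trans[OF \<tau>_coset rc_trans[OF lift1_gen]]) (simp_all add: gen_FB)
qed

lemma list_all2_\<tau>:
  assumes "set xs \<subseteq> carrier Om"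
  shows "list_all2 (\<lambda>u v. u \<in> covecs n \<and> v \<in> covecs n \<and> u - v \<in> rel_covecs n J)
    (map \<tau> xs) (map \<tau> xs)"
  using assms by (auto simp: list_all2_conv_all_nth subset_iff intro!: \<tau>_closed rel_covecs.zero)

text \<open>The inverse of \<open>evalm\<close> up to relations: a tuple goes to the product of the
  coordinate vectors of its entries. It lives on the free module on tuples;
  \<open>liftm_ext_submodule\<close> makes it compatible with the quotient.\<close>

definition liftm :: "(('b \<Rightarrow> 'b) set list \<Rightarrow> 'b) \<Rightarrow> nat set \<Rightarrow> 'k mpol" where
  "liftm = lift (\<lambda>xs. wedges (map \<tau> xs))"

lemma wedges_\<tau>: "xs \<in> tuples Om m \<Longrightarrow> wedges (map \<tau> xs) \<in> forms n m"
  using wedges_forms[of "map \<tau> xs" n] \<tau>_closed by (auto simp: tuples_def)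

context
  fixes m :: nat
begin

abbreviation (input) "tens \<equiv> free_module B (tuples Om m)"

lemma liftm_add: "f \<in> carrier tens \<Longrightarrow> h \<in> carrier tens \<Longrightarrow>
    liftm (f \<oplus>\<^bsub>tens\<^esub> h) - (liftm f + liftm h) \<in> rel_forms n J m"
  unfolding liftm_def by (rule lift_add[OF absorbing_rel_forms wedges_\<tau>])

lemma liftm_smult: "b \<in> carrier B \<Longrightarrow> f \<in> carrier tens \<Longrightarrow>
    liftm (b \<odot>\<^bsub>tens\<^esub> f) - smul (\<sigma> b) (liftm f) \<in> rel_forms n J m"
  unfolding liftm_def by (rule lift_smult[OF absorbing_rel_forms wedges_\<tau>])

lemma liftm_minus: "f \<in> carrier tens \<Longrightarrow> h \<in> carrier tens \<Longrightarrow>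
    liftm (f \<ominus>\<^bsub>tens\<^esub> h) - (liftm f - liftm h) \<in> rel_forms n J m"
  unfolding liftm_def by (rule lift_minus[OF absorbing_rel_forms wedges_\<tau>])

lemma liftm_gen: "xs \<in> tuples Om m \<Longrightarrow>
    liftm (free_gen B xs) - wedges (map \<tau> xs) \<in> rel_forms n J m"
  unfolding liftm_def by (rule lift_gen[OF absorbing_rel_forms wedges_\<tau>])

end

lemmas rf_uminus = absorbing_uminus[OF absorbing_rel_forms]
  and rf_trans = absorbing_trans[OF absorbing_rel_forms]
  and rf_smul = absorbing_smul[OF absorbing_rel_forms]

lemma wedges_update_rel:
  assumes xs: "xs \<in> tuples Om m" and x: "x \<in> carrier Om" and u: "u \<in> covecs n"
    and xu: "\<tau> x - u \<in> rel_covecs n J"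
  shows "wedges (map \<tau> (xs[i := x])) - wedges ((map \<tau> xs)[i := u]) \<in> rel_forms n J m"
proof -
  have "list_all2 (\<lambda>u v. u \<in> covecs n \<and> v \<in> covecs n \<and> u - v \<in> rel_covecs n J)
      ((map \<tau> xs)[i := \<tau> x]) ((map \<tau> xs)[i := u])"
    using list_all2_\<tau>[of xs] xs x u xu \<tau>_closed[OF x]
    by (intro list_all2_update_cong) (auto simp: tuples_def)
  from wedges_cong_rel[OF J_subset this] show ?thesis
    using xs by (simp add: map_update tuples_def)
qed

text \<open>\<open>wedges\<close> is multilinear exactly, and \<open>\<tau>\<close> is linear up to
  relations, which \<open>wedges_update_rel\<close> passes on to the products. If an entry is
  repeated, so is its coordinate vector, and the product is 0.\<close>

lemma liftm_ext_relations:
  assumes "r \<in> ext_relations B Om m"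
  shows "liftm r \<in> rel_forms n J m"
proof -
  interpret E: exterior B Om by (rule exterior_kaehler)
  interpret F: Module.module B "free_module B (tuples Om m)" by (rule E.module_tens)
  let ?F = "free_module B (tuples Om m)"
  show ?thesis
    using assms
  proof (cases rule: E.ext_relations_cases)
    case (add xs i x y)
    let ?e = "\<lambda>z. free_gen B (xs[i := z])" and ?w = "\<lambda>z. wedges (map \<tau> (xs[i := z]))"
    have t: "xs[i := z] \<in> tuples Om m" if "z \<in> carrier Om" for z
      using add(1) that by (rule E.tuples_update)
    note g = E.gen_closed[OF t[OF add(3)]] E.gen_closed[OF t[OF add(4)]]
    have xy: "x \<oplus>\<^bsub>Om\<^esub> y \<in> carrier Om" using add by simp
    note g' = E.gen_closed[OF t[OF xy]]
    have s: "?e x \<oplus>\<^bsub>?F\<^esub> ?e y \<in> carrier ?F" using g by simp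
    have i: "i < length (map \<tau> xs)" using add by (simp add: tuples_def)
    have "?w (x \<oplus>\<^bsub>Om\<^esub> y) - wedges ((map \<tau> xs)[i := \<tau> x + \<tau> y]) \<in> rel_forms n J m"
      using add by (intro wedges_update_rel xy \<tau>_add fns_add \<tau>_closed)
    then have 1: "?w (x \<oplus>\<^bsub>Om\<^esub> y) - (?w x + ?w y) \<in> rel_forms n J m"
      using wedges_update_add[OF i, of "\<tau> x" "\<tau> y"] by (simp add: map_update)
    from 1 liftm_minus[OF g' s] liftm_add[OF g] liftm_gen[OF t[OF xy]] liftm_gen[OF t[OF add(3)]]
      liftm_gen[OF t[OF add(4)]]
    have "(liftm r - (liftm (?e (x \<oplus>\<^bsub>Om\<^esub> y)) - liftm (?e x \<oplus>\<^bsub>?F\<^esub> ?e y)))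
      + ((liftm (?e (x \<oplus>\<^bsub>Om\<^esub> y)) - ?w (x \<oplus>\<^bsub>Om\<^esub> y)) + ((?w (x \<oplus>\<^bsub>Om\<^esub> y) - (?w x + ?w y))
      + (- (liftm (?e x \<oplus>\<^bsub>?F\<^esub> ?e y) - (liftm (?e x) + liftm (?e y)))
      + (- (liftm (?e x) - ?w x) + - (liftm (?e y) - ?w y))))) \<in> rel_forms n J m"
      unfolding add(5) by (intro rel_forms.add rf_uminus)
    then show ?thesis by (simp add: algebra_simps)
  next
    case (smult xs i b x)
    let ?e = "\<lambda>z. free_gen B (xs[i := z])" and ?w = "\<lambda>z. wedges (map \<tau> (xs[i := z]))"
    have t: "xs[i := z] \<in> tuples Om m" if "z \<in> carrier Om" for z
      using smult(1) that by (rule E.tuples_update)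
    have bx: "b \<odot>\<^bsub>Om\<^esub> x \<in> carrier Om" using smult by simp
    note g = E.gen_closed[OF t[OF smult(4)]] E.gen_closed[OF t[OF bx]]
    have s: "b \<odot>\<^bsub>?F\<^esub> ?e x \<in> carrier ?F" using g smult by simp
    have i: "i < length (map \<tau> xs)" using smult by (simp add: tuples_def)
    have "?w (b \<odot>\<^bsub>Om\<^esub> x) - wedges ((map \<tau> xs)[i := smul (\<sigma> b) (\<tau> x)]) \<in> rel_forms n J m"
      using smult by (intro wedges_update_rel bx \<tau>_smult fns_smul \<tau>_closed sigma_closed)
    then have 1: "?w (b \<odot>\<^bsub>Om\<^esub> x) - smul (\<sigma> b) (?w x) \<in> rel_forms n J m"
      using wedges_update_smul[OF i, of "\<sigma> b" "\<tau> x"] by (simp add: map_update)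
    have 2: "smul (\<sigma> b) (liftm (?e x) - ?w x) \<in> rel_forms n J m"
      using smult liftm_gen[OF t[OF smult(4)]] by (intro rf_smul) simp_all
    from 1 2 liftm_minus[OF g(2) s] liftm_smult[OF smult(3) g(1)] liftm_gen[OF t[OF bx]]
    have "(liftm r - (liftm (?e (b \<odot>\<^bsub>Om\<^esub> x)) - liftm (b \<odot>\<^bsub>?F\<^esub> ?e x)))
      + ((liftm (?e (b \<odot>\<^bsub>Om\<^esub> x)) - ?w (b \<odot>\<^bsub>Om\<^esub> x)) + ((?w (b \<odot>\<^bsub>Om\<^esub> x) - smul (\<sigma> b) (?w x))
      + (- (liftm (b \<odot>\<^bsub>?F\<^esub> ?e x) - smul (\<sigma> b) (liftm (?e x)))
      + - smul (\<sigma> b) (liftm (?e x) - ?w x)))) \<in> rel_forms n J m"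
      unfolding smult(5) by (intro rel_forms.add rf_uminus)
    then show ?thesis by (simp add: smul_diff algebra_simps)
  next
    case (alt xs)
    then have "wedges (map \<tau> xs) = 0"
      by (intro wedges_not_distinct) (simp add: distinct_map)
    then show ?thesis
      using liftm_gen[OF alt(1)] alt(3) by simp
  qed
qed

lemma liftm_ext_submodule: "f \<in> ext_submodule B Om m \<Longrightarrow> liftm f \<in> rel_forms n J m"
  unfolding ext_submodule_def liftm_def
  by (rule lift_kernel[OF absorbing_rel_forms wedges_\<tau> exterior.ext_relations_subset[OF exterior_kaehler]])
     (use liftm_ext_relations in \<open>simp_all add: liftm_def\<close>)

end

subsection \<open>From concrete forms to Kaehler forms\<close>

context presentation
begin

definition comb :: "('b, 'v, 'z) module_scheme \<Rightarrow> 'i set \<Rightarrow> ('i \<Rightarrow> 'v) \<Rightarrow> ('i \<Rightarrow> 'k mpol) \<Rightarrow> 'v" where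
  "comb V S e w = (\<Oplus>\<^bsub>V\<^esub>i\<in>S. \<pi> (w i) \<odot>\<^bsub>V\<^esub> e i)"

context
  fixes V :: "('b, 'v, 'z) module_scheme" and S :: "'i set" and e :: "'i \<Rightarrow> 'v"
  assumes V: "Module.module B V" and S: "finite S" and e: "\<And>i. i \<in> S \<Longrightarrow> e i \<in> carrier V"
begin

lemma comb_closed: "w \<in> fns n S \<Longrightarrow> comb V S e w \<in> carrier V"
proof -
  interpret V: Module.module B V by (rule V)
  assume w: "w \<in> fns n S"
  show ?thesis
    unfolding comb_def by (rule V.M.finsum_closed) (use e fns_apply[OF w] in auto)
qed

lemma comb_add:
  assumes v: "v \<in> fns n S" and w: "w \<in> fns n S"
  shows "comb V S e (v + w) = comb V S e v \<oplus>\<^bsub>V\<^esub> comb V S e w"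
proof -
  interpret V: Module.module B V by (rule V)
  have "comb V S e (v + w) = (\<Oplus>\<^bsub>V\<^esub>i\<in>S. \<pi> (v i) \<odot>\<^bsub>V\<^esub> e i \<oplus>\<^bsub>V\<^esub> \<pi> (w i) \<odot>\<^bsub>V\<^esub> e i)"
    unfolding comb_def using e fns_apply[OF v] fns_apply[OF w]
    by (intro V.M.finsum_cong') (auto simp: fun_ops pi_add V.smult_l_distr)
  also have "\<dots> = comb V S e v \<oplus>\<^bsub>V\<^esub> comb V S e w"
    unfolding comb_def using e fns_apply[OF v] fns_apply[OF w]
    by (intro V.M.finsum_addf) auto
  finally show ?thesis .
qed

lemma comb_smul:
  assumes f: "f \<in> A" and w: "w \<in> fns n S"
  shows "comb V S e (smul f w) = \<pi> f \<odot>\<^bsub>V\<^esub> comb V S e w"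
proof -
  interpret V: Module.module B V by (rule V)
  have "comb V S e (smul f w) = (\<Oplus>\<^bsub>V\<^esub>i\<in>S. \<pi> f \<odot>\<^bsub>V\<^esub> (\<pi> (w i) \<odot>\<^bsub>V\<^esub> e i))"
    unfolding comb_def using e fns_apply[OF w] f
    by (intro V.M.finsum_cong') (auto simp: smul_def pi_mult V.smult_assoc1)
  also have "\<dots> = \<pi> f \<odot>\<^bsub>V\<^esub> comb V S e w"
    unfolding comb_def using e fns_apply[OF w] f
    by (intro V.finsum_smult[symmetric]) auto
  finally show ?thesis .
qed

lemma comb_zero: "comb V S e 0 = \<zero>\<^bsub>V\<^esub>"
proof -
  interpret V: Module.module B V by (rule V)
  show ?thesis
    using comb_smul[of 0 0] comb_closed[of 0] by simp
qed

lemma comb_bump: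
  assumes i: "i \<in> S" and f: "f \<in> A"
  shows "comb V S e (bump i f) = \<pi> f \<odot>\<^bsub>V\<^esub> e i"
proof -
  interpret V: Module.module B V by (rule V)
  have "comb V S e (bump i f) = (\<Oplus>\<^bsub>V\<^esub>j\<in>S. if i = j then \<pi> f \<odot>\<^bsub>V\<^esub> e j else \<zero>\<^bsub>V\<^esub>)"
    unfolding comb_def using e f by (intro V.M.finsum_cong') (auto simp: bump_def)
  also have "\<dots> = \<pi> f \<odot>\<^bsub>V\<^esub> e i"
    using i f e S by (intro V.M.finsum_singleton) auto
  finally show ?thesis .
qed

end

abbreviation "Omega m \<equiv> kaehler_forms (class_ring :: 'k ring) B \<phi> m"

lemma Omega_eq: "Omega m = ext_power B Om m"
  by (simp add: kaehler_forms_def)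

lemma module_Omega: "Module.module B (Omega m)"
  unfolding Omega_eq by (rule exterior.module_ext_power[OF exterior_kaehler])

definition dX :: "nat \<Rightarrow> ('b \<Rightarrow> 'b) set" where
  "dX i = d (\<pi> (poly_var i))"

definition dXs :: "nat set \<Rightarrow> (('b \<Rightarrow> 'b) set list \<Rightarrow> 'b) set" where
  "dXs I = wedge_list B Om (map dX (sorted_list_of_set I))"

definition eval1 :: "(nat \<Rightarrow> 'k mpol) \<Rightarrow> ('b \<Rightarrow> 'b) set" where
  "eval1 = comb Om {1..n} dX"

definition evalm :: "nat \<Rightarrow> (nat set \<Rightarrow> 'k mpol) \<Rightarrow> (('b \<Rightarrow> 'b) set list \<Rightarrow> 'b) set" where
  "evalm m = comb (Omega m) (ksubsets n m) dXs"

lemma dX_closed: "i \<in> {1..n} \<Longrightarrow> dX i \<in> carrier Om"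
  unfolding dX_def by (intro d_closed pi_closed poly_ring_var)

lemma dX_tuples: "set js \<subseteq> {1..n} \<Longrightarrow> length js = m \<Longrightarrow> map dX js \<in> tuples Om m"
  using dX_closed by (auto simp: tuples_def)

lemma ksubsets_tuples: "I \<in> ksubsets n m \<Longrightarrow> map dX (sorted_list_of_set I) \<in> tuples Om m"
  using ksubsets_finite[of I n m] by (intro dX_tuples) (auto simp: ksubsets_def)

lemma dXs_closed: "I \<in> ksubsets n m \<Longrightarrow> dXs I \<in> carrier (Omega m)"
  unfolding Omega_eq dXs_def
  by (intro exterior.wedge_list_closed[OF exterior_kaehler] ksubsets_tuples)

lemma eval1_closed: "w \<in> covecs n \<Longrightarrow> eval1 w \<in> carrier Om"
  unfolding eval1_def by (rule comb_closed[OF module_kaehler finite_atLeastAtMost dX_closed])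

lemma eval1_add: "v \<in> covecs n \<Longrightarrow> w \<in> covecs n \<Longrightarrow> eval1 (v + w) = eval1 v \<oplus>\<^bsub>Om\<^esub> eval1 w"
  unfolding eval1_def by (rule comb_add[OF module_kaehler finite_atLeastAtMost dX_closed])

lemma eval1_smul: "f \<in> A \<Longrightarrow> w \<in> covecs n \<Longrightarrow> eval1 (smul f w) = \<pi> f \<odot>\<^bsub>Om\<^esub> eval1 w"
  unfolding eval1_def by (rule comb_smul[OF module_kaehler finite_atLeastAtMost dX_closed])

lemma eval1_zero: "eval1 0 = \<zero>\<^bsub>Om\<^esub>"
  unfolding eval1_def by (rule comb_zero[OF module_kaehler finite_atLeastAtMost dX_closed])

lemma eval1_bump: "i \<in> {1..n} \<Longrightarrow> f \<in> A \<Longrightarrow> eval1 (bump i f) = \<pi> f \<odot>\<^bsub>Om\<^esub> dX i"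
  unfolding eval1_def by (rule comb_bump[OF module_kaehler finite_atLeastAtMost dX_closed])

lemma evalm_closed: "w \<in> forms n m \<Longrightarrow> evalm m w \<in> carrier (Omega m)"
  unfolding evalm_def by (rule comb_closed[OF module_Omega finite_ksubsets dXs_closed])

lemma evalm_add: "v \<in> forms n m \<Longrightarrow> w \<in> forms n m \<Longrightarrow> evalm m (v + w) = evalm m v \<oplus>\<^bsub>Omega m\<^esub> evalm m w"
  unfolding evalm_def by (rule comb_add[OF module_Omega finite_ksubsets dXs_closed])

lemma evalm_smul: "f \<in> A \<Longrightarrow> w \<in> forms n m \<Longrightarrow> evalm m (smul f w) = \<pi> f \<odot>\<^bsub>Omega m\<^esub> evalm m w"
  unfolding evalm_def by (rule comb_smul[OF module_Omega finite_ksubsets dXs_closed])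

lemma evalm_zero: "evalm m 0 = \<zero>\<^bsub>Omega m\<^esub>"
  unfolding evalm_def by (rule comb_zero[OF module_Omega finite_ksubsets dXs_closed])

lemma evalm_bump: "I \<in> ksubsets n m \<Longrightarrow> f \<in> A \<Longrightarrow> evalm m (bump I f) = \<pi> f \<odot>\<^bsub>Omega m\<^esub> dXs I"
  unfolding evalm_def by (rule comb_bump[OF module_Omega finite_ksubsets dXs_closed])

text \<open>Both sides are derivations over the ground field from the polynomial ring to the
  one-forms of B, and they agree on the variables.\<close>

lemma d_pi:
  assumes "f \<in> A"
  shows "d (\<pi> f) = eval1 (grad n f)"
  using assms
proof (induction rule: poly_ring_induct)
  case (const c)
  show ?case
    using d_const[of c] unfolding phi_eq[of c] by (simp add: eval1_zero)
next
  case (var i)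
  interpret O: Module.module B Om by (rule module_kaehler)
  show ?case
    using var by (simp add: grad_var eval1_bump dX_closed) (simp add: dX_def)
next
  case (add f g)
  then show ?case
    by (simp add: pi_add d_add grad_add eval1_add grad_covecs)
next
  case (mult f g)
  interpret O: Module.module B Om by (rule module_kaehler)
  show ?case
    using mult by (simp add: pi_mult d_mult grad_mult eval1_add eval1_smul grad_covecs fns_smul)
qed

text \<open>Insertion sort: dX_i moves past each smaller index with one change of sign, and
  \<open>sg\<close> counts exactly these indices.\<close>

lemma wedge_list_dX:
  assumes "sorted_wrt (<) js" "set js \<subseteq> {1..n}" "i \<in> {1..n}" "i \<notin> set js" "length js = m"
  shows "wedge_list B Om (dX i # map dX js)
    = \<pi> (sg i (insert i (set js))) \<odot>\<^bsub>Omega (Suc m)\<^esub> wedge_list B Om (map dX (insort i js))"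
  using assms
proof (induction js arbitrary: m)
  case Nil
  interpret E: exterior B Om by (rule exterior_kaehler)
  interpret O: Module.module B "Omega (Suc m)" by (rule module_Omega)
  have "wedge_list B Om [dX i] \<in> carrier (Omega (Suc m))"
    using Nil dX_closed unfolding Omega_eq by (intro E.wedge_list_closed) (auto simp: tuples_def)
  moreover have "sg i {i} = (1 :: 'k mpol)"
    by (simp add: sg_def cong: conj_cong)
  ultimately show ?case by simp
next
  case (Cons j js)
  interpret E: exterior B Om by (rule exterior_kaehler)
  interpret O: Module.module B "Omega (Suc m)" by (rule module_Omega)
  interpret O': Module.module B "Omega m" by (rule module_Omega)
  obtain l where m: "m = Suc l" and l: "length js = l"
    using Cons.prems by auto
  have ij: "i \<noteq> j" "j \<in> {1..n}" "\<And>x. x \<in> set js \<Longrightarrow> j < x" "set js \<subseteq> {1..n}" "sorted_wrt (<) js"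
    using Cons.prems by auto
  show ?case
  proof (cases "i < j")
    case True
    have "sorted (j # js)" by (rule strict_sorted_imp_sorted[OF Cons.prems(1)])
    then have ins: "insort i (j # js) = i # j # js" using True by simp
    have "{x \<in> insert i (set (j # js)). x < i} = {}"
      using True ij(3) by fastforce
    then have "sg i (insert i (set (j # js))) = (1 :: 'k mpol)"
      unfolding sg_def by (simp only: card.empty power_0)
    moreover have "wedge_list B Om (dX i # map dX (j # js)) \<in> carrier (Omega (Suc m))"
      using dX_tuples[of "i # j # js" "Suc m"] Cons.prems unfolding Omega_eq
      by (intro E.wedge_list_closed) simp
    ultimately show ?thesis unfolding ins by simp
  next
    case False
    then have ji: "j < i" using ij by simp
    have ins: "insort i (j # js) = j # insort i js" using ji by simp
    have js: "map dX js \<in> tuples Om l" using l ij by (intro dX_tuples) auto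
    have ijs: "map dX (insort i js) \<in> tuples Om m"
      using l m ij Cons.prems by (intro dX_tuples) (auto simp: set_insort_key)
    have cl: "wedge_list B Om (map dX (insort i js)) \<in> carrier (Omega m)"
      "wedge_list B Om (dX j # map dX (insort i js)) \<in> carrier (Omega (Suc m))"
      unfolding Omega_eq using ijs dX_closed ij by (auto intro!: E.wedge_list_closed)
    have "{x \<in> insert i (set (j # js)). x < i} = insert j {x \<in> insert i (set js). x < i}"
      using ji by auto
    moreover have "j \<notin> {x \<in> insert i (set js). x < i}" using ij by auto
    ultimately have sgn: "sg i (insert i (set (j # js))) = - (sg i (insert i (set js)) :: 'k mpol)"
      unfolding sg_def by simp
    have sgA: "(sg i I :: 'k mpol) \<in> A" for I
      by (cases "even (card {x\<in>I. x < i})") (auto simp: sg_def poly_ring_uminus)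
    have IH: "wedge_list B Om (dX i # map dX js)
        = \<pi> (sg i (insert i (set js))) \<odot>\<^bsub>Omega m\<^esub> wedge_list B Om (map dX (insort i js))"
      using Cons.IH[of l] Cons.prems l m by simp
    have "wedge_list B Om (dX i # map dX (j # js))
        = \<ominus>\<^bsub>Omega (Suc m)\<^esub> wedge_list B Om (dX j # dX i # map dX js)"
      unfolding Omega_eq m list.map
      by (rule E.wedge_list_swap[OF dX_closed[OF Cons.prems(3)] dX_closed[OF ij(2)] js])
    also have "wedge_list B Om (dX j # dX i # map dX js)
        = wedge_left B Om m (dX j) (wedge_list B Om (dX i # map dX js))"
      using js ij dX_closed Cons.prems m by (intro E.wedge_left_wedge_list[symmetric]) auto
    also have "\<dots> = \<pi> (sg i (insert i (set js))) \<odot>\<^bsub>Omega (Suc m)\<^esub> wedge_list B Om (dX j # map dX (insort i js))"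
      unfolding IH using cl ijs sgA ij dX_closed
      by (simp add: Omega_eq E.wedge_left_smult E.wedge_left_wedge_list)
    finally show ?thesis
      unfolding ins sgn using cl sgA by (simp add: pi_uminus O.smult_l_minus)
  qed
qed

lemma wedge_left_dXs:
  assumes I: "I \<in> ksubsets n m" and i: "i \<in> {1..n}"
  shows "wedge_left B Om m (dX i) (dXs I)
    = (if i \<in> I then \<zero>\<^bsub>Omega (Suc m)\<^esub>
       else \<pi> (sg i (insert i I)) \<odot>\<^bsub>Omega (Suc m)\<^esub> dXs (insert i I))"
proof -
  interpret E: exterior B Om by (rule exterior_kaehler)
  have fin: "finite I" using I by (rule ksubsets_finite)
  have *: "wedge_left B Om m (dX i) (dXs I) = wedge_list B Om (dX i # map dX (sorted_list_of_set I))"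
    unfolding dXs_def using ksubsets_tuples[OF I] dX_closed[OF i] by (intro E.wedge_left_wedge_list)
  show ?thesis
  proof (cases "i \<in> I")
    case True
    then show ?thesis
      unfolding * Omega_eq using ksubsets_tuples[OF I] dX_closed[OF i] fin
      by (auto intro!: E.wedge_list_not_distinct)
  next
    case False
    have "sorted_wrt (<) (sorted_list_of_set I)" by simp
    then show ?thesis
      unfolding * unfolding dXs_def using False fin I i
        wedge_list_dX[of "sorted_list_of_set I" i m]
      by (simp add: sorted_list_of_set_insert ksubsets_def)
  qed
qed

text \<open>Both sides are bilinear in \<open>u\<close> and \<open>w\<close>, so basis elements
  suffice. There \<open>wedge_bump\<close> and \<open>wedge_left_dXs\<close> produce the same
  sign.\<close>

lemma evalm_wedge:
  assumes u: "u \<in> covecs n" and w: "w \<in> forms n m"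
  shows "evalm (Suc m) (wedge u w) = wedge_left B Om m (eval1 u) (evalm m w)"
proof -
  interpret E: exterior B Om by (rule exterior_kaehler)
  interpret O: Module.module B "Omega (Suc m)" by (rule module_Omega)
  interpret O': Module.module B "Omega m" by (rule module_Omega)
  interpret M: Module.module B Om by (rule module_kaehler)
  have sgA: "(sg i I :: 'k mpol) \<in> A" for i I
    by (cases "even (card {x\<in>I. x < i})") (auto simp: sg_def poly_ring_uminus)
  have base: "evalm (Suc m) (wedge (bump i g) (bump I f)) = wedge_left B Om m (eval1 (bump i g)) (evalm m (bump I f))"
    if i: "i \<in> {1..n}" and g: "g \<in> A" and I: "I \<in> ksubsets n m" and f: "f \<in> A" for i g I f
  proof -
    have fin: "finite I" using I by (rule ksubsets_finite)
    have "wedge_left B Om m (eval1 (bump i g)) (evalm m (bump I f))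
        = \<pi> g \<odot>\<^bsub>Omega (Suc m)\<^esub> (\<pi> f \<odot>\<^bsub>Omega (Suc m)\<^esub> wedge_left B Om m (dX i) (dXs I))"
      using i g I f dXs_closed[OF I] dX_closed[OF i]
        E.wedge_left_smult_left[of "\<pi> g" "dX i" "\<pi> f \<odot>\<^bsub>Omega m\<^esub> dXs I" m]
        E.wedge_left_smult[of "dX i" "\<pi> f" "dXs I" m]
      by (simp add: eval1_bump evalm_bump Omega_eq[symmetric])
    also have "\<dots> = evalm (Suc m) (wedge (bump i g) (bump I f))"
    proof (cases "i \<in> I")
      case True
      then show ?thesis
        using f g by (simp add: wedge_left_dXs[OF I i] wedge_bump fin evalm_zero)
    next
      case False
      have iI: "insert i I \<in> ksubsets n (Suc m)"
        using I i False fin by (auto simp: ksubsets_def)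
      have "\<pi> (sg i (insert i I) * g * f) = \<pi> g \<otimes> (\<pi> f \<otimes> \<pi> (sg i (insert i I)))"
        using f g sgA by (simp add: pi_mult poly_ring_mult B.m_ac)
      then show ?thesis
        using False f g sgA dXs_closed[OF iI]
        by (simp add: wedge_left_dXs[OF I i] wedge_bump fin evalm_bump[OF iI] poly_ring_mult O.smult_assoc1)
    qed
    finally show ?thesis ..
  qed
  have step: "evalm (Suc m) (wedge u (bump I f)) = wedge_left B Om m (eval1 u) (evalm m (bump I f))"
    if I: "I \<in> ksubsets n m" and f: "f \<in> A" for I f
    using u finite_atLeastAtMost
  proof (induction rule: fns_induct)
    case zero
    show ?case
      using evalm_closed[OF fns_bump[OF f I]] by (simp add: evalm_zero eval1_zero E.wedge_left_zero_left Omega_eq)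
  next
    case (add v w)
    have "evalm m (bump I f) \<in> carrier (Omega m)"
      by (rule evalm_closed[OF fns_bump[OF f I]])
    then show ?case
      using add I f E.wedge_left_add_left[of "eval1 v" "eval1 w" "evalm m (bump I f)" m]
      by (simp add: wedge_add_left evalm_add wedge_forms fns_bump eval1_add eval1_closed Omega_eq[symmetric])
  qed (rule base[OF _ _ I f])
  show ?thesis
    using w finite_ksubsets
  proof (induction rule: fns_induct)
    case zero
    show ?case
      using eval1_closed[OF u] by (simp add: evalm_zero Omega_eq E.wedge_left_zero)
  next
    case (add v w)
    then show ?case
      using u E.wedge_left_add[of "eval1 u" "evalm m v" m "evalm m w"] evalm_closed[of v m] evalm_closed[of w m]
      by (simp add: wedge_add evalm_add wedge_forms eval1_closed Omega_eq[symmetric])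
  qed (rule step)
qed

text \<open>A generator b dc has the preimage
  \<open>smul (\<sigma> b) (grad n (\<sigma> c))\<close>.\<close>

lemma eval1_surj:
  assumes "x \<in> carrier Om"
  shows "\<exists>u\<in>covecs n. eval1 u = x"
  using assms
proof (induction rule: kaehler_induct)
  case zero
  show ?case using eval1_zero fns_zero by blast
next
  case (d b c)
  have "eval1 (smul (\<sigma> b) (grad n (\<sigma> c))) = b \<odot>\<^bsub>Om\<^esub> d c"
    using d d_pi[of "\<sigma> c"] by (simp add: eval1_smul grad_covecs)
  moreover have "smul (\<sigma> b) (grad n (\<sigma> c)) \<in> covecs n"
    using d by (intro fns_smul grad_covecs) simp_all
  ultimately show ?case by blast
next
  case (add x y)
  then obtain u v where "u \<in> covecs n" "v \<in> covecs n" "eval1 u = x" "eval1 v = y" by blast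
  then show ?case
    using eval1_add[of u v] fns_add[of u n "{1..n}" v] by metis
qed

lemma evalm_wedges:
  assumes "xs \<in> tuples Om m"
  shows "\<exists>w\<in>forms n m. evalm m w = wedge_list B Om xs"
  using assms
proof (induction xs arbitrary: m)
  case Nil
  then have m: "m = 0" by (simp add: tuples_def)
  interpret O: Module.module B "Omega 0" by (rule module_Omega)
  have 0: "{} \<in> ksubsets n 0" by (simp add: ksubsets_def)
  have "evalm 0 (bump {} 1) = wedge_list B Om []"
    using evalm_bump[OF 0, of 1] dXs_closed[OF 0] by (simp add: dXs_def)
  then show ?case
    using fns_bump[OF poly_ring_one 0] m by blast
next
  case (Cons x xs)
  interpret E: exterior B Om by (rule exterior_kaehler)
  obtain l where m: "m = Suc l" and x: "x \<in> carrier Om" and xs: "xs \<in> tuples Om l"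
    using Cons.prems by (cases m) (auto simp: tuples_def)
  obtain w where w: "w \<in> forms n l" "evalm l w = wedge_list B Om xs"
    using Cons.IH[OF xs] by blast
  obtain u where u: "u \<in> covecs n" "eval1 u = x" using eval1_surj[OF x] by blast
  have "evalm m (wedge u w) = wedge_list B Om (x # xs)"
    unfolding m evalm_wedge[OF u(1) w(1)] u(2) w(2) by (rule E.wedge_left_wedge_list[OF x xs])
  then show ?case
    using wedge_forms[OF u(1) w(1)] m by blast
qed

lemma evalm_surj:
  assumes "x \<in> carrier (Omega m)"
  shows "\<exists>w\<in>forms n m. evalm m w = x"
proof -
  interpret E: exterior B Om by (rule exterior_kaehler)
  show ?thesis
    using assms unfolding Omega_eq
  proof (induction rule: E.ext_power_induct)
    case zero
    show ?case using evalm_zero[of m] fns_zero unfolding Omega_eq by blast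
  next
    case (wedge b xs)
    obtain w where w: "w \<in> forms n m" "evalm m w = wedge_list B Om xs"
      using evalm_wedges[OF wedge(2)] by blast
    then have "evalm m (smul (\<sigma> b) w) = b \<odot>\<^bsub>ext_power B Om m\<^esub> wedge_list B Om xs"
      using wedge(1) by (simp add: evalm_smul Omega_eq)
    then show ?case
      using fns_smul[OF sigma_closed[OF wedge(1)] w(1)] by blast
  next
    case (add x y)
    then obtain v w where "v \<in> forms n m" "w \<in> forms n m" "evalm m v = x" "evalm m w = y" by blast
    then show ?case
      using evalm_add[of v m w] fns_add[of v n "ksubsets n m" w] unfolding Omega_eq by metis
  qed
qed

lemma evalm_rel_forms:
  assumes "w \<in> rel_forms n J m"
  shows "evalm m w = \<zero>\<^bsub>Omega m\<^esub>"
  using assms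
proof induction
  case zero
  show ?case by (rule evalm_zero)
next
  case (smul f w)
  interpret O: Module.module B "Omega m" by (rule module_Omega)
  have f: "f \<in> A" "\<pi> f = \<zero>" using smul(1) by (auto simp: J_def)
  show ?case
    unfolding evalm_smul[OF f(1) smul(2)] f(2) by (rule O.smult_l_null[OF evalm_closed[OF smul(2)]])
next
  case (grad f w l)
  interpret E: exterior B Om by (rule exterior_kaehler)
  have f: "f \<in> A" "\<pi> f = \<zero>" using grad by (auto simp: J_def)
  have "\<phi> 0 = \<zero>"
    unfolding phi_eq by (simp add: poly_const_def)
  then have "d \<zero> = \<zero>\<^bsub>Om\<^esub>"
    using d_const[of 0] by simp
  then have "eval1 (grad n f) = \<zero>\<^bsub>Om\<^esub>"
    using d_pi[OF f(1)] f(2) by simp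
  then show ?case
    using grad(2,3) evalm_wedge[OF grad_covecs[OF f(1)] grad(2)] evalm_closed[OF grad(2)]
    by (simp add: E.wedge_left_zero_left Omega_eq)
next
  case (add v w)
  interpret O: Module.module B "Omega m" by (rule module_Omega)
  show ?case
    using add rel_forms_subset[OF J_subset] by (simp add: evalm_add)
qed

text \<open>\<open>liftm\<close> inverts \<open>evalm\<close> up to relations; the representative is
  part of the claim because \<open>liftm\<close> is defined on the free module. For a basis form the
  claim reduces to the fact that \<open>\<tau> (dX i)\<close> is the i-th unit covector up to
  relations.\<close>

lemma evalm_representative:
  assumes "w \<in> forms n m"
  shows "\<exists>f \<in> carrier (free_module B (tuples Om m)).
    evalm m w = ext_submodule B Om m +>\<^bsub>free_module B (tuples Om m)\<^esub> f \<and> liftm f - w \<in> rel_forms n J m"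
  using assms finite_ksubsets
proof (induction rule: fns_induct)
  let ?F = "free_module B (tuples Om m)" and ?N = "ext_submodule B Om m"
  interpret E: exterior B Om by (rule exterior_kaehler)
  interpret F: Module.module B ?F by (rule E.module_tens)
  {
    case zero
    have "liftm \<zero>\<^bsub>?F\<^esub> = 0"
      by (simp add: liftm_def lift_def free_module_simps(2))
    then show ?case
      using E.ext_coset_zero[of m] evalm_zero[of m] rel_forms.zero
      by (intro bexI[of _ "\<zero>\<^bsub>?F\<^esub>"]) (simp_all add: Omega_eq E.ext_power_eq)
  next
    case bump_case: (bump I f)
    let ?js = "sorted_list_of_set I"
    let ?e = "free_gen B (map dX ?js)"
    note t = ksubsets_tuples[OF bump_case(1)]
    note e = E.gen_closed[OF t]
    have fin: "finite I" using bump_case(1) by (rule ksubsets_finite)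
    have "list_all2 (\<lambda>u v. u \<in> covecs n \<and> v \<in> covecs n \<and> u - v \<in> rel_covecs n J)
        (map \<tau> (map dX ?js)) (map (\<lambda>i. bump i 1) ?js)"
    proof -
      have "\<tau> (dX i) \<in> covecs n \<and> bump i 1 \<in> (covecs n :: (nat \<Rightarrow> 'k mpol) set)
          \<and> \<tau> (dX i) - bump i 1 \<in> rel_covecs n J" if "i \<in> I" for i
      proof -
        have i: "i \<in> {1..n}" using that bump_case(1) by (auto simp: ksubsets_def)
        then show ?thesis
          using \<tau>_d[OF poly_ring_var[OF i]] \<tau>_closed[OF dX_closed[OF i]]
          by (auto simp: dX_def grad_var intro: fns_bump)
      qed
      then show ?thesis
        using fin by (auto simp: list_all2_conv_all_nth) (metis nth_mem set_sorted_list_of_set length_sorted_list_of_set)+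
    qed
    from wedges_cong_rel[OF J_subset this]
    have 3: "wedges (map \<tau> (map dX ?js)) - bump I 1 \<in> rel_forms n J m"
      using fin bump_case(1) by (simp add: wedges_bump ksubsets_def)
    have 4: "smul (\<sigma> (\<pi> f)) (liftm ?e - bump I 1) \<in> rel_forms n J m"
      using bump_case(2) by (intro rf_smul rf_trans[OF liftm_gen[OF t] 3]) simp
    have 5: "smul (\<sigma> (\<pi> f) - f) (bump I 1) \<in> rel_forms n J m"
      using bump_case by (intro rel_forms.smul diff_J fns_bump) simp_all
    have "(liftm (\<pi> f \<odot>\<^bsub>?F\<^esub> ?e) - smul (\<sigma> (\<pi> f)) (liftm ?e))
        + (smul (\<sigma> (\<pi> f)) (liftm ?e - bump I 1) + smul (\<sigma> (\<pi> f) - f) (bump I 1)) \<in> rel_forms n J m"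
      using 4 5 bump_case(2) by (intro rel_forms.add liftm_smult e) simp_all
    then have "liftm (\<pi> f \<odot>\<^bsub>?F\<^esub> ?e) - bump I f \<in> rel_forms n J m"
      by (simp add: smul_diff bump_diff algebra_simps)
    moreover have "evalm m (bump I f) = ?N +>\<^bsub>?F\<^esub> (\<pi> f \<odot>\<^bsub>?F\<^esub> ?e)"
      using bump_case e by (simp add: evalm_bump dXs_def E.wedge_list_eq[OF t] Omega_eq E.ext_power_eq E.ext_coset_smult)
    ultimately show ?case
      using e bump_case(2) by (intro bexI[of _ "\<pi> f \<odot>\<^bsub>?F\<^esub> ?e"]) simp_all
  next
    case (add v w)
    then obtain f g where f: "f \<in> carrier ?F" "evalm m v = ?N +>\<^bsub>?F\<^esub> f" "liftm f - v \<in> rel_forms n J m"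
      and g: "g \<in> carrier ?F" "evalm m w = ?N +>\<^bsub>?F\<^esub> g" "liftm g - w \<in> rel_forms n J m"
      by blast
    have "(liftm (f \<oplus>\<^bsub>?F\<^esub> g) - (liftm f + liftm g)) + ((liftm f - v) + (liftm g - w)) \<in> rel_forms n J m"
      by (intro rel_forms.add liftm_add f g)
    then have "liftm (f \<oplus>\<^bsub>?F\<^esub> g) - (v + w) \<in> rel_forms n J m"
      by (simp add: algebra_simps)
    moreover have "evalm m (v + w) = ?N +>\<^bsub>?F\<^esub> (f \<oplus>\<^bsub>?F\<^esub> g)"
      using add f g by (simp add: evalm_add Omega_eq E.ext_power_eq E.ext_coset_add)
    ultimately show ?case
      using f g by (intro bexI[of _ "f \<oplus>\<^bsub>?F\<^esub> g"]) simp_all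
  }
qed

text \<open>If the class of \<open>w\<close> vanishes, its representative in the free module is a
  combination of exterior relations, so \<open>liftm\<close> sends it to a relation; but
  \<open>liftm\<close> recovers \<open>w\<close> up to relations. Together with
  \<open>evalm_surj\<close> this identifies the m-forms of B with coordinate forms modulo
  \<open>rel_forms\<close>.\<close>

theorem evalm_eq_zero_iff:
  assumes w: "w \<in> forms n m"
  shows "evalm m w = \<zero>\<^bsub>Omega m\<^esub> \<longleftrightarrow> w \<in> rel_forms n J m"
proof
  interpret E: exterior B Om by (rule exterior_kaehler)
  assume 0: "evalm m w = \<zero>\<^bsub>Omega m\<^esub>"
  obtain f where f: "f \<in> carrier (free_module B (tuples Om m))"
    "evalm m w = ext_submodule B Om m +>\<^bsub>free_module B (tuples Om m)\<^esub> f" "liftm f - w \<in> rel_forms n J m"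
    using evalm_representative[OF w] by blast
  have "f \<in> ext_submodule B Om m"
    using f 0 E.ext_coset_eq_zero_iff[OF f(1)] by (simp add: Omega_eq E.ext_power_eq)
  from rel_forms_diff[OF J_subset liftm_ext_submodule[OF this] f(3)]
  show "w \<in> rel_forms n J m" by simp
qed (rule evalm_rel_forms)

end

subsection \<open>Exactness of the de Rham complex in low degrees\<close>

text \<open>For polynomials in the n variables this is membership in q^d, as
  \<open>irrelevant_power_eq\<close> shows.\<close>

definition low :: "nat \<Rightarrow> 'k::zero mpol \<Rightarrow> bool" where
  "low d p \<longleftrightarrow> (\<forall>a. mdeg a < d \<longrightarrow> Poly_Mapping.lookup p a = 0)"

lemma low_zero [simp]: "low d 0"
  by (simp add: low_def)

lemma low_add: "low d p \<Longrightarrow> low d q \<Longrightarrow> low d (p + q)" for p :: "'k::monoid_add mpol"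
  by (simp add: low_def lookup_add)

lemma low_uminus: "low d p \<Longrightarrow> low d (- p)" for p :: "'k::ab_group_add mpol"
  by (simp add: low_def)

lemma low_sum: "(\<And>x. x \<in> X \<Longrightarrow> low d (f x)) \<Longrightarrow> low d (sum f X)"
  for f :: "'x \<Rightarrow> 'k::comm_monoid_add mpol"
  by (simp add: low_def lookup_sum)

lemma low_mult_add:
  fixes p q :: "'k::comm_semiring_1 mpol"
  assumes "low d p" and "low d' q"
  shows "low (d + d') (p * q)"
proof -
  have "mdeg a \<ge> d + d'" if a: "a \<in> Poly_Mapping.keys (p * q)" for a
  proof -
    obtain b c where "a = b + c" "b \<in> Poly_Mapping.keys p" "c \<in> Poly_Mapping.keys q"
      using keys_mult[of p q] a by blast
    moreover from this have "mdeg b \<ge> d" "mdeg c \<ge> d'"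
      using assms by (auto simp: low_def in_keys_iff not_less[symmetric])
    ultimately show ?thesis by (simp add: mdeg_add)
  qed
  then show ?thesis
    by (auto simp: low_def in_keys_iff not_less[symmetric])
qed

lemma low_mult: "low d p \<Longrightarrow> low d (p * q)" for p q :: "'k::comm_semiring_1 mpol"
  using low_mult_add[of d p 0 q] by (simp add: low_def)

lemma low_mult_right: "low d q \<Longrightarrow> low d (p * q)" for p q :: "'k::comm_semiring_1 mpol"
  using low_mult[of d q p] by (simp add: mult.commute)

lemma low_pd: "low (Suc d) p \<Longrightarrow> low d (pd i p)"
  by (simp add: low_def lookup_pd mdeg_add)

lemma low_mono: "low d p \<Longrightarrow> d' \<le> d \<Longrightarrow> low d' p"
  by (simp add: low_def)

lemma lookup_sg_mult: "Poly_Mapping.lookup (sg i I * p) a = sg i I * Poly_Mapping.lookup p a"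
  for p :: "'k::comm_ring_1 mpol"
  by (cases "even (card {j\<in>I. j < i})") (simp_all add: sg_def)

lemma lookup_ext_deriv:
  "Poly_Mapping.lookup (ext_deriv w I) a
    = (\<Sum>i\<in>I. sg i I * (of_nat (Poly_Mapping.lookup a i + 1)
        * Poly_Mapping.lookup (w (I - {i})) (a + unit_exp i)))"
  by (simp add: ext_deriv_def lookup_sum lookup_sg_mult lookup_pd)

lemma pd_sg_mult: "pd i (sg j K * p) = sg j K * pd i p" for p :: "'k::comm_ring_1 mpol"
  by (cases "even (card {l\<in>K. l < j})") (simp_all add: sg_def pd_uminus)

lemma ext_deriv_add: "ext_deriv (v + w) = ext_deriv v + ext_deriv w"
  by (auto simp: ext_deriv_def fun_eq_iff fun_ops pd_add algebra_simps sum.distrib)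

lemma ext_deriv_zero [simp]: "ext_deriv 0 = 0"
  by (auto simp: ext_deriv_def fun_eq_iff fun_ops)

lemma pd_outside:
  assumes "f \<in> carrier (poly_ring n)" "i \<notin> {1..n}"
  shows "pd i f = 0"
proof (rule poly_mapping_eqI)
  fix a
  have "a + unit_exp i \<notin> Poly_Mapping.keys f"
    using assms by (auto simp: carrier_poly_ring keys_add_nat)
  then show "Poly_Mapping.lookup (pd i f) a = Poly_Mapping.lookup 0 a"
    by (simp add: lookup_pd in_keys_iff)
qed

lemma grad_eq_pd: "f \<in> carrier (poly_ring n) \<Longrightarrow> grad n f = (\<lambda>i. pd i f)"
  using pd_outside[of f n] by (auto simp: grad_def fun_eq_iff)

lemma ext_deriv_bump:
  "f \<in> carrier (poly_ring n) \<Longrightarrow> ext_deriv (bump I f) = wedge (grad n f) (bump I 1)"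
  by (auto simp: ext_deriv_def wedge_def grad_eq_pd bump_def fun_eq_iff intro!: sum.cong)

lemma ext_deriv_eq_sum:
  assumes "w \<in> forms n m"
  shows "ext_deriv w = (\<Sum>I\<in>ksubsets n m. wedge (grad n (w I)) (bump I 1))"
proof -
  have "ext_deriv (\<Sum>I\<in>S. bump I (w I)) = (\<Sum>I\<in>S. ext_deriv (bump I (w I)))" for S
    by (induction S rule: infinite_finite_induct) (simp_all add: ext_deriv_add)
  then have "ext_deriv w = (\<Sum>I\<in>ksubsets n m. ext_deriv (bump I (w I)))"
    by (rule trans[OF arg_cong[OF fns_eq_sum[OF assms finite_ksubsets]]])
  also have "\<dots> = (\<Sum>I\<in>ksubsets n m. wedge (grad n (w I)) (bump I 1))"
    by (rule sum.cong[OF refl ext_deriv_bump[OF fns_apply[OF assms]]])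
  finally show ?thesis .
qed

lemma ext_deriv_forms:
  assumes "w \<in> forms n m"
  shows "ext_deriv w \<in> forms n (Suc m)"
  unfolding ext_deriv_eq_sum[OF assms]
  by (intro fns_sum wedge_forms grad_covecs fns_bump fns_apply[OF assms]) auto

text \<open>The second bound is better by one than differentiating the first would give. As d(df) =
  0, the derivative of df \<and> w is - df \<and> dw, in which \<open>f\<close> is differentiated
  only once.\<close>

lemma low_wedge_grad:
  assumes f: "f \<in> carrier (poly_ring n)" and "low (Suc e) f"
  shows "low e (wedge (grad n f) w I)"
    and "low e (ext_deriv (wedge (grad n f) w) I)"
proof -
  have lf: "low e (pd i f)" for i using assms by (intro low_pd)
  show "low e (wedge (grad n f) w I)"
    unfolding wedge_def grad_eq_pd[OF f] by (intro low_sum low_mult low_mult_right lf)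
  have "pd i (wedge (grad n f) w K)
      = (\<Sum>j\<in>K. sg j K * (pd i (pd j f) * w (K - {j}) + pd j f * pd i (w (K - {j}))))" for i K
    by (simp only: wedge_def grad_eq_pd[OF f] pd_sum mult.assoc pd_sg_mult) (simp only: pd_mult)
  then have "ext_deriv (wedge (grad n f) w) I
      = (\<Sum>i\<in>I. \<Sum>j\<in>I - {i}. sg i I * sg j (I - {i}) * (pd i (pd j f) * w (I - {i} - {j})))
        + (\<Sum>i\<in>I. \<Sum>j\<in>I - {i}. sg i I * sg j (I - {i}) * (pd j f * pd i (w (I - {i} - {j}))))"
    by (simp add: ext_deriv_def sum_distrib_left sum.distrib algebra_simps)
  \<comment> \<open>This is the contribution of d(df), which vanishes because second derivatives
    commute.\<close>
  also have "(\<Sum>i\<in>I. \<Sum>j\<in>I - {i}. sg i I * sg j (I - {i}) * (pd i (pd j f) * w (I - {i} - {j}))) = 0"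
  proof (rule alternating_sum_eq_0)
    fix i j
    have "I - {i} - {j} = I - {j} - {i}" by auto
    then show "pd i (pd j f) * w (I - {i} - {j}) = pd j (pd i f) * w (I - {j} - {i})"
      by (simp add: pd_commute)
  qed
  finally show "low e (ext_deriv (wedge (grad n f) w) I)"
    by (simp add: low_sum low_mult low_mult_right lf)
qed

section \<open>The homotopy on monomial forms\<close>

definition mons :: "nat set \<Rightarrow> nat \<Rightarrow> (nat \<Rightarrow>\<^sub>0 nat) set" where
  "mons X e = {a. Poly_Mapping.keys a \<subseteq> X \<and> mdeg a = e}"

lemma lookup_le_mdeg: "Poly_Mapping.lookup a i \<le> mdeg a"
proof (cases "i \<in> Poly_Mapping.keys a")
  case True
  then show ?thesis
    unfolding mdeg_def by (intro member_le_sum) auto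
qed (simp add: in_keys_iff)

lemma finite_mons:
  assumes "finite X"
  shows "finite (mons X e)"
proof -
  have "inj_on (\<lambda>a. restrict (Poly_Mapping.lookup a) X) (mons X e)"
  proof (rule inj_onI)
    fix a b assume ab: "a \<in> mons X e" "b \<in> mons X e"
      "restrict (Poly_Mapping.lookup a) X = restrict (Poly_Mapping.lookup b) X"
    show "a = b"
    proof (rule poly_mapping_eqI)
      fix i show "Poly_Mapping.lookup a i = Poly_Mapping.lookup b i"
      proof (cases "i \<in> X")
        case True
        then show ?thesis using fun_cong[OF ab(3), of i] by simp
      next
        case False
        then have "i \<notin> Poly_Mapping.keys a" "i \<notin> Poly_Mapping.keys b"
          using ab(1,2) by (auto simp: mons_def)
        then show ?thesis by (simp add: in_keys_iff)
      qed
    qed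
  qed
  moreover have "(\<lambda>a. restrict (Poly_Mapping.lookup a) X) ` mons X e \<subseteq> X \<rightarrow>\<^sub>E {..e}"
    using lookup_le_mdeg by (auto simp: mons_def PiE_iff)
  moreover have "finite (X \<rightarrow>\<^sub>E {..e})"
    by (rule finite_PiE[OF assms]) simp
  ultimately show ?thesis
    by (rule inj_on_finite)
qed

text \<open>
  Contraction with the Euler vector field of the smallest variable occurring in \<open>X\<^sup>a dX\<^sub>I\<close>, divided by
  the exponent of that variable in the total weight. Unlike the degree, this exponent is at most
  \<open>e + 1\<close>, so it is invertible even if the characteristic divides the degree of the form.
\<close>

definition contract :: "nat \<Rightarrow> nat \<Rightarrow> (nat set \<Rightarrow> 'k::field mpol) \<Rightarrow> nat set \<Rightarrow> 'k mpol" where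
  "contract n e w J = (\<Sum>b\<in>mons {1..n} (Suc e).
     let i = Min (Poly_Mapping.keys b) in
     Poly_Mapping.single b (if \<forall>j\<in>J. i < j
       then Poly_Mapping.lookup (w (insert i J)) (b - unit_exp i) / of_nat (Poly_Mapping.lookup b i)
       else 0))"

text \<open>\<open>X\<^sup>a dX\<^sub>I\<close> is leading if the smallest variable of \<open>X\<^sup>a\<close> and \<open>dX\<^sub>I\<close> together occurs in \<open>dX\<^sub>I\<close>.\<close>

definition leading :: "nat set \<Rightarrow> (nat \<Rightarrow>\<^sub>0 nat) \<Rightarrow> bool" where
  "leading I a \<longleftrightarrow> (\<forall>i\<in>Poly_Mapping.keys a. \<exists>j\<in>I. j \<le> i)"

lemma lookup_contract:
  "Poly_Mapping.lookup (contract n e w J) b =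
    (if b \<in> mons {1..n} (Suc e) \<and> (\<forall>j\<in>J. Min (Poly_Mapping.keys b) < j)
     then Poly_Mapping.lookup (w (insert (Min (Poly_Mapping.keys b)) J)) (b - unit_exp (Min (Poly_Mapping.keys b)))
       / of_nat (Poly_Mapping.lookup b (Min (Poly_Mapping.keys b)))
     else 0)"
proof -
  have fin: "finite (mons {1..n} (Suc e))" by (simp add: finite_mons)
  show ?thesis
    by (simp add: contract_def Let_def lookup_sum lookup_single when_def sum.delta[OF fin] cong: if_cong)
qed

lemma lookup_contract_eq_0:
  "\<not> (b \<in> mons {1..n} (Suc e) \<and> (\<forall>j\<in>J. Min (Poly_Mapping.keys b) < j))
    \<Longrightarrow> Poly_Mapping.lookup (contract n e w J) b = 0"
  unfolding lookup_contract by (rule if_not_P)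

text \<open>\<open>Min (Poly_Mapping.keys b)\<close> is unspecified for the monomial 1. In degree
  \<open>Suc e\<close> it really is a variable of \<open>b\<close>.\<close>

lemma mons_Suc_nonempty: "b \<in> mons X (Suc e) \<Longrightarrow> Poly_Mapping.keys b \<noteq> {}"
  by (auto simp: mons_def mdeg_def)

lemma contract_forms:
  assumes w: "w \<in> forms n (Suc m)"
  shows "contract n e w \<in> forms n m"
proof -
  have "contract n e w J \<in> carrier (poly_ring n)" for J
    unfolding contract_def Let_def
    by (intro poly_ring_sum poly_ring_single) (auto simp: mons_def)
  moreover have "contract n e w J = 0" if J: "J \<notin> ksubsets n m" for J
  proof (rule poly_mapping_eqI)
    fix b
    show "Poly_Mapping.lookup (contract n e w J) b = Poly_Mapping.lookup 0 b"
    proof (cases "b \<in> mons {1..n} (Suc e) \<and> (\<forall>j\<in>J. Min (Poly_Mapping.keys b) < j)")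
      case True
      let ?i = "Min (Poly_Mapping.keys b)"
      have "?i \<in> Poly_Mapping.keys b"
        using True by (intro Min_in mons_Suc_nonempty) auto
      then have "?i \<in> {1..n}" "?i \<notin> J" using True by (auto simp: mons_def)
      then have "insert ?i J \<notin> ksubsets n (Suc m)"
        using J by (auto simp: ksubsets_def card_insert_if dest: finite_subset split: if_splits)
      then have "w (insert ?i J) = 0" using w by (simp add: fns_def)
      then show ?thesis by (simp add: lookup_contract)
    next
      case False
      then show ?thesis using lookup_contract_eq_0[OF False, of w] by simp
    qed
  qed
  ultimately show ?thesis by (auto simp: fns_def)
qed

lemma low_contract: "low (Suc e) (contract n e w J)"
  by (auto simp: low_def lookup_contract mons_def)

text \<open>\<open>contract\<close> reads a coefficient of its argument only after the smallest
  variable of X^b has been moved into the exterior part, and such a monomial form is leading. The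
  leading coefficients of degree e therefore determine the whole contraction.\<close>

lemma contract_cong:
  assumes "\<And>I a. a \<in> mons {1..n} e \<Longrightarrow> leading I a \<Longrightarrow>
    Poly_Mapping.lookup (v I) a = Poly_Mapping.lookup (w I) a"
  shows "contract n e v = contract n e w"
proof (intro ext poly_mapping_eqI)
  fix J b
  have "Poly_Mapping.lookup (v (insert i J)) (b - unit_exp i) = Poly_Mapping.lookup (w (insert i J)) (b - unit_exp i)"
    if b: "b \<in> mons {1..n} (Suc e)" and i: "i = Min (Poly_Mapping.keys b)" for i
  proof (rule assms)
    have ib: "i \<in> Poly_Mapping.keys b" unfolding i by (intro Min_in mons_Suc_nonempty[OF b]) simp
    show "b - unit_exp i \<in> mons {1..n} e"
      using b mdeg_diff_unit_exp[OF ib] keys_diff_unit_exp[of b i] by (auto simp: mons_def)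
    show "leading (insert i J) (b - unit_exp i)"
      using keys_diff_unit_exp[of b i] unfolding leading_def i by (auto intro: Min_le)
  qed
  then show "Poly_Mapping.lookup (contract n e v J) b = Poly_Mapping.lookup (contract n e w J) b"
    by (simp add: lookup_contract)
qed

lemma mons_add_unit:
  "a \<in> mons {1..n} e \<Longrightarrow> i \<in> {1..n} \<Longrightarrow> a + unit_exp i \<in> mons {1..n} (Suc e)"
  by (auto simp: mons_def mdeg_add keys_add_nat)

lemma lookup_ext_deriv_contract_outside:
  assumes "a \<notin> mons {1..n} e"
  shows "Poly_Mapping.lookup (ext_deriv (contract n e w) I) a = 0"
proof -
  have "a + unit_exp i \<notin> mons {1..n} (Suc e)" for i
    using assms by (auto simp: mons_def mdeg_add keys_add_nat)
  then show ?thesis by (simp add: lookup_ext_deriv lookup_contract)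
qed

text \<open>Let i be the smallest index of I. The coefficient is a sum over j in I. If j differs
  from i, then i stays in \<open>I - {j}\<close> while no variable of X^a X_j lies below i, so the
  contraction is zero there. For j = i the factor a_i + 1 from the derivative cancels the division.
  This holds for every form, closed or not.\<close>

lemma ext_deriv_contract_leading:
  fixes w :: "nat set \<Rightarrow> 'k::field mpol"
  assumes inv: "\<And>j. 0 < j \<Longrightarrow> j \<le> Suc e \<Longrightarrow> of_nat j \<noteq> (0 :: 'k)"
    and I: "I \<in> ksubsets n (Suc m)" and a: "a \<in> mons {1..n} e" and lead: "leading I a"
  shows "Poly_Mapping.lookup (ext_deriv (contract n e w) I) a = Poly_Mapping.lookup (w I) a"
proof -
  have fin: "finite I" using I by (rule ksubsets_finite)
  have "I \<noteq> {}" using I by (auto simp: ksubsets_def)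
  define i where "i = Min I"
  have i: "i \<in> I" "\<And>j. j \<in> I \<Longrightarrow> i \<le> j"
    unfolding i_def using fin \<open>I \<noteq> {}\<close> by auto
  have ia: "i \<le> l" if "l \<in> Poly_Mapping.keys a" for l
    using lead i(2) that by (fastforce simp: leading_def)
  have coeff: "Poly_Mapping.lookup (contract n e w (I - {j})) (a + unit_exp j)
      = (if j = i then Poly_Mapping.lookup (w I) a / of_nat (Poly_Mapping.lookup a i + 1) else 0)"
    if j: "j \<in> I" for j
  proof (cases "j = i")
    case True
    have keys: "Poly_Mapping.keys (a + unit_exp i) = insert i (Poly_Mapping.keys a)"
      by (auto simp: keys_add_nat)
    have min: "Min (insert i (Poly_Mapping.keys a)) = i"
      using ia by (intro Min_eqI) auto
    have "a + unit_exp i \<in> mons {1..n} (Suc e)"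
      using a i(1) I by (intro mons_add_unit) (auto simp: ksubsets_def)
    moreover have "\<forall>l\<in>I - {i}. i < l" using i(2) by (auto simp: order_le_less)
    ultimately show ?thesis
      using True i(1) by (simp add: lookup_contract keys min insert_absorb lookup_add)
  next
    case False
    have "Min (Poly_Mapping.keys (a + unit_exp j)) \<in> Poly_Mapping.keys (a + unit_exp j)"
      by (intro Min_in) (auto simp: keys_add_nat)
    then have "i \<le> Min (Poly_Mapping.keys (a + unit_exp j))"
      using ia i(2)[OF j] by (auto simp: keys_add_nat)
    then have "\<not> (\<forall>l\<in>I - {j}. Min (Poly_Mapping.keys (a + unit_exp j)) < l)"
      using i(1) False not_less by (intro notI) blast
    then have "Poly_Mapping.lookup (contract n e w (I - {j})) (a + unit_exp j) = 0"
      by (intro lookup_contract_eq_0) blast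
    then show ?thesis using False by simp
  qed
  have "{j \<in> I. j < i} = {}" using i(2) by (auto simp: not_less[symmetric])
  then have sg: "sg i I = (1 :: 'k)" unfolding sg_def by (simp only: card.empty power_0)
  have "Poly_Mapping.lookup a i + 1 \<le> Suc e"
    using lookup_le_mdeg[of a i] a by (simp add: mons_def)
  then have nz: "of_nat (Poly_Mapping.lookup a i + 1) \<noteq> (0 :: 'k)" by (intro inv) auto
  have "Poly_Mapping.lookup (ext_deriv (contract n e w) I) a
      = (\<Sum>j\<in>I. if j = i then sg j I * (of_nat (Poly_Mapping.lookup a j + 1)
          * (Poly_Mapping.lookup (w I) a / of_nat (Poly_Mapping.lookup a i + 1))) else 0)"
    unfolding lookup_ext_deriv by (intro sum.cong) (simp_all add: coeff)
  also have "\<dots> = Poly_Mapping.lookup (w I) a"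
    using fin i(1) nz by (simp add: sum.delta sg del: of_nat_add)
  finally show ?thesis .
qed

text \<open>If X^a dX_I is not leading, the smallest variable i of X^a lies below all of I.
  Closedness at X^a / X_i and \<open>insert i I\<close> expresses a_i times the coefficient of
  \<open>w\<close> at X^a dX_I through coefficients whose index set contains i, and these are the
  ones that the contraction reads. The bound \<open>low e\<close> suffices since X^a / X_i has
  degree e - 1.\<close>

lemma ext_deriv_contract_closed:
  fixes w :: "nat set \<Rightarrow> 'k::field mpol"
  assumes inv: "\<And>j. 0 < j \<Longrightarrow> j \<le> Suc e \<Longrightarrow> of_nat j \<noteq> (0 :: 'k)"
    and I: "I \<in> ksubsets n (Suc m)" and a: "a \<in> mons {1..n} e"
    and closed: "\<And>I. low e (ext_deriv w I)"
  shows "Poly_Mapping.lookup (ext_deriv (contract n e w) I) a = Poly_Mapping.lookup (w I) a"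
proof (cases "leading I a")
  case True
  with inv I a show ?thesis by (rule ext_deriv_contract_leading)
next
  case False
  have fin: "finite I" using I by (rule ksubsets_finite)
  define i where "i = Min (Poly_Mapping.keys a)"
  obtain l where l: "l \<in> Poly_Mapping.keys a" "\<And>j. j \<in> I \<Longrightarrow> l < j"
    using False by (auto simp: leading_def not_le)
  have i: "i \<in> Poly_Mapping.keys a" "\<And>j. j \<in> Poly_Mapping.keys a \<Longrightarrow> i \<le> j"
    unfolding i_def using l(1) by (auto intro: Min_in)
  have iI: "i < j" if "j \<in> I" for j
    using i(2)[OF l(1)] l(2)[OF that] by simp
  have i_notin: "i \<notin> I" using iI by auto
  let ?a = "a - unit_exp i"
  have a': "?a + unit_exp i = a" by (rule diff_unit_exp_add[OF i(1)])
  have shift: "?a + unit_exp j = a + unit_exp j - unit_exp i" if "j \<in> I" for j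
    using that i_notin i(1)
    by (intro poly_mapping_eqI) (auto simp: lookup_add lookup_minus lookup_single when_def in_keys_iff)
  have ai: "Poly_Mapping.lookup ?a i + 1 = Poly_Mapping.lookup a i"
    using i(1) by (simp add: lookup_minus in_keys_iff)
  have aj: "Poly_Mapping.lookup ?a j = Poly_Mapping.lookup a j" if "j \<in> I" for j
    using that i_notin by (auto simp: lookup_minus lookup_single when_def)
  have "Poly_Mapping.lookup a i \<le> Suc e"
    using lookup_le_mdeg[of a i] a by (simp add: mons_def)
  then have nz: "of_nat (Poly_Mapping.lookup a i) \<noteq> (0 :: 'k)"
    using i(1) by (intro inv) (auto simp: in_keys_iff)
  have sgi: "sg i (insert i I) = (1 :: 'k)"
  proof -
    have "{j \<in> insert i I. j < i} = {}" using iI by force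
    then show ?thesis unfolding sg_def by (simp only: card.empty power_0)
  qed
  have sgj: "sg j (insert i I) = - (sg j I :: 'k)" if "j \<in> I" for j
  proof -
    have "{l \<in> insert i I. l < j} = insert i {l \<in> I. l < j}" using iI[OF that] by auto
    then show ?thesis unfolding sg_def using fin i_notin by simp
  qed
  let ?W = "\<lambda>j. Poly_Mapping.lookup (w (insert i (I - {j}))) (a + unit_exp j - unit_exp i)"
  have "mdeg ?a < e" using mdeg_diff_unit_exp[OF i(1)] a by (simp add: mons_def)
  then have "0 = Poly_Mapping.lookup (ext_deriv w (insert i I)) ?a"
    using closed by (simp add: low_def)
  also have "\<dots> = of_nat (Poly_Mapping.lookup a i) * Poly_Mapping.lookup (w I) a
      + (\<Sum>j\<in>I. sg j (insert i I) * (of_nat (Poly_Mapping.lookup ?a j + 1)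
        * Poly_Mapping.lookup (w (insert i I - {j})) (?a + unit_exp j)))"
    unfolding lookup_ext_deriv using fin i_notin
    by (simp add: sgi a' ai[symmetric] del: of_nat_add of_nat_Suc)
  \<comment> \<open>Adjoining i, which lies below every j in I, flips all signs.\<close>
  also have "(\<Sum>j\<in>I. sg j (insert i I) * (of_nat (Poly_Mapping.lookup ?a j + 1)
        * Poly_Mapping.lookup (w (insert i I - {j})) (?a + unit_exp j)))
      = - (\<Sum>j\<in>I. sg j I * (of_nat (Poly_Mapping.lookup a j + 1) * ?W j))"
    unfolding sum_negf[symmetric]
  proof (rule sum.cong)
    fix j assume j: "j \<in> I"
    then have "insert i I - {j} = insert i (I - {j})" using i_notin by auto
    then show "sg j (insert i I) * (of_nat (Poly_Mapping.lookup ?a j + 1)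
        * Poly_Mapping.lookup (w (insert i I - {j})) (?a + unit_exp j))
      = - (sg j I * (of_nat (Poly_Mapping.lookup a j + 1) * ?W j))"
      using j by (simp add: sgj aj shift)
  qed simp
  finally have 1: "of_nat (Poly_Mapping.lookup a i) * Poly_Mapping.lookup (w I) a
      = (\<Sum>j\<in>I. sg j I * (of_nat (Poly_Mapping.lookup a j + 1) * ?W j))"
    by simp
  have coeff: "Poly_Mapping.lookup (contract n e w (I - {j})) (a + unit_exp j)
      = ?W j / of_nat (Poly_Mapping.lookup a i)" if j: "j \<in> I" for j
  proof -
    have "Poly_Mapping.keys (a + unit_exp j) = insert j (Poly_Mapping.keys a)"
      by (auto simp: keys_add_nat)
    moreover have "Min (insert j (Poly_Mapping.keys a)) = i"
      using i iI[OF j] by (intro Min_eqI) auto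
    ultimately have min: "Min (Poly_Mapping.keys (a + unit_exp j)) = i" by simp
    have "a + unit_exp j \<in> mons {1..n} (Suc e)"
      using a j I by (intro mons_add_unit) (auto simp: ksubsets_def)
    moreover have "Poly_Mapping.lookup (a + unit_exp j) i = Poly_Mapping.lookup a i"
      using iI[OF j] by (simp add: lookup_add lookup_single)
    ultimately show ?thesis
      using iI by (simp add: lookup_contract min)
  qed
  have "Poly_Mapping.lookup (ext_deriv (contract n e w) I) a
      = (\<Sum>j\<in>I. sg j I * (of_nat (Poly_Mapping.lookup a j + 1) * (?W j / of_nat (Poly_Mapping.lookup a i))))"
    unfolding lookup_ext_deriv by (intro sum.cong) (simp_all add: coeff)
  also have "\<dots> = (\<Sum>j\<in>I. sg j I * (of_nat (Poly_Mapping.lookup a j + 1) * ?W j)) / of_nat (Poly_Mapping.lookup a i)"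
    by (simp add: sum_divide_distrib)
  also have "\<dots> = Poly_Mapping.lookup (w I) a"
    unfolding 1[symmetric] using nz by simp
  finally show ?thesis .
qed

subsection \<open>Counting monomial forms\<close>

lemma mons_0: "mons X 0 = {0}"
  by (auto simp: mons_def mdeg_eq_0_iff)

lemma inj_add_unit: "inj_on (\<lambda>a. a + unit_exp i) S"
  by (auto simp: inj_on_def)

text \<open>Either X_b does not occur or one factor X_b can be split off, which is Pascal's rule.
  For empty \<open>X\<close> the truncated subtraction still gives 1 in degree 0 and 0 in all other
  degrees.\<close>

lemma card_mons:
  assumes "finite X"
  shows "card (mons X e) = (card X + e - 1) choose e"
  using assms
proof (induction X arbitrary: e)
  case empty
  show ?case
  proof (cases e)
    case (Suc d)
    have "mons {} (Suc d) = {}"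
      by (auto simp: mons_def mdeg_def)
    then show ?thesis using Suc by simp
  qed (simp add: mons_0)
next
  case (insert b X)
  show ?case
  proof (induction e)
    case (Suc e)
    have eq: "mons (insert b X) (Suc e) = mons X (Suc e) \<union> (\<lambda>a. a + unit_exp b) ` mons (insert b X) e"
    proof (intro equalityI subsetI)
      fix a assume a: "a \<in> mons (insert b X) (Suc e)"
      show "a \<in> mons X (Suc e) \<union> (\<lambda>a. a + unit_exp b) ` mons (insert b X) e"
      proof (cases "b \<in> Poly_Mapping.keys a")
        case True
        have "a = (a - unit_exp b) + unit_exp b" by (rule diff_unit_exp_add[OF True, symmetric])
        moreover have "a - unit_exp b \<in> mons (insert b X) e"
          using a keys_diff_unit_exp[of a b] mdeg_diff_unit_exp[OF True] by (auto simp: mons_def)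
        ultimately show ?thesis by blast
      qed (use a in \<open>auto simp: mons_def\<close>)
    qed (auto simp: mons_def mdeg_add keys_add_nat)
    have disj: "mons X (Suc e) \<inter> (\<lambda>a. a + unit_exp b) ` mons (insert b X) e = {}"
      using insert.hyps by (auto simp: mons_def keys_add_nat)
    have "card (mons (insert b X) (Suc e)) = card (mons X (Suc e)) + card (mons (insert b X) e)"
      unfolding eq using insert.hyps disj
      by (subst card_Un_disjoint) (simp_all add: finite_mons card_image[OF inj_add_unit])
    then show ?case
      using Suc insert by simp
  qed (simp add: mons_0)
qed

text \<open>The set of variables is arbitrary, so that the count can add one variable at a
  time.\<close>

definition nonleading :: "nat set \<Rightarrow> nat \<Rightarrow> nat \<Rightarrow> (nat set \<times> (nat \<Rightarrow>\<^sub>0 nat)) set" where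
  "nonleading X M e = {(I, a). I \<subseteq> X \<and> card I = M \<and> a \<in> mons X e \<and> \<not> leading I a}"

lemma finite_nonleading: "finite X \<Longrightarrow> finite (nonleading X M e)"
  by (rule finite_subset[of _ "Pow X \<times> mons X e"]) (auto simp: nonleading_def finite_mons)

lemma nonleading_0: "nonleading X M 0 = {}"
  by (auto simp: nonleading_def mons_0 leading_def)

text \<open>The new variable b is always the smallest. It cannot belong to I in a non-leading pair,
  since it would then be at most every variable of X^a. If b divides X^a, any I inside X gives a
  non-leading pair; otherwise the pair is already one over X. After the step marked below, the two
  counts add up by Pascal's rule.\<close>

lemma card_nonleading:
  assumes "finite X"
  shows "card (nonleading X M (Suc e)) = (M + e choose M) * (card X + e choose (M + e + 1))"
  using assms
proof (induction X rule: finite_linorder_min_induct)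
  case empty
  have "nonleading {} M (Suc e) = {}"
    by (auto simp: nonleading_def mons_def mdeg_def)
  then show ?case by (simp add: binomial_eq_0)
next
  case (insert b X)
  let ?A = "{I. I \<subseteq> X \<and> card I = M} \<times> (\<lambda>a. a + unit_exp b) ` mons (insert b X) e"
  have b: "b \<notin> X" using insert by auto
  have eq: "nonleading (insert b X) M (Suc e) = ?A \<union> nonleading X M (Suc e)"
  proof (intro equalityI subsetI)
    fix p assume "p \<in> nonleading (insert b X) M (Suc e)"
    then obtain I a where p: "p = (I, a)" and I: "I \<subseteq> insert b X" "card I = M"
      and a: "a \<in> mons (insert b X) (Suc e)" and nl: "\<not> leading I a"
      by (auto simp: nonleading_def)
    obtain l where l: "l \<in> Poly_Mapping.keys a" "\<And>j. j \<in> I \<Longrightarrow> l < j"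
      using nl by (auto simp: leading_def not_le)
    have "l \<in> insert b X" using l(1) a by (auto simp: mons_def)
    then have "b \<le> l" using insert by auto
    then have "b \<notin> I" using l(2) by fastforce
    then have IX: "I \<subseteq> X" using I by auto
    show "p \<in> ?A \<union> nonleading X M (Suc e)"
    proof (cases "b \<in> Poly_Mapping.keys a")
      case True
      have "a = (a - unit_exp b) + unit_exp b" by (rule diff_unit_exp_add[OF True, symmetric])
      moreover have "a - unit_exp b \<in> mons (insert b X) e"
        using a keys_diff_unit_exp[of a b] mdeg_diff_unit_exp[OF True] by (auto simp: mons_def)
      ultimately show ?thesis using p IX I by blast
    next
      case False
      then have "a \<in> mons X (Suc e)" using a by (auto simp: mons_def)
      then show ?thesis using p IX I nl by (simp add: nonleading_def)
    qed
  next
    fix p assume "p \<in> ?A \<union> nonleading X M (Suc e)"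
    then show "p \<in> nonleading (insert b X) M (Suc e)"
    proof
      assume "p \<in> ?A"
      then obtain I a where p: "p = (I, a + unit_exp b)" "I \<subseteq> X" "card I = M" "a \<in> mons (insert b X) e"
        by auto
      have "b < j" if "j \<in> I" for j using that p(2) insert.hyps by auto
      then have "\<not> leading I (a + unit_exp b)"
        by (auto simp: leading_def keys_add_nat not_le)
      then show ?thesis
        using p by (auto simp: nonleading_def mons_def mdeg_add keys_add_nat)
    qed (auto simp: nonleading_def mons_def)
  qed
  have disj: "?A \<inter> nonleading X M (Suc e) = {}"
    using b by (auto simp: nonleading_def mons_def keys_add_nat)
  have cX: "card (insert b X) = Suc (card X)" using insert b by simp
  have "card ?A = (card X choose M) * (card X + e choose e)"
    using insert.hyps by (simp add: card_cartesian_product n_subsets card_image[OF inj_add_unit] card_mons cX)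
  moreover have "finite ?A" using insert.hyps by (auto simp: finite_mons)
  ultimately have "card (nonleading (insert b X) M (Suc e))
      = (card X choose M) * (card X + e choose e) + (M + e choose M) * (card X + e choose (M + e + 1))"
    unfolding eq using insert disj by (subst card_Un_disjoint) (simp_all add: finite_nonleading)
  \<comment> \<open>Both products count the disjoint choices of e and of M elements among
    \<open>card X + e\<close>. For M above \<open>card X\<close> both are 0.\<close>
  also have "(card X choose M) * (card X + e choose e) = (M + e choose M) * (card X + e choose (M + e))"
  proof (cases "M \<le> card X")
    case True
    have "(M + e choose M) = (M + e choose e)"
      using binomial_symmetric[of M "M + e"] by simp
    then show ?thesis
      using choose_mult[of e "M + e" "card X + e"] True by (simp add: mult.commute)
  qed (simp add: binomial_eq_0)
  finally show ?case
    unfolding cX by (simp add: Suc_eq_plus1[symmetric] distrib_left)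
qed

section \<open>The index sets of the two bases and their sizes\<close>

definition leading_idx :: "nat \<Rightarrow> nat \<Rightarrow> nat \<Rightarrow> (nat set \<times> (nat \<Rightarrow>\<^sub>0 nat)) set" where
  "leading_idx n M e = {(I, a). I \<in> ksubsets n M \<and> a \<in> mons {1..n} e \<and> leading I a}"

text \<open>The monomial forms whose classes are a basis of the m-forms of the truncated ring, for k
  = e + 1. Those of degree below e all survive, because every relation starts in degree e; in degree
  e the relations eliminate the leading ones.\<close>

definition residual_idx :: "nat \<Rightarrow> nat \<Rightarrow> nat \<Rightarrow> (nat set \<times> (nat \<Rightarrow>\<^sub>0 nat)) set" where
  "residual_idx n M e = ksubsets n M \<times> (\<Union>l<e. mons {1..n} l) \<union> nonleading {1..n} M e"

lemma card_ksubsets: "card (ksubsets n M) = n choose M"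
  unfolding ksubsets_def using n_subsets[of "{1..n}" M] by simp

lemma finite_leading_idx: "finite (leading_idx n M e)"
  by (rule finite_subset[of _ "ksubsets n M \<times> mons {1..n} e"]) (auto simp: leading_idx_def finite_mons)

lemma finite_residual_idx: "finite (residual_idx n M e)"
  by (simp add: residual_idx_def finite_mons finite_nonleading)

lemma card_leading_idx:
  "card (leading_idx n M e) + card (nonleading {1..n} M e) = (n choose M) * (n + e - 1 choose e)"
proof -
  have "ksubsets n M \<times> mons {1..n} e = leading_idx n M e \<union> nonleading {1..n} M e"
    by (auto simp: leading_idx_def nonleading_def ksubsets_def)
  moreover have "leading_idx n M e \<inter> nonleading {1..n} M e = {}"
    by (auto simp: leading_idx_def nonleading_def)
  moreover have "card (ksubsets n M \<times> mons {1..n} e) = (n choose M) * (n + e - 1 choose e)"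
    by (simp add: card_cartesian_product card_ksubsets card_mons)
  ultimately show ?thesis
    using card_Un_disjoint[OF finite_leading_idx finite_nonleading, of "{1..n}" n M e M e] by simp
qed

text \<open>Summing the number of monomials over the degrees below e is the hockey-stick identity,
  obtained from Pascal's rule.\<close>

lemma card_residual_idx:
  assumes "n \<ge> 1"
  shows "card (residual_idx n M e) = (n choose M) * (n + e - 1 choose n) + card (nonleading {1..n} M e)"
proof -
  have "card (\<Union>l<e. mons {1..n} l) = (n + e - 1 choose n)"
  proof (induction e)
    case 0
    \<comment> \<open>There are no monomials here, and \<open>n - 1 choose n\<close> is 0 for
      positive n. For n = 0 truncated subtraction would turn it into 1.\<close>
    show ?case using assms by (simp add: binomial_eq_0)
  next
    case (Suc e)
    have "(\<Union>l<Suc e. mons {1..n} l) = (\<Union>l<e. mons {1..n} l) \<union> mons {1..n} e"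
      by (auto simp: less_Suc_eq)
    moreover have "(\<Union>l<e. mons {1..n} l) \<inter> mons {1..n} e = {}"
      by (auto simp: mons_def)
    ultimately have "card (\<Union>l<Suc e. mons {1..n} l) = (n + e - 1 choose n) + (n + e - 1 choose e)"
      using Suc by (simp add: card_Un_disjoint finite_mons card_mons)
    also have "(n + e - 1 choose e) = (n + e - 1 choose (n - 1))"
      using binomial_symmetric[of e "n + e - 1"] assms by simp
    finally show ?case
      using assms by (cases n) (simp_all add: One_nat_def)
  qed
  moreover have "ksubsets n M \<times> (\<Union>l<e. mons {1..n} l) \<inter> nonleading {1..n} M e = {}"
    by (auto simp: nonleading_def mons_def)
  ultimately show ?thesis
    unfolding residual_idx_def
    by (subst card_Un_disjoint) (simp_all add: finite_mons finite_nonleading card_cartesian_product card_ksubsets)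
qed

lemma ibinom_of_nat: "ibinom (int a) (int b) = int (a choose b)"
  by (auto simp: ibinom_def binomial_eq_0)

text \<open>In degree e = 0 no pair is non-leading, in agreement with the first factor, whose upper
  index M - 1 is below M. If n \<le> M, the lower index n - M - 1 is negative, and
  \<open>n + d choose (M + d + 1)\<close> vanishes as well.\<close>

lemma card_nonleading_ibinom:
  assumes "n \<ge> 1" "M \<ge> 1"
  shows "int (card (nonleading {1..n} M e))
    = ibinom (int M + int (Suc e) - 2) M * ibinom (int n + int (Suc e) - 2) (int n - int M - 1)"
proof (cases e)
  case 0
  have "int M + int (Suc 0) - 2 = int (M - 1)" using assms by simp
  then show ?thesis
    using assms 0 by (simp only: ibinom_of_nat) (simp add: nonleading_0)
next
  case (Suc d)
  have "ibinom (int M + int (Suc e) - 2) (int M) = int (M + d choose M)"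
    unfolding ibinom_of_nat[symmetric] Suc by simp
  moreover have "ibinom (int n + int (Suc e) - 2) (int n - int M - 1) = int (n + d choose (M + d + 1))"
  proof (cases "M + 1 \<le> n")
    case True
    then have eqs: "int n + int (Suc e) - 2 = int (n + d)" "int n - int M - 1 = int (n - M - 1)"
      "n + d - (M + d + 1) = n - M - 1"
      using Suc by simp_all
    show ?thesis
      unfolding eqs ibinom_of_nat
      using binomial_symmetric[of "M + d + 1" "n + d"] True unfolding eqs(3) by simp
  qed (simp add: ibinom_def binomial_eq_0)
  ultimately show ?thesis
    using Suc by (simp add: card_nonleading)
qed

lemma card_leading_idx_ibinom:
  assumes "n \<ge> 1" "M \<ge> 1"
  shows "int (card (leading_idx n M e))
    = ibinom n M * ibinom (int n + int (Suc e) - 2) (int n - 1)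
      - ibinom (int M + int (Suc e) - 2) M * ibinom (int n + int (Suc e) - 2) (int n - int M - 1)"
proof -
  have eqs: "int n + int (Suc e) - 2 = int (n + e - 1)" "int n - 1 = int (n - 1)" "n + e - 1 - e = n - 1"
    using assms by simp_all
  have "ibinom (int n + int (Suc e) - 2) (int n - 1) = int (n + e - 1 choose e)"
    unfolding eqs ibinom_of_nat using binomial_symmetric[of e "n + e - 1"] assms unfolding eqs(3) by simp
  moreover have "int (card (leading_idx n M e)) + int (card (nonleading {1..n} M e))
      = int (n choose M) * int (n + e - 1 choose e)"
    using arg_cong[OF card_leading_idx[of n M e], of int] by simp
  ultimately show ?thesis
    unfolding card_nonleading_ibinom[OF assms, symmetric] unfolding ibinom_of_nat by simp
qed

lemma card_residual_idx_ibinom: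
  assumes "n \<ge> 1" "M \<ge> 1"
  shows "int (card (residual_idx n M e))
    = ibinom n M * ibinom (int n + int (Suc e) - 2) n
      + ibinom (int M + int (Suc e) - 2) M * ibinom (int n + int (Suc e) - 2) (int n - int M - 1)"
proof -
  have eq: "int n + int (Suc e) - 2 = int (n + e - 1)" using assms by simp
  have "ibinom (int n + int (Suc e) - 2) n = int (n + e - 1 choose n)"
    unfolding eq by (rule ibinom_of_nat)
  then show ?thesis
    unfolding card_nonleading_ibinom[OF assms, symmetric] card_residual_idx[OF assms(1)]
    unfolding ibinom_of_nat by simp
qed

subsection \<open>Dimension from a coordinate isomorphism\<close>

text \<open>The vector space axioms of \<open>V\<close> are transported along \<open>P\<close> and
  so become part of the conclusion. For a carrier that is an intersection, this takes the place of a
  proof that it is a subspace. The dimension is then that of the vectors of length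
  \<open>card T\<close>.\<close>

lemma has_dimension_coordinates:
  fixes V :: "('k::field, 'v, 'z) module_scheme" and P :: "('t \<Rightarrow> 'k) \<Rightarrow> 'v"
  assumes T: "finite T"
    and bij: "bij_betw P {c. \<forall>t. t \<notin> T \<longrightarrow> c t = 0} (carrier V)"
    and zero: "P (\<lambda>_. 0) = \<zero>\<^bsub>V\<^esub>"
    and add: "\<And>c c'. \<forall>t. t \<notin> T \<longrightarrow> c t = 0 \<Longrightarrow> \<forall>t. t \<notin> T \<longrightarrow> c' t = 0 \<Longrightarrow>
      P (\<lambda>t. c t + c' t) = P c \<oplus>\<^bsub>V\<^esub> P c'"
    and smult: "\<And>x c. \<forall>t. t \<notin> T \<longrightarrow> c t = 0 \<Longrightarrow> P (\<lambda>t. x * c t) = x \<odot>\<^bsub>V\<^esub> P c"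
  shows "has_dimension (class_ring :: 'k ring) V (int (card T))"
proof -
  let ?C = "{c. \<forall>t. t \<notin> T \<longrightarrow> c t = (0 :: 'k)}" and ?K = "class_ring :: 'k ring"
  have cring_K: "cring ?K"
    using class_field[where 'a = 'k] by (simp add: field_def domain_def)
  have rep: "\<exists>c\<in>?C. x = P c" if "x \<in> carrier V" for x
    using that bij by (auto simp: bij_betw_def)
  have cl: "P c \<in> carrier V" if "c \<in> ?C" for c
    using that bij by (auto simp: bij_betw_def)
  have module: "Module.module ?K V"
  proof (rule moduleI)
    show "abelian_group V"
    proof (rule abelian_groupI)
      show "\<zero>\<^bsub>V\<^esub> \<in> carrier V" using cl[of "\<lambda>_. 0"] zero by simp
      fix x y z assume "x \<in> carrier V" "y \<in> carrier V" "z \<in> carrier V"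
      then obtain a b c where c: "a \<in> ?C" "b \<in> ?C" "c \<in> ?C" "x = P a" "y = P b" "z = P c"
        using rep by meson
      show "x \<oplus>\<^bsub>V\<^esub> y \<in> carrier V"
        using c add[of a b] cl[of "\<lambda>t. a t + b t"] by simp
      show "x \<oplus>\<^bsub>V\<^esub> y \<oplus>\<^bsub>V\<^esub> z = x \<oplus>\<^bsub>V\<^esub> (y \<oplus>\<^bsub>V\<^esub> z)"
        using c add[of a b] add[of b c] add[of "\<lambda>t. a t + b t" c] add[of a "\<lambda>t. b t + c t"]
        by (simp add: add.assoc)
      show "x \<oplus>\<^bsub>V\<^esub> y = y \<oplus>\<^bsub>V\<^esub> x"
        using c add[of a b] add[of b a] by (simp add: add.commute)
      show "\<zero>\<^bsub>V\<^esub> \<oplus>\<^bsub>V\<^esub> x = x"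
        using c add[of "\<lambda>_. 0" a] zero by simp
      show "\<exists>y\<in>carrier V. y \<oplus>\<^bsub>V\<^esub> x = \<zero>\<^bsub>V\<^esub>"
        using c add[of "\<lambda>t. - a t" a] zero cl[of "\<lambda>t. - a t"] by (intro bexI[of _ "P (\<lambda>t. - a t)"]) simp_all
    qed
  next
    fix r s x y assume "x \<in> carrier V" "y \<in> carrier V"
    then obtain a b where c: "a \<in> ?C" "b \<in> ?C" "x = P a" "y = P b"
      using rep by meson
    show "r \<odot>\<^bsub>V\<^esub> x \<in> carrier V"
      using c smult[of a r] cl[of "\<lambda>t. r * a t"] by simp
    show "(r \<oplus>\<^bsub>?K\<^esub> s) \<odot>\<^bsub>V\<^esub> x = r \<odot>\<^bsub>V\<^esub> x \<oplus>\<^bsub>V\<^esub> s \<odot>\<^bsub>V\<^esub> x"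
      using c smult[of a r] smult[of a s] smult[of a "r + s"] add[of "\<lambda>t. r * a t" "\<lambda>t. s * a t"]
      by (simp add: distrib_right)
    show "r \<odot>\<^bsub>V\<^esub> (x \<oplus>\<^bsub>V\<^esub> y) = r \<odot>\<^bsub>V\<^esub> x \<oplus>\<^bsub>V\<^esub> r \<odot>\<^bsub>V\<^esub> y"
      using c smult[of a r] smult[of b r] smult[of "\<lambda>t. a t + b t" r] add[of a b]
        add[of "\<lambda>t. r * a t" "\<lambda>t. r * b t"]
      by (simp add: distrib_left)
    show "(r \<otimes>\<^bsub>?K\<^esub> s) \<odot>\<^bsub>V\<^esub> x = r \<odot>\<^bsub>V\<^esub> (s \<odot>\<^bsub>V\<^esub> x)"
      using c smult[of a s] smult[of a "r * s"] smult[of "\<lambda>t. s * a t" r] by (simp add: mult.assoc)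
  next
    fix x assume "x \<in> carrier V"
    then obtain a where c: "a \<in> ?C" "x = P a" using rep by meson
    show "\<one>\<^bsub>?K\<^esub> \<odot>\<^bsub>V\<^esub> x = x"
      using c smult[of a 1] by simp
  qed (rule cring_K)
  have vs: "vectorspace ?K V"
    by (rule vectorspace.intro[OF module class_field])
  define N where "N = card T"
  obtain h where h: "bij_betw h T {0..<N}"
    using ex_bij_betw_finite_nat[OF T] by (auto simp: N_def)
  let ?W = "module_vec TYPE('k) N"
  define coord where "coord v = (\<lambda>t. if t \<in> T then vec_index v (h t) else 0)" for v :: "'k vec"
  have hT: "h t < N" if "t \<in> T" for t using h that by (auto simp: bij_betw_def)
  have coord_C: "coord v \<in> ?C" for v by (simp add: coord_def)
  have coord_bij: "bij_betw coord (carrier_vec N) ?C"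
  proof (rule bij_betwI')
    fix v w :: "'k vec" assume v: "v \<in> carrier_vec N" "w \<in> carrier_vec N"
    show "coord v = coord w \<longleftrightarrow> v = w"
    proof
      assume eq: "coord v = coord w"
      show "v = w"
      proof (rule eq_vecI)
        fix i assume "i < dim_vec w"
        then have "i \<in> h ` T" using h v by (simp add: bij_betw_def)
        then obtain t where "t \<in> T" "h t = i" by blast
        then show "vec_index v i = vec_index w i" using fun_cong[OF eq, of t] by (simp add: coord_def)
      qed (use v in auto)
    qed simp
  next
    fix c assume c: "c \<in> ?C"
    have "c = coord (vec N (\<lambda>i. c (inv_into T h i)))"
      using c hT h by (auto simp: coord_def fun_eq_iff bij_betw_def)
    then show "\<exists>v\<in>carrier_vec N. c = coord v" by (metis vec_carrier)
  qed (use coord_C in blast)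
  have lin: "P \<circ> coord \<in> LinearCombinations.module_hom ?K ?W V"
  proof -
    have "P (coord (v + w)) = P (coord v) \<oplus>\<^bsub>V\<^esub> P (coord w)"
      if "v \<in> carrier_vec N" "w \<in> carrier_vec N" for v w
    proof -
      have "coord (v + w) = (\<lambda>t. coord v t + coord w t)"
        using that hT by (auto simp: coord_def fun_eq_iff)
      then show ?thesis using add coord_C by simp
    qed
    moreover have "P (coord (r \<cdot>\<^sub>v v)) = r \<odot>\<^bsub>V\<^esub> P (coord v)" if "v \<in> carrier_vec N" for r v
    proof -
      have "coord (r \<cdot>\<^sub>v v) = (\<lambda>t. r * coord v t)"
        using that hT by (auto simp: coord_def fun_eq_iff)
      then show ?thesis using smult coord_C by simp
    qed
    ultimately show ?thesis
      using cl coord_C by (auto simp: LinearCombinations.module_hom_def module_vec_def)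
  qed
  interpret lm: linear_map ?K ?W V "P \<circ> coord"
    by (intro linear_map.intro vec_vs vs mod_hom.intro vec_module module mod_hom_axioms.intro lin)
  interpret vec: vec_space "TYPE('k)" N .
  have "bij_betw (P \<circ> coord) (carrier ?W) (carrier V)"
    using bij_betw_trans[OF coord_bij bij] by (simp add: module_vec_def)
  then have inj: "inj_on (P \<circ> coord) (carrier ?W)" and surj: "(P \<circ> coord) ` carrier ?W = carrier V"
    by (auto simp: bij_betw_def)
  have fd: "vectorspace.fin_dim ?K ?W" by simp
  have "vectorspace.dim ?K ?W = N" by (rule vec.dim_is_n)
  with lm.dim_eq[OF fd inj surj] have "vectorspace.dim ?K V = N" by simp
  then show ?thesis
    using vs lm.surj_fin_dim[OF fd surj] by (simp add: has_dimension_def N_def)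
qed

subsection \<open>Powers of the irrelevant ideal\<close>

definition low_ideal :: "nat \<Rightarrow> nat \<Rightarrow> 'k::field mpol set" where
  "low_ideal n d = {f \<in> carrier (poly_ring n). low d f}"

lemma low_ideal_subset: "low_ideal n d \<subseteq> carrier (poly_ring n)"
  by (auto simp: low_ideal_def)

lemma ideal_low_ideal: "ideal (low_ideal n d) (poly_ring n)"
proof -
  interpret R: cring "poly_ring n :: 'a mpol ring" by (rule cring_poly_ring)
  show ?thesis
  proof (rule idealI)
    show "subgroup (low_ideal n d) (add_monoid (poly_ring n :: 'a mpol ring))"
    proof (rule subgroup.intro)
      fix f :: "'a mpol" assume f: "f \<in> low_ideal n d"
      then show "inv\<^bsub>add_monoid (poly_ring n)\<^esub> f \<in> low_ideal n d"
        unfolding a_inv_def[symmetric]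
        by (simp add: low_ideal_def a_inv_poly_ring poly_ring_uminus low_uminus)
    qed (auto simp: low_ideal_def poly_ring_add low_add)
  qed (auto simp: low_ideal_def poly_ring_mult low_mult low_mult_right R.ring_axioms)
qed

lemma mdeg_ge_keys: "low d f \<Longrightarrow> t \<in> Poly_Mapping.keys f \<Longrightarrow> d \<le> mdeg t"
  by (auto simp: low_def in_keys_iff not_less[symmetric])

lemma low_single: "d \<le> mdeg t \<Longrightarrow> low d (Poly_Mapping.single t c)"
  by (auto simp: low_def lookup_single when_def)

lemma var_low_ideal: "i \<in> {1..n} \<Longrightarrow> poly_var i \<in> low_ideal n (Suc 0)"
  by (simp add: low_ideal_def poly_ring_var) (simp add: poly_var_def low_single)

text \<open>Every term of a polynomial without constant term is divisible by a variable.\<close>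

lemma irrelevant_ideal_eq: "irrelevant_ideal n = low_ideal n (Suc 0)"
proof -
  interpret R: cring "poly_ring n :: 'a mpol ring" by (rule cring_poly_ring)
  have vars: "poly_var ` {1..n} \<subseteq> carrier (poly_ring n :: 'a mpol ring)"
    using poly_ring_var by blast
  interpret I: ideal "irrelevant_ideal n :: 'a mpol set" "poly_ring n"
    unfolding irrelevant_ideal_def by (rule R.genideal_ideal[OF vars])
  have var: "(poly_var i :: 'a mpol) \<in> irrelevant_ideal n" if "i \<in> {1..n}" for i
    using R.genideal_self[OF vars] that unfolding irrelevant_ideal_def by blast
  show ?thesis
  proof
    show "irrelevant_ideal n \<subseteq> (low_ideal n (Suc 0) :: 'a mpol set)"
      unfolding irrelevant_ideal_def
      by (rule R.genideal_minimal[OF ideal_low_ideal]) (use var_low_ideal in blast)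
    show "(low_ideal n (Suc 0) :: 'a mpol set) \<subseteq> irrelevant_ideal n"
    proof
      fix f :: "'a mpol" assume f: "f \<in> low_ideal n (Suc 0)"
      show "f \<in> irrelevant_ideal n"
      proof (induction f rule: poly_mapping_add_induct)
        case zero
        show ?case using I.zero_closed by simp
      next
        case (single t)
        have "Suc 0 \<le> mdeg t" using f single by (intro mdeg_ge_keys) (auto simp: low_ideal_def)
        then obtain i where i: "i \<in> Poly_Mapping.keys t" by (fastforce simp: mdeg_def)
        have t: "Poly_Mapping.keys t \<subseteq> {1..n}"
          using f single by (auto simp: low_ideal_def carrier_poly_ring)
        have "Poly_Mapping.single (t - unit_exp i) (Poly_Mapping.lookup f t) \<in> carrier (poly_ring n)"
          using t keys_diff_unit_exp[of t i] by (intro poly_ring_single) blast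
        moreover have "(poly_var i :: 'a mpol) \<in> irrelevant_ideal n" using t i by (intro var) blast
        ultimately show ?case
          using I.I_r_closed[of "poly_var i" "Poly_Mapping.single (t - unit_exp i) (Poly_Mapping.lookup f t)"]
          by (simp flip: single_eq_var_mult[OF i])
      next
        case (add g h)
        then show ?case using I.a_closed by simp
      qed
    qed
  qed
qed

text \<open>Splitting a variable off a monomial of degree at least d + 1 leaves one of degree at
  least d; conversely, lower bounds on degrees add up in products.\<close>

lemma ideal_prod_low: "ideal_prod (poly_ring n) (low_ideal n d) (low_ideal n (Suc 0)) = (low_ideal n (Suc d) :: 'k::field mpol set)"
proof
  show "ideal_prod (poly_ring n) (low_ideal n d) (low_ideal n (Suc 0)) \<subseteq> (low_ideal n (Suc d) :: 'k mpol set)"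
  proof
    fix f :: "'k mpol" assume "f \<in> ideal_prod (poly_ring n) (low_ideal n d) (low_ideal n (Suc 0))"
    then show "f \<in> low_ideal n (Suc d)"
    proof induction
      case (prod g h)
      then show ?case using low_mult_add[of d g "Suc 0" h] by (simp add: low_ideal_def poly_ring_mult)
    qed (simp add: low_ideal_def poly_ring_add low_add)
  qed
  show "(low_ideal n (Suc d) :: 'k mpol set) \<subseteq> ideal_prod (poly_ring n) (low_ideal n d) (low_ideal n (Suc 0))"
  proof
    fix f :: "'k mpol" assume f: "f \<in> low_ideal n (Suc d)"
    have prod: "g * h \<in> ideal_prod (poly_ring n) (low_ideal n d) (low_ideal n (Suc 0))"
      if "g \<in> low_ideal n d" "h \<in> low_ideal n (Suc 0)" for g h :: "'k mpol"
      using ideal_prod.prod[OF that, of "poly_ring n"] by simp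
    show "f \<in> ideal_prod (poly_ring n) (low_ideal n d) (low_ideal n (Suc 0))"
    proof (induction f rule: poly_mapping_add_induct)
      case zero
      show ?case using prod[of 0 0] by (simp add: low_ideal_def)
    next
      case (single t)
      have deg: "Suc d \<le> mdeg t" using f single by (intro mdeg_ge_keys) (auto simp: low_ideal_def)
      then obtain i where i: "i \<in> Poly_Mapping.keys t" by (fastforce simp: mdeg_def)
      have t: "Poly_Mapping.keys t \<subseteq> {1..n}"
        using f single by (auto simp: low_ideal_def carrier_poly_ring)
      have "Poly_Mapping.single (t - unit_exp i) (Poly_Mapping.lookup f t) \<in> low_ideal n d"
        unfolding low_ideal_def
        using t keys_diff_unit_exp[of t i] deg mdeg_diff_unit_exp[OF i]
        by (auto intro!: poly_ring_single low_single)
      moreover have "(poly_var i :: 'k mpol) \<in> low_ideal n (Suc 0)"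
        using t i by (intro var_low_ideal) blast
      ultimately show ?case
        unfolding single_eq_var_mult[OF i] by (subst mult.commute) (rule prod)
    next
      case (add g h)
      then show ?case using ideal_prod.sum[of g "poly_ring n"] by simp
    qed
  qed
qed

lemma irrelevant_power_eq: "irrelevant_power n k = low_ideal n k"
proof (induction k)
  case 0
  show ?case
    by (simp add: irrelevant_power_def nat_pow_def ideals_set_def low_ideal_def low_def)
next
  case (Suc k)
  have "irrelevant_power n (Suc k) = ideal_prod (poly_ring n) (irrelevant_power n k) (irrelevant_ideal n :: 'a mpol set)"
    by (simp add: irrelevant_power_def nat_pow_def ideals_set_def)
  then show ?case
    unfolding Suc irrelevant_ideal_eq ideal_prod_low .
qed

section \<open>The polynomial ring and its truncation as presented algebras\<close>

lemma presentation_poly_ring: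
  "presentation (poly_ring n :: 'k::field mpol ring) n id poly_const"
  by (intro presentation.intro presentation_axioms.intro cring_poly_ring ring_hom_memI) auto

lemma J_poly_ring: "presentation.J (poly_ring n :: 'k::field mpol ring) n id = {0}"
  unfolding presentation.J_def[OF presentation_poly_ring] by auto

lemma presentation_trunc_ring:
  "presentation (trunc_ring n k :: 'k::field mpol set ring) n
    ((+>\<^bsub>poly_ring n\<^esub>) (irrelevant_power n k)) (trunc_const n k)"
proof -
  interpret I: ideal "irrelevant_power n k :: 'k mpol set" "poly_ring n"
    unfolding irrelevant_power_eq by (rule ideal_low_ideal)
  show ?thesis
    unfolding trunc_ring_def
  proof (intro presentation.intro presentation_axioms.intro)
    show "cring (poly_ring n Quot (irrelevant_power n k :: 'k mpol set))"
      by (rule I.quotient_is_cring[OF cring_poly_ring])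
    show "(+>\<^bsub>poly_ring n\<^esub>) (irrelevant_power n k)
        \<in> Ring.ring_hom (poly_ring n) (poly_ring n Quot (irrelevant_power n k :: 'k mpol set))"
      by (rule I.rcos_ring_hom)
    show "(+>\<^bsub>poly_ring n\<^esub>) (irrelevant_power n k) ` carrier (poly_ring n)
        = carrier (poly_ring n Quot (irrelevant_power n k :: 'k mpol set))"
      by (auto simp: FactRing_def A_RCOSETS_def')
  qed (simp add: trunc_const_def)
qed

lemma J_trunc_ring:
  "presentation.J (trunc_ring n k) n ((+>\<^bsub>poly_ring n\<^esub>) (irrelevant_power n k))
    = (low_ideal n k :: 'k::field mpol set)"
proof -
  interpret I: ideal "low_ideal n k :: 'k mpol set" "poly_ring n" by (rule ideal_low_ideal)
  have zero: "\<zero>\<^bsub>trunc_ring n k\<^esub> = (low_ideal n k :: 'k mpol set)"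
    by (simp add: trunc_ring_def FactRing_def irrelevant_power_eq)
  have "low_ideal n k +>\<^bsub>poly_ring n\<^esub> f = low_ideal n k \<longleftrightarrow> f \<in> low_ideal n k"
    if "f \<in> carrier (poly_ring n)" for f :: "'k mpol"
  proof
    assume "low_ideal n k +>\<^bsub>poly_ring n\<^esub> f = low_ideal n k"
    then show "f \<in> low_ideal n k" using I.a_rcos_self[OF that] by simp
  qed (rule I.a_rcos_const)
  then have "f \<in> carrier (poly_ring n) \<and> low_ideal n k +>\<^bsub>poly_ring n\<^esub> f = low_ideal n k \<longleftrightarrow> f \<in> low_ideal n k"
    for f :: "'k mpol"
    using low_ideal_subset[of n k] by blast
  then show ?thesis
    unfolding presentation.J_def[OF presentation_trunc_ring]
    unfolding irrelevant_power_eq zero by (simp only: Collect_mem_eq)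
qed

subsection \<open>The submodule generated by the differentials of an ideal\<close>

text \<open>The summand dJ \<and> \<Omega>^(m-1) of \<open>rel_forms\<close> alone. For J = q^k it
  is the coordinate version of the submodule in the first formula.\<close>

inductive_set grad_forms :: "nat \<Rightarrow> 'k::field mpol set \<Rightarrow> nat \<Rightarrow> (nat set \<Rightarrow> 'k mpol) set" for n J m where
  zero: "0 \<in> grad_forms n J m"
| grad: "f \<in> J \<Longrightarrow> w \<in> forms n l \<Longrightarrow> m = Suc l \<Longrightarrow> wedge (grad n f) w \<in> grad_forms n J m"
| add: "v \<in> grad_forms n J m \<Longrightarrow> w \<in> grad_forms n J m \<Longrightarrow> v + w \<in> grad_forms n J m"

lemma grad_forms_rel_forms: "w \<in> grad_forms n J m \<Longrightarrow> w \<in> rel_forms n J m"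
  by (induction rule: grad_forms.induct) (auto intro: rel_forms.intros)

lemma grad_forms_smul:
  assumes "w \<in> grad_forms n J m" "g \<in> carrier (poly_ring n)"
  shows "smul g w \<in> grad_forms n J m"
  using assms(1)
proof induction
  case (grad f w l)
  then show ?case
    using assms(2) by (auto simp flip: wedge_smul intro!: grad_forms.grad fns_smul)
qed (auto simp: smul_add intro: grad_forms.intros)

lemma grad_forms_sum: "(\<And>x. x \<in> X \<Longrightarrow> f x \<in> grad_forms n J m) \<Longrightarrow> sum f X \<in> grad_forms n J m"
  by (induction X rule: infinite_finite_induct) (auto intro: grad_forms.intros)

lemma rel_forms_zero_ideal: "w \<in> rel_forms n {0} m \<Longrightarrow> w = 0"
  by (induction rule: rel_forms.induct) auto

text \<open>For a relation f w with f in q^(e+1) both bounds hold by degree, and for df \<and> w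
  they are \<open>low_wedge_grad\<close>. The second is the form of closedness on which
  \<open>ext_deriv_contract_closed\<close> relies.\<close>

lemma low_rel_forms:
  assumes "w \<in> rel_forms n (low_ideal n (Suc e)) m"
  shows "low e (w I)" and "low e (ext_deriv w I)"
proof -
  have "\<forall>I. low e (w I) \<and> low e (ext_deriv w I)"
    using assms
  proof induction
    case (smul f w)
    then have f: "low (Suc e) f" by (simp add: low_ideal_def)
    show ?case
      unfolding smul_def ext_deriv_def
      using low_mono[OF f, of e] by (intro allI conjI low_mult low_sum low_mult_right low_pd f) simp
  next
    case (grad f w l)
    then show ?case by (auto simp: low_ideal_def intro: low_wedge_grad)
  next
    case zero
    show ?case by (simp only: ext_deriv_zero) (simp add: fun_ops)
  next
    case (add v w)
    then show ?case by (simp only: ext_deriv_add) (simp add: fun_ops low_add)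
  qed
  then show "low e (w I)" "low e (ext_deriv w I)" by auto
qed

text \<open>Such a form already lies in the summand J \<Omega>^m for J = q^d, so modulo relations
  only coefficients of degree below d count.\<close>

lemma rel_forms_low:
  assumes w: "w \<in> forms n m" and low: "\<And>I. low d (w I)"
  shows "w \<in> rel_forms n (low_ideal n d) m"
proof -
  have "bump I (w I) \<in> rel_forms n (low_ideal n d) m" if I: "I \<in> ksubsets n m" for I
  proof -
    have "smul (w I) (bump I 1) \<in> rel_forms n (low_ideal n d) m"
      using fns_apply[OF w] low I by (intro rel_forms.smul fns_bump) (auto simp: low_ideal_def)
    then show ?thesis by simp
  qed
  then have "(\<Sum>I\<in>X. bump I (w I)) \<in> rel_forms n (low_ideal n d) m" if "X \<subseteq> ksubsets n m" for X
    using that by (induction X rule: infinite_finite_induct) (auto intro: rel_forms.intros)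
  then have "(\<Sum>I\<in>ksubsets n m. bump I (w I)) \<in> rel_forms n (low_ideal n d) m" by blast
  then show ?thesis
    using fns_eq_sum[OF w finite_ksubsets] by simp
qed

text \<open>The coefficients f_I of the contraction have degree e + 1 and so lie in q^(e+1), and the
  derivative is the sum of the products df_I \<and> dX_I.\<close>

lemma ext_deriv_contract_grad_forms:
  assumes "w \<in> forms n (Suc m)"
  shows "ext_deriv (contract n e w) \<in> grad_forms n (low_ideal n (Suc e)) (Suc m)"
proof -
  have c: "contract n e w \<in> forms n m" by (rule contract_forms[OF assms])
  show ?thesis
    unfolding ext_deriv_eq_sum[OF c]
    by (intro grad_forms_sum grad_forms.grad[OF _ fns_bump refl])
       (auto simp: low_ideal_def low_contract intro: fns_apply[OF c])
qed

section \<open>Linearity over the ground field and forms with prescribed coefficients\<close>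

lemma lookup_const_mult: "Poly_Mapping.lookup (poly_const x * p) a = x * Poly_Mapping.lookup p a"
  unfolding poly_const_def mult_map_scale_conv_mult[symmetric] by (simp add: map.rep_eq when_def)

lemma contract_add: "contract n e (v + w) = contract n e v + contract n e w"
  by (intro ext poly_mapping_eqI)
     (simp add: lookup_contract fun_ops lookup_add add_divide_distrib)

lemma contract_zero: "contract n e 0 = 0"
  by (intro ext poly_mapping_eqI) (simp add: lookup_contract fun_ops)

lemma contract_const_smul: "contract n e (smul (poly_const x) w) = smul (poly_const x) (contract n e w)"
  by (intro ext poly_mapping_eqI) (simp add: lookup_contract smul_def lookup_const_mult)

lemma ext_deriv_const_smul: "ext_deriv (smul (poly_const x) w) = smul (poly_const x) (ext_deriv w)"
  by (intro ext poly_mapping_eqI)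
     (simp add: lookup_ext_deriv smul_def lookup_const_mult sum_distrib_left mult_ac)

definition of_coords ::
    "(nat set \<times> (nat \<Rightarrow>\<^sub>0 nat)) set \<Rightarrow> (nat set \<times> (nat \<Rightarrow>\<^sub>0 nat) \<Rightarrow> 'k::field) \<Rightarrow> nat set \<Rightarrow> 'k mpol" where
  "of_coords T c I = (\<Sum>t\<in>T. if fst t = I then Poly_Mapping.single (snd t) (c t) else 0)"

context
  fixes T :: "(nat set \<times> (nat \<Rightarrow>\<^sub>0 nat)) set"
  assumes T: "finite T"
begin

lemma lookup_of_coords:
  "Poly_Mapping.lookup (of_coords T c I) a = (if (I, a) \<in> T then c (I, a) else 0)"
proof -
  have "Poly_Mapping.lookup (of_coords T c I) a = (\<Sum>t\<in>T. if t = (I, a) then c t else 0)"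
    unfolding of_coords_def lookup_sum
    by (intro sum.cong) (auto simp: lookup_single when_def)
  then show ?thesis by (simp add: sum.delta[OF T])
qed

lemma of_coords_add: "of_coords T (\<lambda>t. c t + c' t) = of_coords T c + of_coords T c'"
  by (intro ext poly_mapping_eqI) (simp add: lookup_of_coords fun_ops lookup_add)

lemma of_coords_zero: "of_coords T (\<lambda>_. 0) = 0"
  by (intro ext poly_mapping_eqI) (simp add: lookup_of_coords fun_ops)

lemma of_coords_smult: "of_coords T (\<lambda>t. x * c t) = smul (poly_const x) (of_coords T c)"
  by (intro ext poly_mapping_eqI) (simp add: lookup_of_coords smul_def lookup_const_mult)

lemma of_coords_forms:
  assumes "T \<subseteq> ksubsets n m \<times> {a. Poly_Mapping.keys a \<subseteq> {1..n}}"
  shows "of_coords T c \<in> forms n m"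
proof -
  have "of_coords T c I = 0" if "I \<notin> ksubsets n m" for I
    using assms that by (intro poly_mapping_eqI) (auto simp: lookup_of_coords)
  moreover have "of_coords T c I \<in> carrier (poly_ring n)" for I
    unfolding carrier_poly_ring using assms by (auto simp: in_keys_iff lookup_of_coords split: if_splits)
  ultimately show ?thesis by (simp add: fns_def)
qed

end

lemma fns_outside: "w \<in> fns n S \<Longrightarrow> i \<notin> S \<Longrightarrow> w i = 0"
  by (simp add: fns_def)

lemma lookup_outside:
  "f \<in> carrier (poly_ring n) \<Longrightarrow> \<not> Poly_Mapping.keys a \<subseteq> {1..n} \<Longrightarrow> Poly_Mapping.lookup f a = 0"
  by (auto simp: carrier_poly_ring in_keys_iff)

lemma homogeneous_iff: "homogeneous e f \<longleftrightarrow> (\<forall>a. mdeg a \<noteq> e \<longrightarrow> Poly_Mapping.lookup f a = 0)"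
  by (auto simp: homogeneous_def mdeg_def in_keys_iff)

definition homogeneous_forms :: "nat \<Rightarrow> nat \<Rightarrow> nat \<Rightarrow> (nat set \<Rightarrow> 'k::field mpol) set" where
  "homogeneous_forms n m e = {w \<in> forms n m. \<forall>I. homogeneous e (w I)}"

text \<open>
  Homogeneous elements of the submodule are closed in the relevant degree, so they are determined
  by their leading coefficients, which are arbitrary.
\<close>

lemma bij_betw_leading:
  assumes inv: "\<And>j. 0 < j \<Longrightarrow> j \<le> Suc e \<Longrightarrow> of_nat j \<noteq> (0 :: 'k::field)"
  shows "bij_betw (\<lambda>c. ext_deriv (contract n e (of_coords (leading_idx n (Suc m) e) c)))
    {c. \<forall>t. t \<notin> leading_idx n (Suc m) e \<longrightarrow> c t = (0 :: 'k)}
    (grad_forms n (low_ideal n (Suc e)) (Suc m) \<inter> homogeneous_forms n (Suc m) e)"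
    (is "bij_betw ?D ?C ?X")
proof -
  let ?T = "leading_idx n (Suc m) e"
  have fin: "finite ?T" by (rule finite_leading_idx)
  have forms: "of_coords ?T c \<in> forms n (Suc m)" for c :: "_ \<Rightarrow> 'k"
    by (rule of_coords_forms[OF fin]) (auto simp: leading_idx_def mons_def)
  have lead: "Poly_Mapping.lookup (?D c I) a = c (I, a)" if "(I, a) \<in> ?T" for c :: "_ \<Rightarrow> 'k" and I a
  proof -
    have "Poly_Mapping.lookup (?D c I) a = Poly_Mapping.lookup (of_coords ?T c I) a"
      using that by (intro ext_deriv_contract_leading[OF inv, where m = m]) (auto simp: leading_idx_def)
    then show ?thesis using that by (simp add: lookup_of_coords[OF fin])
  qed
  have X: "ext_deriv (contract n e w) \<in> ?X" if "w \<in> forms n (Suc m)" for w :: "_ \<Rightarrow> 'k mpol"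
  proof -
    have "homogeneous e (ext_deriv (contract n e w) I)" for I
      unfolding homogeneous_iff
      by (intro allI impI lookup_ext_deriv_contract_outside) (auto simp: mons_def)
    then show ?thesis
      using that ext_deriv_contract_grad_forms[OF that]
      by (auto simp: homogeneous_forms_def intro: ext_deriv_forms contract_forms)
  qed
  show ?thesis
    unfolding bij_betw_def
  proof (intro conjI equalityI)
    show "inj_on ?D ?C"
    proof (intro inj_onI ext)
      fix c c' :: "_ \<Rightarrow> 'k" and t assume cc: "c \<in> ?C" "c' \<in> ?C" "?D c = ?D c'"
      show "c t = c' t"
      proof (cases "t \<in> ?T")
        case True
        then show ?thesis
          using lead[of "fst t" "snd t" c] lead[of "fst t" "snd t" c'] cc(3) by simp
      next
        case False
        then show ?thesis using cc(1,2) by (cases t) simp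
      qed
    qed
    show "?D ` ?C \<subseteq> ?X" using X[OF forms] by auto
    show "?X \<subseteq> ?D ` ?C"
    proof
      fix w assume w: "w \<in> ?X"
      then have wf: "w \<in> forms n (Suc m)" and hom: "\<And>I. homogeneous e (w I)"
        and rel: "w \<in> rel_forms n (low_ideal n (Suc e)) (Suc m)"
        by (auto simp: homogeneous_forms_def intro: grad_forms_rel_forms)
      let ?c = "\<lambda>(I, a). if (I, a) \<in> ?T then Poly_Mapping.lookup (w I) a else 0"
      \<comment> \<open>Replacing the non-leading coefficients of \<open>w\<close> by 0 does not
        change what \<open>contract\<close> reads.\<close>
      have "contract n e (of_coords ?T ?c) = contract n e w"
      proof (rule contract_cong)
        fix I a assume a: "a \<in> mons {1..n} e" "leading I a"
        show "Poly_Mapping.lookup (of_coords ?T ?c I) a = Poly_Mapping.lookup (w I) a"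
        proof (cases "I \<in> ksubsets n (Suc m)")
          case True
          then have "(I, a) \<in> ?T" using a by (simp add: leading_idx_def)
          then show ?thesis by (simp add: lookup_of_coords[OF fin])
        next
          case False
          then show ?thesis by (simp add: fns_outside[OF wf] fns_outside[OF forms])
        qed
      qed
      \<comment> \<open>Outside degree e both sides vanish, since \<open>w\<close> is homogeneous.
        In degree e the form \<open>w\<close> is closed as far as the homotopy asks, being a
        relation.\<close>
      moreover have "ext_deriv (contract n e w) = w"
      proof (intro ext poly_mapping_eqI)
        fix I a
        have dc: "ext_deriv (contract n e w) \<in> forms n (Suc m)"
          by (intro ext_deriv_forms contract_forms wf)
        consider "I \<notin> ksubsets n (Suc m)" | "a \<notin> mons {1..n} e" | "I \<in> ksubsets n (Suc m)" "a \<in> mons {1..n} e"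
          by blast
        then show "Poly_Mapping.lookup (ext_deriv (contract n e w) I) a = Poly_Mapping.lookup (w I) a"
        proof cases
          case 1
          then show ?thesis by (simp add: fns_outside[OF wf] fns_outside[OF dc])
        next
          case 2
          then have "\<not> Poly_Mapping.keys a \<subseteq> {1..n} \<or> mdeg a \<noteq> e" by (auto simp: mons_def)
          then have "Poly_Mapping.lookup (w I) a = 0"
            using lookup_outside[OF fns_apply[OF wf]] hom[of I] by (auto simp: homogeneous_iff)
          then show ?thesis by (simp add: lookup_ext_deriv_contract_outside[OF 2])
        next
          case 3
          with inv show ?thesis
            by (intro ext_deriv_contract_closed low_rel_forms(2)[OF rel])
        qed
      qed
      ultimately have "w = ?D ?c" by simp
      moreover have "?c \<in> ?C" by auto
      ultimately show "w \<in> ?D ` ?C" by (rule image_eqI)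
    qed
  qed
qed

text \<open>Below degree e every relation has zero coefficients. In degree e it is the derivative of
  its contraction, which depends only on the leading coefficients. Applied to the difference of two
  forms supported on \<open>residual_idx\<close>, this gives the independence of the
  classes.\<close>

lemma residual_idx_unique:
  assumes inv: "\<And>j. 0 < j \<Longrightarrow> j \<le> Suc e \<Longrightarrow> of_nat j \<noteq> (0 :: 'k::field)"
    and v: "v \<in> rel_forms n (low_ideal n (Suc e)) (Suc m)"
    and lead: "\<And>I a. a \<in> mons {1..n} e \<Longrightarrow> leading I a \<Longrightarrow> Poly_Mapping.lookup (v I) a = (0 :: 'k)"
    and t: "(I, a) \<in> residual_idx n (Suc m) e"
  shows "Poly_Mapping.lookup (v I) a = 0"
proof (cases "mdeg a < e")
  case True
  then show ?thesis using low_rel_forms(1)[OF v, of I] by (simp add: low_def)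
next
  case False
  then have a: "I \<in> ksubsets n (Suc m)" "a \<in> mons {1..n} e"
    using t by (auto simp: residual_idx_def nonleading_def ksubsets_def mons_def)
  have "contract n e v = contract n e 0"
    using lead by (intro contract_cong) (simp add: fun_ops)
  then have "Poly_Mapping.lookup (ext_deriv (contract n e v) I) a = 0"
    by (simp add: contract_zero fun_ops)
  moreover have "Poly_Mapping.lookup (ext_deriv (contract n e v) I) a = Poly_Mapping.lookup (v I) a"
    using inv a by (intro ext_deriv_contract_closed low_rel_forms(2)[OF v])
  ultimately show ?thesis by simp
qed

text \<open>The derivative of the contraction is a relation that agrees with \<open>w\<close> at the
  leading coefficients of degree e; subtracting it clears them. Terms of degree above e are
  relations by \<open>rel_forms_low\<close>, and what is left sits on
  \<open>residual_idx\<close>.\<close>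

lemma residual_idx_exhaustive:
  assumes inv: "\<And>j. 0 < j \<Longrightarrow> j \<le> Suc e \<Longrightarrow> of_nat j \<noteq> (0 :: 'k::field)"
    and w: "w \<in> forms n (Suc m)"
  obtains c where "\<forall>t. t \<notin> residual_idx n (Suc m) e \<longrightarrow> c t = (0 :: 'k)"
    and "w - of_coords (residual_idx n (Suc m) e) c \<in> rel_forms n (low_ideal n (Suc e)) (Suc m)"
proof -
  let ?T = "residual_idx n (Suc m) e"
  let ?dc = "ext_deriv (contract n e w)"
  define w' where "w' = w - ?dc"
  define c where "c = (\<lambda>(I, a). if (I, a) \<in> ?T then Poly_Mapping.lookup (w' I) a else 0)"
  have fin: "finite ?T" by (rule finite_residual_idx)
  have forms: "of_coords ?T c \<in> forms n (Suc m)"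
    by (rule of_coords_forms[OF fin])
       (auto simp: residual_idx_def nonleading_def ksubsets_def mons_def)
  have dc: "?dc \<in> rel_forms n (low_ideal n (Suc e)) (Suc m)"
    by (intro grad_forms_rel_forms ext_deriv_contract_grad_forms w)
  have w': "w' \<in> forms n (Suc m)"
    unfolding w'_def by (intro fns_diff w ext_deriv_forms contract_forms)
  have "w' - of_coords ?T c \<in> rel_forms n (low_ideal n (Suc e)) (Suc m)"
  proof (rule rel_forms_low)
    show "w' - of_coords ?T c \<in> forms n (Suc m)" by (intro fns_diff w' forms)
    fix I
    have "Poly_Mapping.lookup (w' I) a = Poly_Mapping.lookup (of_coords ?T c I) a" if a: "mdeg a < Suc e" for a
    proof -
      \<comment> \<open>A coefficient of degree at most e is zero for reasons of support, or
        recorded in \<open>c\<close>, or leading of degree e and hence cleared from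
        \<open>w'\<close>.\<close>
      consider "I \<notin> ksubsets n (Suc m)" | "\<not> Poly_Mapping.keys a \<subseteq> {1..n}" | "(I, a) \<in> ?T"
        | "I \<in> ksubsets n (Suc m)" "a \<in> mons {1..n} e" "leading I a"
        using a by (auto simp: residual_idx_def nonleading_def ksubsets_def mons_def less_Suc_eq)
      then show ?thesis
      proof cases
        case 1
        then show ?thesis by (simp add: fns_outside[OF w'] fns_outside[OF forms])
      next
        case 2
        then show ?thesis by (simp add: lookup_outside[OF fns_apply[OF w']] lookup_outside[OF fns_apply[OF forms]])
      next
        case 3
        then show ?thesis by (simp add: lookup_of_coords[OF fin] c_def)
      next
        case 4
        then have "(I, a) \<notin> ?T" by (auto simp: residual_idx_def nonleading_def mons_def)
        moreover have "Poly_Mapping.lookup (?dc I) a = Poly_Mapping.lookup (w I) a"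
          using inv 4 by (intro ext_deriv_contract_leading)
        ultimately show ?thesis
          by (simp add: lookup_of_coords[OF fin] w'_def fun_ops lookup_minus)
      qed
    qed
    then show "low (Suc e) ((w' - of_coords ?T c) I)"
      by (simp add: low_def fun_ops lookup_minus)
  qed
  from rel_forms.add[OF this dc] have "w - of_coords ?T c \<in> rel_forms n (low_ideal n (Suc e)) (Suc m)"
    by (simp add: w'_def)
  then show ?thesis
    by (rule that[rotated]) (auto simp: c_def)
qed

subsection \<open>The dimension formulas\<close>

context presentation
begin

lemma evalm_eq_iff:
  assumes v: "v \<in> forms n m" and w: "w \<in> forms n m"
  shows "evalm m v = evalm m w \<longleftrightarrow> v - w \<in> rel_forms n J m"
proof -
  interpret O: Module.module B "Omega m" by (rule module_Omega)
  have vw: "v - w \<in> forms n m" by (intro fns_diff v w)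
  have "evalm m v = evalm m (v - w) \<oplus>\<^bsub>Omega m\<^esub> evalm m w"
    using evalm_add[OF vw w] by simp
  moreover have "evalm m (v - w) \<oplus>\<^bsub>Omega m\<^esub> evalm m w = evalm m w \<longleftrightarrow> evalm m (v - w) = \<zero>\<^bsub>Omega m\<^esub>"
    using O.M.add.r_cancel_one[OF evalm_closed[OF w] evalm_closed[OF vw]] by simp
  ultimately show ?thesis
    by (simp add: evalm_eq_zero_iff[OF vw])
qed

lemma evalm_const_smul:
  "w \<in> forms n m \<Longrightarrow> evalm m (smul (poly_const c) w) = \<phi> c \<odot>\<^bsub>Omega m\<^esub> evalm m w"
  by (simp add: evalm_smul phi_eq)

lemma module_restrict_Omega: "Module.module class_ring (restrict_scalars \<phi> (Omega m))"
proof (rule module_restrict_scalars[OF module_Omega])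
  show "cring (class_ring :: 'k ring)"
    using class_field[where 'a='k] by (simp add: field_def domain_def)
  show "\<phi> \<in> Ring.ring_hom class_ring B"
  proof (rule ring_hom_memI)
    fix x y :: 'k
    have "poly_const (x * y) = poly_const x * (poly_const y :: 'k mpol)"
      "poly_const (x + y) = poly_const x + (poly_const y :: 'k mpol)"
      by (simp_all add: poly_const_def mult_single single_add)
    then show "\<phi> (x \<otimes>\<^bsub>class_ring\<^esub> y) = \<phi> x \<otimes> \<phi> y" "\<phi> (x \<oplus>\<^bsub>class_ring\<^esub> y) = \<phi> x \<oplus> \<phi> y"
      by (simp_all add: phi_eq pi_mult pi_add class_ring_simps)
  next
    have "poly_const 1 = (1 :: 'k mpol)" by (simp add: poly_const_def)
    then show "\<phi> \<one>\<^bsub>class_ring\<^esub> = \<one>"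
      using pi_one by (simp add: phi_eq class_ring_simps)
  qed simp
qed

text \<open>The classes of the monomial forms in \<open>residual_idx\<close> are a basis:
  \<open>residual_idx_unique\<close> gives independence and \<open>residual_idx_exhaustive\<close>
  generation.\<close>

lemma has_dimension_Omega:
  assumes J: "J = low_ideal n (Suc e)"
    and inv: "\<And>j. 0 < j \<Longrightarrow> j \<le> Suc e \<Longrightarrow> of_nat j \<noteq> (0 :: 'k)"
  shows "has_dimension (class_ring :: 'k ring) (restrict_scalars \<phi> (Omega (Suc m)))
    (int (card (residual_idx n (Suc m) e)))"
proof (rule has_dimension_coordinates[where P = "\<lambda>c. evalm (Suc m) (of_coords (residual_idx n (Suc m) e) c)"])
  let ?T = "residual_idx n (Suc m) e"
  let ?C = "{c. \<forall>t. t \<notin> ?T \<longrightarrow> c t = (0 :: 'k)}"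
  show fin: "finite ?T" by (rule finite_residual_idx)
  have forms: "of_coords ?T c \<in> forms n (Suc m)" for c :: "_ \<Rightarrow> 'k"
    by (rule of_coords_forms[OF fin])
       (auto simp: residual_idx_def nonleading_def ksubsets_def mons_def)
  show "bij_betw (\<lambda>c. evalm (Suc m) (of_coords ?T c)) ?C (carrier (restrict_scalars \<phi> (Omega (Suc m))))"
    unfolding bij_betw_def
  proof (intro conjI equalityI)
    show "inj_on (\<lambda>c. evalm (Suc m) (of_coords ?T c)) ?C"
    proof (intro inj_onI ext)
      fix c c' :: "_ \<Rightarrow> 'k" and t :: "nat set \<times> (nat \<Rightarrow>\<^sub>0 nat)"
      assume cc: "c \<in> ?C" "c' \<in> ?C"
        and eq: "evalm (Suc m) (of_coords ?T c) = evalm (Suc m) (of_coords ?T c')"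
      obtain I a where t: "t = (I, a)" by (cases t)
      let ?v = "of_coords ?T c - of_coords ?T c'"
      have v: "?v \<in> rel_forms n (low_ideal n (Suc e)) (Suc m)"
        using eq by (simp add: evalm_eq_iff[OF forms forms] J)
      have look: "Poly_Mapping.lookup (?v I) a = (if (I, a) \<in> ?T then c (I, a) - c' (I, a) else 0)" for I a
        by (simp add: lookup_of_coords[OF fin] fun_ops lookup_minus)
      show "c t = c' t"
      proof (cases "(I, a) \<in> ?T")
        case True
        have "Poly_Mapping.lookup (?v I) a = 0"
          using inv v
        proof (rule residual_idx_unique)
          fix I a assume "a \<in> mons {1..n} e" "leading I a"
          then have "(I, a) \<notin> ?T" by (auto simp: residual_idx_def nonleading_def mons_def)
          then show "Poly_Mapping.lookup (?v I) a = 0" by (simp add: look)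
        qed (use True in auto)
        then show ?thesis using True by (simp add: look t)
      next
        case False
        then show ?thesis using cc t by auto
      qed
    qed
    show "(\<lambda>c. evalm (Suc m) (of_coords ?T c)) ` ?C \<subseteq> carrier (restrict_scalars \<phi> (Omega (Suc m)))"
      using evalm_closed[OF forms] by (auto simp: restrict_scalars_def)
    show "carrier (restrict_scalars \<phi> (Omega (Suc m))) \<subseteq> (\<lambda>c. evalm (Suc m) (of_coords ?T c)) ` ?C"
    proof
      fix x assume "x \<in> carrier (restrict_scalars \<phi> (Omega (Suc m)))"
      then obtain w where w: "w \<in> forms n (Suc m)" and x: "evalm (Suc m) w = x"
        using evalm_surj[of x "Suc m"] by (auto simp: restrict_scalars_def)
      obtain c where c: "\<forall>t. t \<notin> ?T \<longrightarrow> c t = (0 :: 'k)"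
        and "w - of_coords ?T c \<in> rel_forms n (low_ideal n (Suc e)) (Suc m)"
        using inv w by (rule residual_idx_exhaustive)
      then have "x = evalm (Suc m) (of_coords ?T c)"
        using evalm_eq_iff[OF w forms] x by (simp add: J)
      then show "x \<in> (\<lambda>c. evalm (Suc m) (of_coords ?T c)) ` ?C"
        using c by blast
    qed
  qed
  show "evalm (Suc m) (of_coords ?T (\<lambda>_. 0)) = \<zero>\<^bsub>restrict_scalars \<phi> (Omega (Suc m))\<^esub>"
    by (simp add: of_coords_zero[OF fin] evalm_zero restrict_scalars_def)
  show "evalm (Suc m) (of_coords ?T (\<lambda>t. c t + c' t))
      = evalm (Suc m) (of_coords ?T c) \<oplus>\<^bsub>restrict_scalars \<phi> (Omega (Suc m))\<^esub> evalm (Suc m) (of_coords ?T c')"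
    for c c' :: "_ \<Rightarrow> 'k"
    by (simp add: of_coords_add[OF fin] evalm_add[OF forms forms] restrict_scalars_def)
  show "evalm (Suc m) (of_coords ?T (\<lambda>t. x * c t))
      = x \<odot>\<^bsub>restrict_scalars \<phi> (Omega (Suc m))\<^esub> evalm (Suc m) (of_coords ?T c)"
    for x and c :: "_ \<Rightarrow> 'k"
    by (simp add: of_coords_smult[OF fin] evalm_const_smul[OF forms] restrict_scalars_def)
qed

end

section \<open>The component of dq^k \<and> \<Omega>^(m-1) for the polynomial ring\<close>

context
  fixes n :: nat and ground :: "'k::field itself"
begin

interpretation presentation "poly_ring n :: 'k::field mpol ring" n id poly_const
  by (rule presentation_poly_ring)

text \<open>The identity presentation has kernel 0, so 0 is the only relation and forms of the
  polynomial ring have unique coordinates.\<close>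

lemma inj_on_evalm: "inj_on (evalm m) (forms n m)"
proof (rule inj_onI)
  fix v w :: "nat set \<Rightarrow> 'k mpol"
  assume "v \<in> forms n m" "w \<in> forms n m" "evalm m v = evalm m w"
  then have "v - w \<in> rel_forms n {0} m"
    by (simp add: evalm_eq_iff J_poly_ring)
  from rel_forms_zero_ideal[OF this] show "v = w" by simp
qed

text \<open>The claim speaks of products with arbitrary forms because \<open>grad_forms\<close>
  absorbs scalars into the second factor. In this shape it is stable under sums and scalars and
  passes from the generators df to their span.\<close>

lemma d_irrelevant_power_lift:
  assumes "u \<in> d_irrelevant_power n k"
  shows "\<exists>v\<in>covecs n. eval1 v = u
    \<and> (\<forall>l. \<forall>w\<in>forms n l. wedge v w \<in> grad_forms n (low_ideal n k :: 'k mpol set) (Suc l))"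
proof -
  define lifts where "lifts u v \<longleftrightarrow> v \<in> covecs n \<and> eval1 v = u
    \<and> (\<forall>l. \<forall>w\<in>forms n l. wedge v w \<in> grad_forms n (low_ideal n k :: 'k mpol set) (Suc l))" for u v
  have "\<exists>v. lifts u v"
  proof (rule module.span_induct[OF module_kaehler assms[unfolded d_irrelevant_power_def irrelevant_power_eq]])
    show "d ` low_ideal n k \<subseteq> carrier Om"
      using low_ideal_subset d_closed by blast
    show "\<exists>v. lifts \<zero>\<^bsub>Om\<^esub> v"
      by (intro exI[of _ 0]) (auto simp: lifts_def eval1_zero intro: grad_forms.zero)
  next
    fix x assume "x \<in> d ` (low_ideal n k :: 'k mpol set)"
    then obtain f :: "'k mpol" where f: "f \<in> low_ideal n k" "x = d f" by blast
    then have "f \<in> A" by (simp add: low_ideal_def)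
    then show "\<exists>v. lifts x v"
      using f d_pi[of f]
      by (intro exI[of _ "grad n f"]) (auto simp: lifts_def intro: grad_covecs grad_forms.grad)
  next
    fix x y assume "\<exists>v. lifts x v" "\<exists>v. lifts y v"
    then obtain v v' where "lifts x v" "lifts y v'" by blast
    then show "\<exists>v. lifts (x \<oplus>\<^bsub>Om\<^esub> y) v"
      by (intro exI[of _ "v + v'"])
         (auto simp: lifts_def eval1_add wedge_add_left intro: fns_add grad_forms.add)
  next
    fix a x assume a: "a \<in> A" and "\<exists>v. lifts x v"
    then obtain v where "lifts x v" by blast
    with a show "\<exists>v. lifts (a \<odot>\<^bsub>Om\<^esub> x) v"
      by (intro exI[of _ "smul a v"])
         (auto simp: lifts_def eval1_smul wedge_smul_left intro: fns_smul grad_forms_smul)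
  qed
  then show ?thesis by (auto simp: lifts_def)
qed

text \<open>In one direction a factor from dq^k is lifted by \<open>d_irrelevant_power_lift\<close>;
  in the other, each df \<and> w is itself one of the generators of the span.\<close>

lemma d_irrelevant_power_wedge_eq:
  "d_irrelevant_power_wedge n k (Suc l) = evalm (Suc l) ` grad_forms n (low_ideal n k :: 'k mpol set) (Suc l)"
proof -
  interpret E: exterior "poly_ring n :: 'k mpol ring" Om by (rule exterior_kaehler)
  let ?G = "{wedge_left (poly_ring n :: 'k mpol ring) Om l u w | u w.
    u \<in> d_irrelevant_power n k \<and> w \<in> carrier (Omega l)}"
  let ?N = "grad_forms n (low_ideal n k :: 'k mpol set) (Suc l)"
  have span: "d_irrelevant_power_wedge n k (Suc l) = LinearCombinations.module.span (poly_ring n) (Omega (Suc l)) ?G"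
    by (simp add: d_irrelevant_power_wedge_def)
  have N: "w \<in> forms n (Suc l)" if "w \<in> ?N" for w
    using rel_forms_subset[OF low_ideal_subset grad_forms_rel_forms[OF that]] .
  have gen: "x \<in> evalm (Suc l) ` ?N" if x_G: "x \<in> ?G" for x
  proof -
    obtain u y where x: "x = wedge_left (poly_ring n :: 'k mpol ring) Om l u y"
      and u: "u \<in> d_irrelevant_power n k" and y: "y \<in> carrier (Omega l)"
      using x_G by blast
    obtain v where v: "v \<in> covecs n" "eval1 v = u"
      "\<And>w. w \<in> forms n l \<Longrightarrow> wedge v w \<in> grad_forms n (low_ideal n k :: 'k mpol set) (Suc l)"
      using d_irrelevant_power_lift[OF u] by metis
    obtain w where w: "w \<in> forms n l" "evalm l w = y" using evalm_surj[OF y] by blast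
    have "x = evalm (Suc l) (wedge v w)"
      unfolding evalm_wedge[OF v(1) w(1)] v(2) w(2) x ..
    then show ?thesis using v(3)[OF w(1)] by blast
  qed
  have G: "?G \<subseteq> carrier (Omega (Suc l))"
  proof
    fix x assume "x \<in> ?G"
    from gen[OF this] show "x \<in> carrier (Omega (Suc l))" using evalm_closed[OF N] by blast
  qed
  have sub: "submodule (poly_ring n) (LinearCombinations.module.span (poly_ring n) (Omega (Suc l)) ?G) (Omega (Suc l))"
    by (rule LinearCombinations.module.span_is_submodule[OF module_Omega G])
  show ?thesis
    unfolding span
  proof (intro equalityI subsetI)
    fix x assume "x \<in> LinearCombinations.module.span (poly_ring n) (Omega (Suc l)) ?G"
    from this G show "x \<in> evalm (Suc l) ` ?N"
    proof (rule module.span_induct[OF module_Omega])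
      show "\<zero>\<^bsub>Omega (Suc l)\<^esub> \<in> evalm (Suc l) ` ?N"
        using evalm_zero by (intro image_eqI[OF _ grad_forms.zero]) simp
      show "\<And>x y. x \<in> evalm (Suc l) ` ?N \<Longrightarrow> y \<in> evalm (Suc l) ` ?N \<Longrightarrow> x \<oplus>\<^bsub>Omega (Suc l)\<^esub> y \<in> evalm (Suc l) ` ?N"
        using evalm_add[OF N N] grad_forms.add by (auto intro!: image_eqI)
      show "\<And>a x. a \<in> A \<Longrightarrow> x \<in> evalm (Suc l) ` ?N \<Longrightarrow> a \<odot>\<^bsub>Omega (Suc l)\<^esub> x \<in> evalm (Suc l) ` ?N"
        using evalm_smul[OF _ N] grad_forms_smul by (auto intro!: image_eqI)
    qed (rule gen)
  next
    fix x assume "x \<in> evalm (Suc l) ` ?N"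
    then obtain w where w: "w \<in> ?N" and x: "x = evalm (Suc l) w" by blast
    show "x \<in> LinearCombinations.module.span (poly_ring n) (Omega (Suc l)) ?G"
      unfolding x using w
    proof induction
      case zero
      show ?case unfolding evalm_zero by (rule submodule.zero_closed[OF sub])
    next
      case (grad f w l')
      then have f: "f \<in> A" and l': "l' = l" by (auto simp: low_ideal_def)
      have "d f \<in> d_irrelevant_power n k"
        unfolding d_irrelevant_power_def irrelevant_power_eq
        using grad(1) low_ideal_subset d_closed
        by (intro LinearCombinations.module.in_own_span[OF module_kaehler, THEN subsetD]) blast+
      moreover have "evalm (Suc l) (wedge (grad n f) w) = wedge_left (poly_ring n) Om l (d f) (evalm l w)"
        using evalm_wedge[OF grad_covecs[OF f] grad(2)] d_pi[OF f] l' by simp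
      moreover have "evalm l w \<in> carrier (Omega l)" using grad(2) l' by (intro evalm_closed) simp
      ultimately have "evalm (Suc l) (wedge (grad n f) w) \<in> ?G" by blast
      then show ?case
        using LinearCombinations.module.in_own_span[OF module_Omega G] by blast
    next
      case (add v w)
      then show ?case
        unfolding evalm_add[OF N[OF add(1)] N[OF add(2)]] by (intro submodule.m_closed[OF sub])
    qed
  qed
qed

text \<open>Each dX_i has degree 1, so an m-form has degree m + e exactly if its coefficients have
  degree e.\<close>

lemma forms_component_eq:
  "forms_component n m (m + e) = evalm m ` (homogeneous_forms n m e :: (nat set \<Rightarrow> 'k mpol) set)"
proof -
  let ?V = "restrict_scalars poly_const (Omega m)"
  let ?G = "{f \<odot>\<^bsub>Omega m\<^esub> wedge_list (poly_ring n) Om (map (d \<circ> poly_var) is)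
        | f l is. f \<in> carrier (poly_ring n) \<and> homogeneous l f \<and> l + m = m + e \<and>
            length is = m \<and> set is \<subseteq> {1..n} \<and> sorted_wrt (<) is}"
  let ?N = "homogeneous_forms n m e :: (nat set \<Rightarrow> 'k mpol) set"
  have span: "forms_component n m (m + e) = LinearCombinations.module.span class_ring ?V ?G"
    by (simp add: forms_component_def)
  have N: "w \<in> forms n m" if "w \<in> ?N" for w
    using that by (simp add: homogeneous_forms_def)
  have V: "carrier ?V = carrier (Omega m)" "zero ?V = zero (Omega m)" "add ?V = add (Omega m)"
    "smult ?V = (\<lambda>c x. poly_const c \<odot>\<^bsub>Omega m\<^esub> x)"
    by (simp_all add: restrict_scalars_def)
  \<comment> \<open>Increasing lists of length m are the enumerations of the subsets of size
    m.\<close>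
  have gen: "?G = {evalm m (bump I f) | I f. I \<in> ksubsets n m \<and> f \<in> A \<and> homogeneous e f}"
  proof -
    have 1: "f \<odot>\<^bsub>Omega m\<^esub> wedge_list (poly_ring n) Om (map (d \<circ> poly_var) is) = evalm m (bump (set is) f)"
      if "f \<in> A" "length is = m" "set is \<subseteq> {1..n}" "sorted_wrt (<) is" for f and "is" :: "nat list"
    proof -
      have "distinct is" "sorted is" using that(4) by (simp_all add: strict_sorted_iff)
      then have "sorted_list_of_set (set is) = is" "set is \<in> ksubsets n m"
        using that by (simp_all add: sorted_list_of_set.idem_if_sorted_distinct ksubsets_def distinct_card)
      moreover have "d \<circ> poly_var = dX" by (auto simp: dX_def)
      ultimately show ?thesis using that(1) by (simp add: evalm_bump dXs_def)
    qed
    have 2: "set is \<in> ksubsets n m"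
      if "length is = m" "set is \<subseteq> {1..n}" "sorted_wrt (<) is" for "is" :: "nat list"
      using that by (simp add: ksubsets_def strict_sorted_iff distinct_card)
    have 3: "\<exists>is. I = set is \<and> length is = m \<and> set is \<subseteq> {1..n} \<and> sorted_wrt (<) is"
      if "I \<in> ksubsets n m" for I
      using that ksubsets_finite[OF that]
      by (intro exI[of _ "sorted_list_of_set I"]) (simp add: ksubsets_def)
    show ?thesis
    proof (intro equalityI subsetI)
      fix x assume "x \<in> ?G"
      then obtain f l "is" where "x = f \<odot>\<^bsub>Omega m\<^esub> wedge_list (poly_ring n) Om (map (d \<circ> poly_var) is)"
        "f \<in> A" "homogeneous l f" "l + m = m + e" "length is = m" "set is \<subseteq> {1..n}" "sorted_wrt (<) is"
        by blast
      moreover from this have "l = e" by simp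
      ultimately show "x \<in> {evalm m (bump I f) | I f. I \<in> ksubsets n m \<and> f \<in> A \<and> homogeneous e f}"
        using 1[of f "is"] 2[of "is"] by blast
    next
      fix x assume "x \<in> {evalm m (bump I f) | I f. I \<in> ksubsets n m \<and> f \<in> A \<and> homogeneous e f}"
      then obtain I f where x: "x = evalm m (bump I f)" "I \<in> ksubsets n m" "f \<in> A" "homogeneous e f" by blast
      obtain "is" where "is": "I = set is" "length is = m" "set is \<subseteq> {1..n}" "sorted_wrt (<) is"
        using 3[OF x(2)] by blast
      then have "x = f \<odot>\<^bsub>Omega m\<^esub> wedge_list (poly_ring n) Om (map (d \<circ> poly_var) is)"
        using 1[of f "is"] x by simp
      then show "x \<in> ?G" using x(3,4) "is"(2-4) add.commute[of e m] by blast
    qed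
  qed
  have G: "?G \<subseteq> carrier ?V"
  proof
    fix x assume "x \<in> ?G"
    then obtain I f where x: "x = evalm m (bump I f)" "I \<in> ksubsets n m" "f \<in> A"
      unfolding gen by blast
    show "x \<in> carrier ?V"
      unfolding x(1) V(1) by (intro evalm_closed fns_bump x)
  qed
  have sub: "submodule class_ring (LinearCombinations.module.span class_ring ?V ?G) ?V"
    by (rule LinearCombinations.module.span_is_submodule[OF module_restrict_Omega G])
  show ?thesis
    unfolding span
  proof (intro equalityI subsetI)
    fix x assume "x \<in> LinearCombinations.module.span class_ring ?V ?G"
    from this G show "x \<in> evalm m ` ?N"
    proof (rule module.span_induct[OF module_restrict_Omega])
      show "\<zero>\<^bsub>?V\<^esub> \<in> evalm m ` ?N"
        unfolding V evalm_zero[symmetric]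
        by (intro imageI, simp add: homogeneous_forms_def) (simp add: homogeneous_def fun_ops)
    next
      fix x assume "x \<in> ?G"
      then obtain I f where x: "x = evalm m (bump I f)" "I \<in> ksubsets n m" "f \<in> A" "homogeneous e f"
        unfolding gen by blast
      have "homogeneous e (bump I f K)" for K
        using x(4) by (simp add: bump_def homogeneous_def)
      then have "bump I f \<in> ?N"
        using fns_bump[OF x(3,2)] by (simp add: homogeneous_forms_def)
      then show "x \<in> evalm m ` ?N" using x(1) by blast
    next
      fix x y assume "x \<in> evalm m ` ?N" "y \<in> evalm m ` ?N"
      then obtain v w where vw: "v \<in> ?N" "w \<in> ?N" "x = evalm m v" "y = evalm m w" by blast
      have "homogeneous e ((v + w) I)" for I
        using vw(1,2) by (simp add: homogeneous_forms_def homogeneous_iff fun_ops lookup_add)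
      then have "v + w \<in> ?N"
        using fns_add[OF vw(1,2)[THEN N]] by (simp add: homogeneous_forms_def)
      moreover have "x \<oplus>\<^bsub>?V\<^esub> y = evalm m (v + w)" using vw by (simp add: V evalm_add N)
      ultimately show "x \<oplus>\<^bsub>?V\<^esub> y \<in> evalm m ` ?N" by blast
    next
      fix c :: 'k and x assume "x \<in> evalm m ` ?N"
      then obtain w where w: "w \<in> ?N" "x = evalm m w" by blast
      have "homogeneous e (smul (poly_const c) w I)" for I
        using w(1) by (simp add: homogeneous_forms_def homogeneous_iff smul_def lookup_const_mult)
      then have "smul (poly_const c) w \<in> ?N"
        using fns_smul[OF poly_ring_const N[OF w(1)]] by (simp add: homogeneous_forms_def)
      moreover have "c \<odot>\<^bsub>?V\<^esub> x = evalm m (smul (poly_const c) w)"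
        using w by (simp add: V evalm_const_smul N)
      ultimately show "c \<odot>\<^bsub>?V\<^esub> x \<in> evalm m ` ?N" by blast
    qed
  next
    fix x assume "x \<in> evalm m ` ?N"
    then obtain w where w: "w \<in> ?N" and x: "x = evalm m w" by blast
    have closed: "bump I (w I) \<in> forms n m" if "I \<in> ksubsets n m" for I
      by (intro fns_bump fns_apply[OF N[OF w]] that)
    have "evalm m (\<Sum>I\<in>X. bump I (w I)) \<in> LinearCombinations.module.span class_ring ?V ?G"
      if "X \<subseteq> ksubsets n m" for X
      using finite_subset[OF that finite_ksubsets] that
    proof induction
      case empty
      show ?case
        unfolding sum.empty evalm_zero V(2)[symmetric] by (rule submodule.zero_closed[OF sub])
    next
      case (insert I X)
      have sum: "(\<Sum>I\<in>X. bump I (w I)) \<in> forms n m"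
        using insert.prems by (intro fns_sum closed) blast
      have I: "I \<in> ksubsets n m" using insert.prems by blast
      have "evalm m (bump I (w I)) \<in> ?G"
        unfolding gen using I w fns_apply[OF N[OF w]] unfolding homogeneous_forms_def by blast
      then have "evalm m (bump I (w I)) \<in> LinearCombinations.module.span class_ring ?V ?G"
        by (rule LinearCombinations.module.in_own_span[OF module_restrict_Omega G, THEN subsetD])
      moreover have "evalm m (\<Sum>I\<in>X. bump I (w I)) \<in> LinearCombinations.module.span class_ring ?V ?G"
        using insert.prems by (intro insert.IH) blast
      ultimately show ?case
        unfolding sum.insert[OF insert.hyps] evalm_add[OF closed[OF I] sum] V(3)[symmetric]
        by (rule submodule.m_closed[OF sub])
    qed
    from this[OF subset_refl] show "x \<in> LinearCombinations.module.span class_ring ?V ?G"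
      unfolding x using fns_eq_sum[OF N[OF w] finite_ksubsets] by simp
  qed
qed

text \<open>As \<open>evalm\<close> is injective, the intersection of the two images is the image of
  the intersection, which \<open>bij_betw_leading\<close> parametrises by the leading
  coefficients.\<close>

lemma has_dimension_component:
  assumes inv: "\<And>j. 0 < j \<Longrightarrow> j \<le> Suc e \<Longrightarrow> of_nat j \<noteq> (0 :: 'k)"
  shows "has_dimension (class_ring :: 'k ring)
    ((restrict_scalars poly_const (Omega (Suc l)))
      \<lparr>carrier := d_irrelevant_power_wedge n (Suc e) (Suc l) \<inter> forms_component n (Suc l) (Suc l + e)\<rparr>)
    (int (card (leading_idx n (Suc l) e)))"
proof -
  let ?T = "leading_idx n (Suc l) e"
  let ?C = "{c. \<forall>t. t \<notin> ?T \<longrightarrow> c t = (0 :: 'k)}"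
  let ?D = "\<lambda>c. ext_deriv (contract n e (of_coords ?T c))"
  let ?X = "grad_forms n (low_ideal n (Suc e)) (Suc l) \<inter> (homogeneous_forms n (Suc l) e :: (nat set \<Rightarrow> 'k mpol) set)"
  let ?V = "(restrict_scalars poly_const (Omega (Suc l)))
      \<lparr>carrier := d_irrelevant_power_wedge n (Suc e) (Suc l) \<inter> forms_component n (Suc l) (Suc l + e)\<rparr>"
  have fin: "finite ?T" by (rule finite_leading_idx)
  have forms: "?D c \<in> forms n (Suc l)" for c :: "_ \<Rightarrow> 'k"
    by (intro ext_deriv_forms contract_forms of_coords_forms[OF fin]) (auto simp: leading_idx_def mons_def)
  have sub: "grad_forms n (low_ideal n (Suc e)) (Suc l) \<subseteq> (forms n (Suc l) :: (nat set \<Rightarrow> 'k mpol) set)"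
    "homogeneous_forms n (Suc l) e \<subseteq> (forms n (Suc l) :: (nat set \<Rightarrow> 'k mpol) set)"
    using rel_forms_subset[OF low_ideal_subset grad_forms_rel_forms] by (auto simp: homogeneous_forms_def)
  have "carrier ?V = evalm (Suc l) ` ?X"
    unfolding d_irrelevant_power_wedge_eq forms_component_eq
    using inj_on_image_Int[OF inj_on_evalm sub] by simp
  moreover have "bij_betw (evalm (Suc l)) ?X (evalm (Suc l) ` ?X)"
    using sub by (intro inj_on_imp_bij_betw inj_on_subset[OF inj_on_evalm]) blast
  ultimately have bij: "bij_betw (\<lambda>c. evalm (Suc l) (?D c)) ?C (carrier ?V)"
    using bij_betw_trans[OF bij_betw_leading[OF inv, where n = n and m = l]] by (simp add: o_def)
  show ?thesis
  proof (rule has_dimension_coordinates[OF fin bij])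
    show "evalm (Suc l) (?D (\<lambda>_. 0)) = \<zero>\<^bsub>?V\<^esub>"
      by (simp add: of_coords_zero[OF fin] contract_zero evalm_zero restrict_scalars_def)
    show "evalm (Suc l) (?D (\<lambda>t. c t + c' t)) = evalm (Suc l) (?D c) \<oplus>\<^bsub>?V\<^esub> evalm (Suc l) (?D c')"
      for c c' :: "_ \<Rightarrow> 'k"
      by (simp add: of_coords_add[OF fin] contract_add ext_deriv_add evalm_add[OF forms forms] restrict_scalars_def)
    show "evalm (Suc l) (?D (\<lambda>t. x * c t)) = x \<odot>\<^bsub>?V\<^esub> evalm (Suc l) (?D c)"
      for x and c :: "_ \<Rightarrow> 'k"
      by (simp add: of_coords_smult[OF fin] contract_const_smul ext_deriv_const_smul
          evalm_const_smul[OF forms] restrict_scalars_def)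
  qed
qed

end

theorem theorem7p8:
  fixes n k :: nat
  assumes "k \<ge> 1" and "n \<ge> 1"
    and "CHAR('k::field) = 0 \<or> CHAR('k) > k"
  shows "(\<forall>m\<ge>1. has_dimension (class_ring :: 'k ring)
      ((restrict_scalars poly_const (poly_forms n m))
        \<lparr>carrier := d_irrelevant_power_wedge n k m \<inter> forms_component n m (m + k - 1)\<rparr>)
      (ibinom n m * ibinom (int n + int k - 2) (int n - 1)
        - ibinom (int m + int k - 2) m * ibinom (int n + int k - 2) (int n - int m - 1)))
    \<and> (\<forall>m\<ge>1. has_dimension (class_ring :: 'k ring)
      (restrict_scalars (trunc_const n k)
        (kaehler_forms (class_ring :: 'k ring) (trunc_ring n k) (trunc_const n k) m))
      (ibinom n m * ibinom (int n + int k - 2) n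
        + ibinom (int m + int k - 2) m * ibinom (int n + int k - 2) (int n - int m - 1)))"
proof -
  \<comment> \<open>The coefficients that matter have degree e = k - 1, and the homotopy raises this
    degree to k.\<close>
  obtain e where k: "k = Suc e" using assms(1) by (cases k) (auto simp: One_nat_def)
  \<comment> \<open>If \<open>of_nat j\<close> were 0, the characteristic would divide j; with 0 < j
    \<le> k it would then be positive and at most k.\<close>
  have inv: "of_nat j \<noteq> (0 :: 'k)" if "0 < j" "j \<le> Suc e" for j
    using assms(3) that dvd_imp_le[of "CHAR('k)" j] by (auto simp: of_nat_eq_0_iff_char_dvd k)
  have J: "presentation.J (trunc_ring n k) n ((+>\<^bsub>poly_ring n\<^esub>) (irrelevant_power n k))
      = (low_ideal n (Suc e) :: 'k mpol set)"
    by (simp add: J_trunc_ring k)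
  show ?thesis
  proof (intro conjI allI impI)
    fix m :: nat assume m: "1 \<le> m"
    then obtain l where l: "m = Suc l" by (cases m) (auto simp: One_nat_def)
    have "m + k - 1 = Suc l + e" by (simp add: k l One_nat_def)
    then show "has_dimension (class_ring :: 'k ring)
        ((restrict_scalars poly_const (poly_forms n m))
          \<lparr>carrier := d_irrelevant_power_wedge n k m \<inter> forms_component n m (m + k - 1)\<rparr>)
        (ibinom n m * ibinom (int n + int k - 2) (int n - 1)
          - ibinom (int m + int k - 2) m * ibinom (int n + int k - 2) (int n - int m - 1))"
      using has_dimension_component[OF inv, where n = n and l = l]
      unfolding card_leading_idx_ibinom[OF assms(2) m[unfolded l]] by (simp only: k l)
    show "has_dimension (class_ring :: 'k ring)
        (restrict_scalars (trunc_const n k)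
          (kaehler_forms (class_ring :: 'k ring) (trunc_ring n k) (trunc_const n k) m))
        (ibinom n m * ibinom (int n + int k - 2) n
          + ibinom (int m + int k - 2) m * ibinom (int n + int k - 2) (int n - int m - 1))"
      using presentation.has_dimension_Omega[OF presentation_trunc_ring J inv, where m = l]
      unfolding card_residual_idx_ibinom[OF assms(2) m[unfolded l]] by (simp only: k l)
  qed
qed

end
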